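(* Assume that $c\in(1,30/29)$ and $h\in\mathcal{F}_c$. Let $\eta\in\mathcal{C}^{\infty}(\mathbb{R})$ be a smooth cut-off function supported in $(1/2,4)$ such that $\eta(x)=1$ for $x\in[1,2]$ and $0\le\eta(x)\le 1$ for $x\in\mathbb{R}$. Define the maximal function $$\mathcal{M}_{h}f(x)=\sup_{N\in\mathbb{N}}|K_{h,N}*f(x)|,\qquad x\in\mathbb{Z},$$ corresponding to the kernels $$K_{h,N}(x)=\frac{1}{|\mathbf{N}_h\cap[1,N]|}\sum_{n\in\mathbf{N}_h\cap[1,N]}\delta_n(x)\,\eta\left(\frac{n}{N}\right),\qquad x\in\mathbb{Z}.$$ Then there is a constant $C>0$, independent of $f$, such that $$\|\mathcal{M}_{h}f\|_{\ell^{1,\infty}(\mathbb{Z})}\le C\|f\|_{\ell^1(\mathbb{Z})}\qquad\text{for every } f\in\ell^1(\mathbb{Z}).$$ In particular, for every $p>1$ there is a constant $C_p>0$ such that $\|\mathcal{M}_hf\|_{\ell^p(\mathbb{Z})}\le C_p\|f\|_{\ell^p(\mathbb{Z})}$ for every $f\in\ell^p(\mathbb{Z})$.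
   Context: $\mathbb{N}=\{1,2,3,\dots\}$. For $c\in(1,2)$, $\mathcal{F}_c$ is the family of all functions $h:[x_0,\infty)\to[1,\infty)$ (for some $x_0\ge1$) such that: (i) $h\in\mathcal{C}^3([x_0,\infty))$ and $h'(x)>0$, $h''(x)>0$ for every $x\ge x_0$; (ii) there exist a real-valued function $\vartheta\in\mathcal{C}^3([x_0,\infty))$ and a constant $C_h>0$ such that $h(x)=C_hx^c\ell_h(x)$ with $\ell_h(x)=e^{\int_{x_0}^x\frac{\vartheta(t)}{t}dt}$ for every $x\ge x_0$, and $\lim_{x\to\infty}\vartheta(x)=\lim_{x\to\infty}x\vartheta'(x)=\lim_{x\to\infty}x^2\vartheta''(x)=\lim_{x\to\infty}x^3\vartheta'''(x)=0$. $\mathbf{N}_h=\{n\in\mathbb{N}:\ \exists\, m\in\mathbb{N},\ m\ge x_0,\ n=\lfloor h(m)\rfloor\}$. The supremum is over those $N\in\mathbb{N}$ with $\mathbf{N}_h\cap[1,N]\neq\emptyset$. $\delta_n(x)=1$ if $x=n$ and $\delta_n(x)=0$ otherwise. $f*g(x)=\sum_{y\in\mathbb{Z}}f(x-y)g(y)$. $\|F\|_{\ell^{1,\infty}(\mathbb{Z})}=\sup_{\lambda>0}\lambda\,|\{x\in\mathbb{Z}:|F(x)|>\lambda\}|$. *)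

theory Defs
  imports "HOL-Analysis.Analysis"
begin

text \<open>Iterated derivative relative to \<open>S\<close>; on \<open>{x\<^sub>0..}\<close> it is one-sided at the endpoint \<open>x\<^sub>0\<close>.\<close>

definition deriv_on :: "real set \<Rightarrow> nat \<Rightarrow> (real \<Rightarrow> real) \<Rightarrow> real \<Rightarrow> real" where
  "deriv_on S k f = ((\<lambda>g x. vector_derivative g (at x within S)) ^^ k) f"

definition C_diff_on :: "nat \<Rightarrow> real set \<Rightarrow> (real \<Rightarrow> real) \<Rightarrow> bool" where
  "C_diff_on k S f \<longleftrightarrow>
     (\<forall>j<k. deriv_on S j f differentiable_on S) \<and> continuous_on S (deriv_on S k f)"

definition smooth :: "(real \<Rightarrow> real) \<Rightarrow> bool" where
  "smooth f \<longleftrightarrow> (\<forall>k. C_diff_on k UNIV f)"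

text \<open>
  A function \<open>h : [x\<^sub>0,\<infinity>) \<rightarrow> [1,\<infinity>)\<close> is given by its left endpoint \<open>x\<^sub>0\<close> and a total function
  \<open>h\<close> of which only the values on \<open>{x\<^sub>0..}\<close> are used. Thus \<open>in_F c x0 h\<close> says that \<open>h\<close>, with
  domain \<open>[x\<^sub>0,\<infinity>)\<close>, belongs to \<open>\<F>\<^sub>c\<close>.
\<close>

definition in_F :: "real \<Rightarrow> real \<Rightarrow> (real \<Rightarrow> real) \<Rightarrow> bool" where
  "in_F c x0 h \<longleftrightarrow>
     x0 \<ge> 1 \<and> (\<forall>x\<ge>x0. h x \<ge> 1) \<and>
     C_diff_on 3 {x0..} h \<and>
     (\<forall>x\<ge>x0. deriv_on {x0..} 1 h x > 0 \<and> deriv_on {x0..} 2 h x > 0) \<and>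
     (\<exists>\<theta> Ch. C_diff_on 3 {x0..} \<theta> \<and> Ch > 0 \<and>
        (\<forall>x\<ge>x0. h x = Ch * x powr c * exp (integral {x0..x} (\<lambda>t. \<theta> t / t))) \<and>
        (\<forall>k\<le>3. ((\<lambda>x. x ^ k * deriv_on {x0..} k \<theta> x) \<longlongrightarrow> 0) at_top))"

definition N_set :: "real \<Rightarrow> (real \<Rightarrow> real) \<Rightarrow> nat set" where
  "N_set x0 h = {n. n \<ge> 1 \<and> (\<exists>m::nat. m \<ge> 1 \<and> real m \<ge> x0 \<and> int n = \<lfloor>h (real m)\<rfloor>)}"

definition delta :: "int \<Rightarrow> int \<Rightarrow> real" where
  "delta n x = (if x = n then 1 else 0)"

definition kernel :: "real \<Rightarrow> (real \<Rightarrow> real) \<Rightarrow> (real \<Rightarrow> real) \<Rightarrow> nat \<Rightarrow> int \<Rightarrow> real" where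
  "kernel x0 h \<eta> N x =
     1 / real (card (N_set x0 h \<inter> {1..N})) *
     (\<Sum>n\<in>N_set x0 h \<inter> {1..N}. delta (int n) x * \<eta> (real n / real N))"

definition conv :: "(int \<Rightarrow> complex) \<Rightarrow> (int \<Rightarrow> complex) \<Rightarrow> int \<Rightarrow> complex" where
  "conv f g x = (\<Sum>\<^sub>\<infinity>y. f (x - y) * g y)"

definition maximal ::
    "real \<Rightarrow> (real \<Rightarrow> real) \<Rightarrow> (real \<Rightarrow> real) \<Rightarrow> (int \<Rightarrow> complex) \<Rightarrow> int \<Rightarrow> ennreal" where
  "maximal x0 h \<eta> f x =
     (SUP N \<in> {N::nat. N \<ge> 1 \<and> N_set x0 h \<inter> {1..N} \<noteq> {}}.
        ennreal (cmod (conv (\<lambda>z. complex_of_real (kernel x0 h \<eta> N z)) f x)))"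

text \<open>The real power of an extended nonnegative number, used for exponents \<open>r > 0\<close> only.\<close>

definition epowr :: "ennreal \<Rightarrow> real \<Rightarrow> ennreal" where
  "epowr a r = (if a = \<infinity> then \<infinity> else ennreal (enn2real a powr r))"

text \<open>The (quasi-)norms are stated for the modulus \<open>F\<close> of a function, which may take the value \<open>\<infinity>\<close>.\<close>

definition lp_norm :: "real \<Rightarrow> (int \<Rightarrow> ennreal) \<Rightarrow> ennreal" where
  "lp_norm p F = epowr (\<integral>\<^sup>+ x. epowr (F x) p \<partial>count_space UNIV) (1 / p)"

definition weak_l1_norm :: "(int \<Rightarrow> ennreal) \<Rightarrow> ennreal" where
  "weak_l1_norm F =
     (SUP s\<in>{0<..}. ennreal s * emeasure (count_space UNIV) {x. F x > ennreal s})"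

definition modulus :: "(int \<Rightarrow> complex) \<Rightarrow> int \<Rightarrow> ennreal" where
  "modulus f x = ennreal (cmod (f x))"

definition lp_space :: "real \<Rightarrow> (int \<Rightarrow> complex) set" where
  "lp_space p = {f. lp_norm p (modulus f) < \<infinity>}"

end

theory Submission
  imports Defs
begin

text \<open>
  Let \<open>\<phi>\<close> be the inverse of \<open>h\<close>, \<open>N = 2 ^ n\<close>, \<open>M = \<phi> N\<close> and \<open>r = N / M\<close>, the typical gap of the set
  \<open>N_set\<close> near \<open>N\<close>. The normalised indicator function of \<open>N_set\<close> on \<open>[N/2, 2N]\<close> is dominated by
  \<open>w (t / N) * F (\<phi> t) / N\<close> with \<open>w\<close> a bump function and \<open>F\<close> the Fejer kernel of order \<open>K ~ r\<close>, because
  \<open>\<phi>\<close> is within \<open>O(1 / r)\<close> of an integer near the points of the set. The zeroth Fourier mode of \<open>F\<close>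
  gives a bounded average \<open>A\<close>; the others give an oscillating kernel \<open>T\<close>. The correlation
  \<open>\<integral> T t * T (t + x)\<close> is a sum over pairs of frequencies \<open>k, l\<close> of oscillatory integrals with phase
  \<open>l * \<phi> (t + x) \<plusminus> k * \<phi> t\<close>. The pairs \<open>k \<noteq> l\<close> save a power of \<open>N\<close>; the pairs \<open>k = l\<close> give at most
  \<open>(r\<^sup>2 / x\<^sup>2) / N\<close>, and for \<open>x\<close> smaller than the gap the decay of \<open>F\<close> is used directly. Hence, up to a
  power saving, the correlation kernel has \<open>\<ell>\<^sup>1\<close> norm \<open>O(1 / M)\<close>.

  For the weak type bound at height \<open>\<lambda>\<close>, at scale \<open>N\<close> one discards the part of \<open>f\<close> above \<open>\<lambda> * M\<close> and the
  part on dyadic intervals of length \<open>N\<close> whose average exceeds \<open>\<lambda>\<close>; the images of both are contained in small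
  sets. On the rest \<open>A\<close> contributes \<open>O(\<lambda>)\<close> pointwise, and the \<open>\<ell>\<^sup>2\<close> norms of the contributions of \<open>T\<close> sum to
  \<open>O(\<lambda> * \<parallel>f\<parallel>\<^sub>1)\<close> since \<open>M\<close> grows geometrically. The bounds for \<open>p > 1\<close> follow by interpolation with
  \<open>\<ell>\<^sup>\<infinity>\<close>.
\<close>

section \<open>Oscillatory integrals\<close>

text \<open>The average is dominated by a nonnegative kernel and the truncation varies with the
  scale, so no cancellation of the discarded parts is needed. As \<phi> moves by O(1/r) per unit
  step, the lower bound for the kernel persists on unit intervals; the integers can thus be replaced
  by the real line, and correlations are integrals, not exponential sums. The delicate pairs are k =
  l: one integration by parts gives only 1 / (k x / r), and the sums over k and over x would both
  lose a logarithm. Second order decay is needed although \<phi> has just three derivatives; hence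
  the special weight and the exact substitution. For k \<noteq> l the derivative of the phase has at
  most one zero because \<phi>' is strictly log-convex: for the power t^\<gamma> with \<gamma> = 1/c
  the relevant expression is \<gamma>^2 (1 - \<gamma>) > 0. Each of the K^2 pairs then costs K^3
  M^(-1/4), in total r^5 M^(-1/4) = N^5 M^(-21/4). With M at least a multiple of N^(29/30), which
  comes from c < 30/29, this is O(N^(-3/40)), summable over dyadic N.\<close>

lemma mean_value_within:
  fixes f :: "real \<Rightarrow> real"
  assumes "a \<le> b"
    and "\<And>x. x \<in> {a..b} \<Longrightarrow> (f has_real_derivative f' x) (at x within {a..b})"
  shows "\<exists>x\<in>{a..b}. f b - f a = f' x * (b - a)"
  by (rule mvt_very_simple[OF assms(1), of f "\<lambda>x. (*) (f' x)"])
     (use assms(2) in \<open>simp add: has_field_derivative_def\<close>)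

text \<open>One integration by parts: \<open>F\<close> is chosen so that its derivative is the
  integrand plus \<open>R\<close>, and both \<open>F\<close> and \<open>R\<close> carry the factor 1
  / \<open>\<Lambda>\<close>. The bound on \<open>G''\<close> takes the place of a monotone
  \<open>G'\<close>.\<close>

lemma oscillatory_integral_bound:
  fixes a a' G G' G'' :: "real \<Rightarrow> real"
  assumes pq: "p \<le> q" and L: "\<Lambda> > 0" and \<eta>: "\<eta> > 0"
    and a: "\<And>t. t \<in> {p..q} \<Longrightarrow> (a has_real_derivative a' t) (at t within {p..q})"
    and G: "\<And>t. t \<in> {p..q} \<Longrightarrow> (G has_real_derivative G' t) (at t within {p..q})"
    and G': "\<And>t. t \<in> {p..q} \<Longrightarrow> (G' has_real_derivative G'' t) (at t within {p..q})"
    and A: "\<And>t. t \<in> {p..q} \<Longrightarrow> \<bar>a t\<bar> \<le> A" "\<And>t. t \<in> {p..q} \<Longrightarrow> \<bar>a' t\<bar> \<le> A"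
    and G'_ge: "\<And>t. t \<in> {p..q} \<Longrightarrow> \<bar>G' t\<bar> \<ge> \<eta>"
    and G''_le: "\<And>t. t \<in> {p..q} \<Longrightarrow> \<bar>G'' t\<bar> \<le> \<Gamma>"
  shows "\<bar>integral {p..q} (\<lambda>t. a t * cos (\<Lambda> * G t))\<bar>
           \<le> A / \<Lambda> * ((2 + (q - p)) / \<eta> + (q - p) * \<Gamma> / \<eta>\<^sup>2)"
proof -
  define F where "F t = a t * sin (\<Lambda> * G t) / (\<Lambda> * G' t)" for t
  define R where "R t = (a' t / G' t - a t * G'' t / (G' t)\<^sup>2) * sin (\<Lambda> * G t) / \<Lambda>" for t
  define I where "I = integral {p..q} (\<lambda>t. a t * cos (\<Lambda> * G t))"
  have nz: "G' t \<noteq> 0" if "t \<in> {p..q}" for t using G'_ge[OF that] \<eta> by auto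
  have A0: "A \<ge> 0" using A(1)[of p] pq by auto
  have G0: "\<Gamma> \<ge> 0" using G''_le[of p] pq by auto
  have dF: "(F has_real_derivative (a t * cos (\<Lambda> * G t) + R t)) (at t within {p..q})" if t: "t \<in> {p..q}" for t
  proof -
    have nz': "\<Lambda> * G' t \<noteq> 0" "G' t \<noteq> 0" using nz[OF t] L by auto
    have "(F has_real_derivative
        ((a' t * sin (\<Lambda> * G t) + (cos (\<Lambda> * G t) * (\<Lambda> * G' t)) * a t) * (\<Lambda> * G' t)
          - (a t * sin (\<Lambda> * G t)) * (\<Lambda> * G'' t)) / ((\<Lambda> * G' t) * (\<Lambda> * G' t))) (at t within {p..q})"
      unfolding F_def
      by (intro DERIV_divide DERIV_mult DERIV_cmult DERIV_chain2[where f=sin, OF DERIV_sin] a[OF t] G[OF t] G'[OF t] nz')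
    moreover have "((a' t * sin (\<Lambda> * G t) + (cos (\<Lambda> * G t) * (\<Lambda> * G' t)) * a t) * (\<Lambda> * G' t)
          - (a t * sin (\<Lambda> * G t)) * (\<Lambda> * G'' t)) / ((\<Lambda> * G' t) * (\<Lambda> * G' t))
        = a t * cos (\<Lambda> * G t) + R t"
      unfolding R_def using nz' L by (simp add: divide_simps power2_eq_square) (simp add: algebra_simps)
    ultimately show ?thesis by simp
  qed
  have 1: "((\<lambda>t. a t * cos (\<Lambda> * G t) + R t) has_integral (F q - F p)) {p..q}"
    by (rule fundamental_theorem_of_calculus[OF pq])
       (use dF in \<open>auto simp: has_real_derivative_iff_has_vector_derivative\<close>)
  have "continuous_on {p..q} a" "continuous_on {p..q} G"
    using DERIV_continuous_on[of "{p..q}" a a'] DERIV_continuous_on[of "{p..q}" G G'] a G by blast+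
  then have "(\<lambda>t. a t * cos (\<Lambda> * G t)) integrable_on {p..q}"
    by (intro integrable_continuous_real continuous_intros)
  then have 2: "((\<lambda>t. a t * cos (\<Lambda> * G t)) has_integral I) {p..q}"
    unfolding I_def by (rule integrable_integral)
  have 3: "(R has_integral (F q - F p - I)) {p..q}"
    using has_integral_diff[OF 1 2] by simp
  have Rb: "norm (R t) \<le> (A / \<eta> + A * \<Gamma> / \<eta>\<^sup>2) / \<Lambda>" if t: "t \<in> {p..q}" for t
  proof -
    have s1: "\<bar>a' t / G' t\<bar> \<le> A / \<eta>"
      unfolding abs_divide using A(2)[OF t] G'_ge[OF t] \<eta> by (intro frac_le) auto
    have s2: "\<bar>a t * G'' t / (G' t)\<^sup>2\<bar> \<le> A * \<Gamma> / \<eta>\<^sup>2"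
    proof -
      have "\<bar>a t * G'' t\<bar> \<le> A * \<Gamma>"
        unfolding abs_mult using A(1)[OF t] G''_le[OF t] A0 by (intro mult_mono) auto
      moreover have "\<eta>\<^sup>2 \<le> \<bar>(G' t)\<^sup>2\<bar>"
        using power_mono[OF G'_ge[OF t], of 2] \<eta> by simp
      ultimately show ?thesis unfolding abs_divide using A0 G0 \<eta> by (intro frac_le) auto
    qed
    have "\<bar>a' t / G' t - a t * G'' t / (G' t)\<^sup>2\<bar> \<le> A / \<eta> + A * \<Gamma> / \<eta>\<^sup>2"
      using s1 s2 by linarith
    then have "\<bar>a' t / G' t - a t * G'' t / (G' t)\<^sup>2\<bar> * \<bar>sin (\<Lambda> * G t)\<bar> \<le> (A / \<eta> + A * \<Gamma> / \<eta>\<^sup>2) * 1"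
      by (intro mult_mono) auto
    then show ?thesis unfolding R_def using L
      by (simp add: abs_mult abs_divide divide_right_mono)
  qed
  have 4: "\<bar>F q - F p - I\<bar> \<le> (A / \<eta> + A * \<Gamma> / \<eta>\<^sup>2) / \<Lambda> * (q - p)"
    using has_integral_bound_real[OF _ finite.emptyI 3, of "(A / \<eta> + A * \<Gamma> / \<eta>\<^sup>2) / \<Lambda>"] Rb A0 G0 \<eta> L pq
    by (auto simp: content_real)
  have Fb: "\<bar>F t\<bar> \<le> A / (\<Lambda> * \<eta>)" if t: "t \<in> {p..q}" for t
  proof -
    have "\<bar>a t\<bar> * \<bar>sin (\<Lambda> * G t)\<bar> \<le> A * 1"
      using A(1)[OF t] A0 by (intro mult_mono) auto
    then show ?thesis unfolding F_def abs_divide abs_mult using L \<eta> A0 G'_ge[OF t]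
      by (intro frac_le) auto
  qed
  have "\<bar>I\<bar> \<le> 2 * (A / (\<Lambda> * \<eta>)) + (A / \<eta> + A * \<Gamma> / \<eta>\<^sup>2) / \<Lambda> * (q - p)"
    using 4 Fb[of p] Fb[of q] pq by auto
  also have "\<dots> = A / \<Lambda> * ((2 + (q - p)) / \<eta> + (q - p) * \<Gamma> / \<eta>\<^sup>2)"
    using L \<eta> by (simp add: field_simps)
  finally show ?thesis unfolding I_def .
qed

lemma abs_integral_le:
  fixes f :: "real \<Rightarrow> real"
  assumes "p \<le> q" "continuous_on {p..q} f" "\<And>t. t \<in> {p..q} \<Longrightarrow> \<bar>f t\<bar> \<le> A"
  shows "\<bar>integral {p..q} f\<bar> \<le> A * (q - p)"
proof -
  have "A \<ge> 0" using assms(1) assms(3)[of p] by auto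
  then show ?thesis
    using has_integral_bound_real[OF _ finite.emptyI integrable_integral[OF integrable_continuous_real[OF assms(2)]], of A] assms
    by (auto simp: content_real)
qed

text \<open>The window of radius \<open>\<delta>\<close> about \<open>t0\<close> is estimated
  trivially; outside it \<open>G'\<close> is at least \<open>\<mu> * \<delta>\<close>, so the
  non-stationary bound applies on each side. \<open>\<delta>\<close> stays free and is later
  balanced against \<open>M\<close>.\<close>

lemma stationary_integral_bound:
  fixes a a' G G' G'' :: "real \<Rightarrow> real"
  assumes pq: "p \<le> q" and L: "\<Lambda> > 0" and \<mu>: "\<mu> > 0" and \<delta>: "\<delta> > 0" and t0: "t0 \<in> {p..q}"
    and a: "\<And>t. t \<in> {p..q} \<Longrightarrow> (a has_real_derivative a' t) (at t within {p..q})"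
    and G: "\<And>t. t \<in> {p..q} \<Longrightarrow> (G has_real_derivative G' t) (at t within {p..q})"
    and G': "\<And>t. t \<in> {p..q} \<Longrightarrow> (G' has_real_derivative G'' t) (at t within {p..q})"
    and A: "\<And>t. t \<in> {p..q} \<Longrightarrow> \<bar>a t\<bar> \<le> A" "\<And>t. t \<in> {p..q} \<Longrightarrow> \<bar>a' t\<bar> \<le> A"
    and G'_ge: "\<And>t. t \<in> {p..q} \<Longrightarrow> \<bar>G' t\<bar> \<ge> \<mu> * \<bar>t - t0\<bar>"
    and G''_le: "\<And>t. t \<in> {p..q} \<Longrightarrow> \<bar>G'' t\<bar> \<le> \<Gamma>"
  shows "\<bar>integral {p..q} (\<lambda>t. a t * cos (\<Lambda> * G t))\<bar>
           \<le> 2 * A * \<delta> + 2 * (A / \<Lambda> * ((2 + (q - p)) / (\<mu> * \<delta>) + (q - p) * \<Gamma> / (\<mu> * \<delta>)\<^sup>2))"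
proof -
  define u v where "u = max p (t0 - \<delta>)" and "v = min q (t0 + \<delta>)"
  define f where "f = (\<lambda>t. a t * cos (\<Lambda> * G t))"
  define S where "S = A / \<Lambda> * ((2 + (q - p)) / (\<mu> * \<delta>) + (q - p) * \<Gamma> / (\<mu> * \<delta>)\<^sup>2)"
  have uv: "p \<le> u" "u \<le> t0" "t0 \<le> v" "v \<le> q" "v - u \<le> 2 * \<delta>"
    using t0 \<delta> unfolding u_def v_def by auto
  have A0: "A \<ge> 0" using A(1)[of p] pq by auto
  have G0: "\<Gamma> \<ge> 0" using G''_le[of p] pq by auto
  have cont: "continuous_on {p..q} f"
  proof -
    have "continuous_on {p..q} a" "continuous_on {p..q} G"
      using DERIV_continuous_on[of "{p..q}" a a'] DERIV_continuous_on[of "{p..q}" G G'] a G by blast+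
    then show ?thesis unfolding f_def by (intro continuous_intros)
  qed
  have S0: "S \<ge> 0" unfolding S_def using A0 G0 L \<mu> \<delta> pq by (auto intro!: mult_nonneg_nonneg add_nonneg_nonneg divide_nonneg_nonneg)
  have part: "\<bar>integral {p'..q'} f\<bar> \<le> S" if "p \<le> p'" "p' \<le> q'" "q' \<le> q" "\<And>t. t \<in> {p'..q'} \<Longrightarrow> \<bar>t - t0\<bar> \<ge> \<delta>" for p' q'
  proof -
    have sub: "{p'..q'} \<subseteq> {p..q}" using that by auto
    have "\<bar>integral {p'..q'} f\<bar> \<le> A / \<Lambda> * ((2 + (q' - p')) / (\<mu> * \<delta>) + (q' - p') * \<Gamma> / (\<mu> * \<delta>)\<^sup>2)"
      unfolding f_def
    proof (rule oscillatory_integral_bound[where a'=a' and G'=G' and G''=G''])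
      show "\<mu> * \<delta> \<le> \<bar>G' t\<bar>" if t: "t \<in> {p'..q'}" for t
      proof -
        have "\<mu> * \<delta> \<le> \<mu> * \<bar>t - t0\<bar>" using that(1) \<open>\<And>t. t \<in> {p'..q'} \<Longrightarrow> \<bar>t - t0\<bar> \<ge> \<delta>\<close> \<mu> by simp
        also have "\<dots> \<le> \<bar>G' t\<bar>" using G'_ge sub t by blast
        finally show ?thesis .
      qed
    qed (use that sub L \<mu> \<delta> a G G' A G''_le in \<open>auto intro: DERIV_subset[OF _ sub]\<close>)
    also have "\<dots> \<le> S" unfolding S_def using that A0 G0 L \<mu> \<delta>
      by (intro mult_left_mono add_mono divide_right_mono mult_right_mono) auto
    finally show ?thesis .
  qed
  have left: "\<bar>integral {p..u} f\<bar> \<le> S"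
  proof (cases "u = p")
    case True then show ?thesis using S0 by simp
  next
    case False
    then have "u = t0 - \<delta>" unfolding u_def by (auto simp: max_def split: if_splits)
    then show ?thesis using uv t0 by (intro part) auto
  qed
  have right: "\<bar>integral {v..q} f\<bar> \<le> S"
  proof (cases "v = q")
    case True then show ?thesis using S0 by simp
  next
    case False
    then have "v = t0 + \<delta>" unfolding v_def by (auto simp: min_def split: if_splits)
    then show ?thesis using uv t0 by (intro part) auto
  qed
  have mid: "\<bar>integral {u..v} f\<bar> \<le> A * (v - u)"
  proof (rule abs_integral_le)
    show "continuous_on {u..v} f" using cont uv by (auto elim: continuous_on_subset)
    show "\<bar>f t\<bar> \<le> A" if "t \<in> {u..v}" for t
    proof -
      have "\<bar>a t\<bar> * \<bar>cos (\<Lambda> * G t)\<bar> \<le> A * 1" using A(1)[of t] that uv A0 by (intro mult_mono) auto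
      then show ?thesis unfolding f_def by (simp add: abs_mult)
    qed
  qed (use uv in auto)
  have int: "f integrable_on {p..q}" using cont by (rule integrable_continuous_real)
  have "integral {p..q} f = integral {p..u} f + integral {u..q} f"
    using uv int by (intro Henstock_Kurzweil_Integration.integral_combine[symmetric]) auto
  also have "integral {u..q} f = integral {u..v} f + integral {v..q} f"
    using uv integrable_subinterval_real[OF int, of u q] by (intro Henstock_Kurzweil_Integration.integral_combine[symmetric]) auto
  finally have "\<bar>integral {p..q} f\<bar> \<le> A * (v - u) + 2 * S"
    using left right mid by linarith
  also have "\<dots> \<le> A * (2 * \<delta>) + 2 * S" using uv A0 by (intro add_mono mult_left_mono) auto
  finally show ?thesis unfolding f_def S_def by simp
qed

text \<open>\<open>t0\<close> is a point where \<open>R\<close> takes the value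
  \<open>\<kappa>\<close>, or the endpoint closest to this if the value is not attained. Phases
  without a stationary point therefore need no separate treatment.\<close>

lemma increasing_lower_bound:
  fixes R :: "real \<Rightarrow> real"
  assumes pq: "p \<le> q"
    and R: "\<And>t. t \<in> {p..q} \<Longrightarrow> (R has_real_derivative R' t) (at t within {p..q})"
    and R': "\<And>t. t \<in> {p..q} \<Longrightarrow> R' t \<ge> m" and m: "m \<ge> 0"
  shows "\<exists>t0\<in>{p..q}. \<forall>t\<in>{p..q}. \<bar>R t - \<kappa>\<bar> \<ge> m * \<bar>t - t0\<bar>"
proof -
  have gr: "R t - R s \<ge> m * (t - s)" if "p \<le> s" "s \<le> t" "t \<le> q" for s t
  proof -
    have "\<exists>x\<in>{s..t}. R t - R s = R' x * (t - s)"
      by (rule mean_value_within[OF \<open>s \<le> t\<close>], rule DERIV_subset[OF R]) (use that in auto)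
    then obtain x where "x \<in> {s..t}" "R t - R s = R' x * (t - s)" by blast
    moreover have "R' x * (t - s) \<ge> m * (t - s)"
      using R'[of x] \<open>x \<in> {s..t}\<close> that by (intro mult_right_mono) auto
    ultimately show ?thesis by simp
  qed
  have cont: "continuous_on {p..q} R" using DERIV_continuous_on[of "{p..q}" R R'] R by blast
  consider "R p \<ge> \<kappa>" | "R q \<le> \<kappa>" | "R p \<le> \<kappa>" "\<kappa> \<le> R q" by linarith
  then obtain t0 where t0: "t0 \<in> {p..q}" "t0 = p \<and> R p \<ge> \<kappa> \<or> t0 = q \<and> R q \<le> \<kappa> \<or> R t0 = \<kappa>"
  proof cases
    case 3
    then obtain x where "p \<le> x" "x \<le> q" "R x = \<kappa>" using IVT'[of R p \<kappa> q] cont pq by auto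
    then show ?thesis using that by auto
  qed (use that pq in auto)
  have "\<bar>R t - \<kappa>\<bar> \<ge> m * \<bar>t - t0\<bar>" if t: "t \<in> {p..q}" for t
  proof (cases "t0 \<le> t")
    case True
    then have "R t - R t0 \<ge> m * \<bar>t - t0\<bar>" using gr[of t0 t] t t0 by auto
    moreover have "m * \<bar>t - t0\<bar> \<ge> 0" using m by simp
    ultimately show ?thesis using t0(2) True t by auto
  next
    case False
    then have "R t0 - R t \<ge> m * \<bar>t - t0\<bar>" using gr[of t t0] t t0 by auto
    moreover have "m * \<bar>t - t0\<bar> \<ge> 0" using m by simp
    ultimately show ?thesis using t0(2) False t by auto
  qed
  then show ?thesis using t0(1) by blast
qed

section \<open>The Fejer kernel\<close>

text \<open>Normalised to mean 1 over a period, hence of height \<open>K\<close> at the integers.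
  The squared modulus shows positivity, which the cosine expansion \<open>fejer_expand\<close>
  hides.\<close>

definition fejer :: "nat \<Rightarrow> real \<Rightarrow> real" where
  "fejer K u = (cmod (\<Sum>j<K. cis (2 * pi * u) ^ j))\<^sup>2 / real K"

lemma fejer_nonneg: "fejer K u \<ge> 0"
  by (simp add: fejer_def)

lemma fejer_add_int: "fejer K (u + of_int m) = fejer K u"
proof -
  have "cis (2 * pi * (u + of_int m)) = cis (2 * pi * u) * cis (2 * pi * of_int m)"
    by (simp add: cis_mult algebra_simps)
  also have "cis (2 * pi * of_int m) = 1" by simp
  finally show ?thesis by (simp add: fejer_def)
qed

lemma fejer_le: "fejer K u \<le> real K"
proof -
  have "cmod (\<Sum>j<K. cis (2 * pi * u) ^ j) \<le> (\<Sum>j<K. 1)"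
    by (rule sum_norm_le) (simp add: norm_power)
  then have "(cmod (\<Sum>j<K. cis (2 * pi * u) ^ j))\<^sup>2 \<le> (real K)\<^sup>2"
    by (intro power_mono) auto
  then have "fejer K u \<le> (real K)\<^sup>2 / real K"
    unfolding fejer_def by (intro divide_right_mono) auto
  then show ?thesis by (simp add: power2_eq_square split: if_splits)
qed

text \<open>The sum is geometric, and the distance of its ratio from 1 is twice the modulus of sin
  (pi u).\<close>

lemma fejer_sin_le: "fejer K u * (sin (pi * u))\<^sup>2 \<le> 1 / real K"
proof -
  let ?z = "cis (2 * pi * u)" and ?S = "\<Sum>j<K. cis (2 * pi * u) ^ j"
  have "1 - ?z ^ K = (1 - ?z) * ?S" by (rule one_diff_power_eq)
  then have "cmod (1 - ?z) * cmod ?S = cmod (1 - ?z ^ K)" by (simp add: norm_mult)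
  also have "\<dots> \<le> 2"
    using norm_triangle_ineq4[of 1 "?z ^ K"] by (simp add: norm_power)
  finally have 1: "cmod (1 - ?z) * cmod ?S \<le> 2" .
  have "cmod (1 - ?z) = 2 * \<bar>sin (pi * u)\<bar>"
    using dist_exp_i_1[of "2 * pi * u"] by (simp add: cis_conv_exp norm_minus_commute)
  then have "\<bar>sin (pi * u)\<bar> * cmod ?S \<le> 1" using 1 by simp
  then have "(\<bar>sin (pi * u)\<bar> * cmod ?S)\<^sup>2 \<le> 1\<^sup>2" by (intro power_mono) auto
  then have "(cmod ?S)\<^sup>2 * (sin (pi * u))\<^sup>2 \<le> 1" by (simp add: power_mult_distrib mult.commute)
  then show ?thesis unfolding fejer_def by (simp add: divide_right_mono)
qed

text \<open>For such \<open>u\<close> all angles have modulus at most pi / 4 < pi / 3, so every term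
  of the sum has real part at least 1 / 2. This lets the kernel dominate an indicator function near
  the integers.\<close>

lemma fejer_ge:
  assumes "\<bar>u\<bar> * (8 * real K) \<le> 1"
  shows "fejer K u \<ge> real K / 4"
proof (cases "K = 0")
  case False
  let ?S = "\<Sum>j<K. cis (2 * pi * u) ^ j"
  have "1 / 2 \<le> cos (real j * (2 * pi * u))" if "j < K" for j
  proof -
    have "8 * (real j * \<bar>u\<bar>) \<le> 8 * (real K * \<bar>u\<bar>)"
      using that by (intro mult_left_mono mult_right_mono) auto
    then have "8 * (real j * \<bar>u\<bar>) \<le> 1" using assms by (simp add: algebra_simps)
    then have "pi * (8 * (real j * \<bar>u\<bar>)) \<le> pi * 1" by (intro mult_left_mono) auto
    moreover have "\<bar>real j * (2 * pi * u)\<bar> = pi * (8 * (real j * \<bar>u\<bar>)) / 4" by (simp add: abs_mult)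
    ultimately have "\<bar>real j * (2 * pi * u)\<bar> \<le> pi / 3" using pi_gt_zero by linarith
    then have "cos (pi / 3) \<le> cos \<bar>real j * (2 * pi * u)\<bar>"
      using pi_gt_zero by (intro cos_monotone_0_pi_le) auto
    then show ?thesis by (simp add: cos_60)
  qed
  then have "(\<Sum>j<K. 1 / 2) \<le> (\<Sum>j<K. cos (real j * (2 * pi * u)))" by (intro sum_mono) auto
  also have "\<dots> = Re ?S" by (simp add: Complex.DeMoivre)
  also have "\<dots> \<le> cmod ?S" by (rule complex_Re_le_cmod)
  finally have "real K / 2 \<le> cmod ?S" by simp
  then have "(real K / 2)\<^sup>2 \<le> (cmod ?S)\<^sup>2" by (intro power_mono) auto
  then have "(real K / 2)\<^sup>2 / real K \<le> fejer K u"
    unfolding fejer_def by (intro divide_right_mono) auto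
  moreover have "(real K / 2)\<^sup>2 / real K = real K / 4" using False by (simp add: power2_eq_square)
  ultimately show ?thesis by simp
qed (simp add: fejer_def)

text \<open>Adding the term of index \<open>K\<close> contributes 1 and twice each cos (k x) with 1
  <= k <= K, which raises every weight K - k to K + 1 - k.\<close>

lemma norm_sum_cis_square:
  "(cmod (\<Sum>j<K. cis x ^ j))\<^sup>2 = real K + 2 * (\<Sum>k=1..<K. (real K - real k) * cos (real k * x))"
proof (induction K)
  case (Suc K)
  let ?S = "\<Sum>j<K. cis x ^ j"
  have "(cmod (?S + cis x ^ K))\<^sup>2 = (cmod ?S)\<^sup>2 + 1 + 2 * Re (?S * cnj (cis x ^ K))"
  proof -
    have "(cmod (z + w))\<^sup>2 = (cmod z)\<^sup>2 + (cmod w)\<^sup>2 + 2 * Re (z * cnj w)" for z w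
      by (simp only: cmod_power2) (simp add: power2_eq_square algebra_simps)
    from this[of ?S "cis x ^ K"] show ?thesis by (simp add: norm_power)
  qed
  also have "Re (?S * cnj (cis x ^ K)) = (\<Sum>j<K. cos ((real K - real j) * x))"
  proof -
    have "Re (cis x ^ j * cnj (cis x ^ K)) = cos ((real K - real j) * x)" for j
      using cos_minus[of "(real K - real j) * x"] by (simp add: Complex.DeMoivre cis_cnj cis_mult algebra_simps del: cos_minus)
    then show ?thesis by (simp only: sum_distrib_right Re_sum)
  qed
  also have "\<dots> = (\<Sum>k=1..<Suc K. cos (real k * x))"
    by (rule sum.reindex_bij_witness[of _ "\<lambda>k. K - k" "\<lambda>j. K - j"]) (auto simp: of_nat_diff)
  also have "(cmod ?S)\<^sup>2 + 1 + 2 * \<dots> = real (Suc K) + 2 * ((\<Sum>k=1..<K. (real K - real k) * cos (real k * x)) + (\<Sum>k=1..<Suc K. cos (real k * x)))"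
    by (simp add: Suc.IH)
  also have "(\<Sum>k=1..<K. (real K - real k) * cos (real k * x)) = (\<Sum>k=1..<Suc K. (real K - real k) * cos (real k * x))"
    by (cases "K = 0") auto
  also have "\<dots> + (\<Sum>k=1..<Suc K. cos (real k * x)) = (\<Sum>k=1..<Suc K. (real (Suc K) - real k) * cos (real k * x))"
    unfolding sum.distrib[symmetric] by (intro sum.cong) (auto simp: algebra_simps)
  finally show ?case by simp
qed simp

lemma fejer_expand:
  assumes "K \<ge> 1"
  shows "fejer K u = 1 + 2 * (\<Sum>k=1..<K. (1 - real k / real K) * cos (2 * pi * (real k * u)))"
proof -
  have "fejer K u = (real K + 2 * (\<Sum>k=1..<K. (real K - real k) * cos (real k * (2 * pi * u)))) / real K"
    unfolding fejer_def norm_sum_cis_square ..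
  also have "\<dots> = 1 + 2 * (\<Sum>k=1..<K. (real K - real k) * cos (real k * (2 * pi * u)) / real K)"
    using assms by (simp add: add_divide_distrib flip: sum_divide_distrib)
  also have "(\<Sum>k=1..<K. (real K - real k) * cos (real k * (2 * pi * u)) / real K)
      = (\<Sum>k=1..<K. (1 - real k / real K) * cos (2 * pi * (real k * u)))"
    using assms by (intro sum.cong) (auto simp: field_simps)
  finally show ?thesis .
qed

text \<open>A weak form of Jordan's inequality, from the cubic Taylor bound and 3 <= pi <= 16 /
  5.\<close>

lemma sin_pi_ge:
  assumes "0 \<le> x" "x \<le> 1 / 2"
  shows "x \<le> sin (pi * x)"
proof -
  have "\<bar>sin (pi * x) - pi * x\<bar> \<le> inverse 6 * \<bar>pi * x\<bar> ^ 3"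
    using Maclaurin_sin_bound[of "pi * x" 3]
    by (simp add: numeral_3_eq_3 sin_coeff_def fact_numeral)
  then have 1: "sin (pi * x) \<ge> pi * x - (pi * x) ^ 3 / 6"
    using assms abs_ge_minus_self[of "sin (pi * x) - pi * x"] by simp
  have le: "pi * x \<le> 16 / 5 * (1 / 2)" using assms pi_approx by (intro mult_mono) auto
  have "(pi * x) * (pi * x) * (pi * x) \<le> 8 / 5 * (8 / 5) * (pi * x)"
    using le assms by (intro mult_right_mono mult_mono) auto
  then have "(pi * x) ^ 3 \<le> 64 / 25 * (pi * x)" by (simp add: power3_eq_cube)
  moreover have "pi * x \<ge> 3 * x" using assms pi_approx by (intro mult_right_mono) auto
  ultimately show ?thesis using 1 assms by linarith
qed

text \<open>The addition formula for sin (pi x) forces one of the sines at \<open>u\<close> and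
  \<open>u + x\<close> to have modulus at least \<open>x / 2\<close>; the kernel there is at most 1
  / (K (x / 2)^2). Two points at distance \<open>x\<close> cannot both lie near integers, which is
  the decay used for shifts below the gap.\<close>

lemma fejer_mult_le:
  assumes "0 < x" "x \<le> 1 / 2"
  shows "fejer K u * fejer K (u + x) \<le> 4 / (real K * x\<^sup>2) * (fejer K u + fejer K (u + x))"
proof -
  have small: "fejer K w \<le> 4 / (real K * x\<^sup>2)" if "\<bar>sin (pi * w)\<bar> \<ge> x / 2" for w
  proof -
    have "(x / 2)\<^sup>2 \<le> (sin (pi * w))\<^sup>2" using power_mono[OF that, of 2] assms by simp
    then have "fejer K w * (x / 2)\<^sup>2 \<le> fejer K w * (sin (pi * w))\<^sup>2"
      using fejer_nonneg by (intro mult_left_mono)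
    also have "\<dots> \<le> 1 / real K" by (rule fejer_sin_le)
    finally have "fejer K w \<le> 1 / real K / (x / 2)\<^sup>2" using assms by (subst pos_le_divide_eq) auto
    then show ?thesis by (simp add: power_divide mult.commute)
  qed
  have "sin (pi * x) = sin (pi * (u + x)) * cos (pi * u) - cos (pi * (u + x)) * sin (pi * u)"
    using sin_diff[of "pi * (u + x)" "pi * u"] by (simp add: distrib_left)
  also have "\<bar>\<dots>\<bar> \<le> \<bar>sin (pi * (u + x)) * cos (pi * u)\<bar> + \<bar>cos (pi * (u + x)) * sin (pi * u)\<bar>" by linarith
  also have "\<dots> \<le> \<bar>sin (pi * (u + x))\<bar> * 1 + 1 * \<bar>sin (pi * u)\<bar>"
    unfolding abs_mult by (intro add_mono mult_mono) auto
  finally have "\<bar>sin (pi * x)\<bar> \<le> \<bar>sin (pi * (u + x))\<bar> + \<bar>sin (pi * u)\<bar>" by simp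
  then have "x \<le> \<bar>sin (pi * (u + x))\<bar> + \<bar>sin (pi * u)\<bar>" using sin_pi_ge[of x] assms by simp
  then consider "\<bar>sin (pi * u)\<bar> \<ge> x / 2" | "\<bar>sin (pi * (u + x))\<bar> \<ge> x / 2" by linarith
  then show ?thesis
  proof cases
    case 1
    have "fejer K u * fejer K (u + x) \<le> 4 / (real K * x\<^sup>2) * fejer K (u + x)"
      using small[OF 1] fejer_nonneg by (intro mult_right_mono)
    moreover have "0 \<le> 4 / (real K * x\<^sup>2) * fejer K u" using fejer_nonneg by simp
    ultimately show ?thesis by (simp add: distrib_left)
  next
    case 2
    have "fejer K u * fejer K (u + x) \<le> fejer K u * (4 / (real K * x\<^sup>2))"
      using small[OF 2] fejer_nonneg by (intro mult_left_mono)
    moreover have "0 \<le> 4 / (real K * x\<^sup>2) * fejer K (u + x)" using fejer_nonneg by simp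
    ultimately show ?thesis by (simp add: algebra_simps add_divide_distrib)
  qed
qed

lemma fejer_mult_le_trivial:
  "fejer K u * fejer K v \<le> real K * (fejer K u + fejer K v)"
proof -
  have "fejer K u * fejer K v \<le> real K * fejer K v"
    using fejer_le fejer_nonneg by (intro mult_right_mono)
  then show ?thesis using fejer_nonneg[of K u] by (simp add: distrib_left add.commute add_increasing)
qed

lemma continuous_on_fejer [continuous_intros]:
  assumes "continuous_on S f"
  shows "continuous_on S (\<lambda>x. fejer K (f x))"
  unfolding fejer_def divide_inverse by (intro continuous_intros continuous_on_cis assms)

section \<open>Correlations of a weighted Fejer kernel along a curve\<close>

lemma has_real_derivative_max_0_power:
  fixes x :: real
  assumes "n \<ge> 2"
  shows "((\<lambda>x. (max 0 x) ^ n) has_real_derivative (real n * (max 0 x) ^ (n - 1))) (at x)"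
proof -
  consider "x < 0" | "x > 0" | "x = 0" by linarith
  then show ?thesis
  proof cases
    case 1
    have "((\<lambda>x. 0) has_real_derivative 0) (at x)" by simp
    then have "((\<lambda>x. (max 0 x) ^ n) has_real_derivative 0) (at x)"
      by (rule has_field_derivative_transform_within_open[of _ _ _ "{..<0}"]) (use 1 assms in auto)
    then show ?thesis using 1 assms by (simp add: power_0_left)
  next
    case 2
    have "((\<lambda>x. x ^ n) has_real_derivative (real n * x ^ (n - 1))) (at x)"
      using DERIV_pow[of n x] by simp
    then have "((\<lambda>x. (max 0 x) ^ n) has_real_derivative (real n * x ^ (n - 1))) (at x)"
      by (rule has_field_derivative_transform_within_open[of _ _ _ "{0<..}"]) (use 2 in auto)
    then show ?thesis using 2 by simp
  next
    case 3
    \<comment> \<open>The difference quotient at 0 is either 0 or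
      \<open>(max 0 h) ^ (n - 1)\<close>; it tends to 0 because n >= 2.\<close>
    have "((\<lambda>h::real. (max 0 h) ^ n / h) \<longlongrightarrow> 0) (at 0)"
    proof (rule Lim_null_comparison[where g = "\<lambda>h. \<bar>h\<bar> ^ (n - 1)"])
      show "eventually (\<lambda>h. norm ((max 0 h) ^ n / h) \<le> \<bar>h\<bar> ^ (n - 1)) (at (0::real))"
      proof (rule eventuallyI)
        fix h :: real
        have "(max 0 h) ^ n / h = (max 0 h) ^ (n - 1) \<or> (max 0 h) ^ n / h = 0"
          using assms by (cases "h > 0") (auto simp: max_def power_eq_if[of h n] )
        moreover have "(max 0 h) ^ (n - 1) \<le> \<bar>h\<bar> ^ (n - 1)" by (intro power_mono) auto
        moreover have "0 \<le> (max 0 h) ^ (n - 1)" by simp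
        ultimately show "norm ((max 0 h) ^ n / h) \<le> \<bar>h\<bar> ^ (n - 1)"
          by (elim disjE) (simp_all only: real_norm_def abs_of_nonneg abs_zero zero_le_power abs_ge_zero)
      qed
      have "((\<lambda>h::real. \<bar>h\<bar> ^ (n - 1)) \<longlongrightarrow> \<bar>0\<bar> ^ (n - 1)) (at 0)" by (intro tendsto_intros)
      then show "((\<lambda>h::real. \<bar>h\<bar> ^ (n - 1)) \<longlongrightarrow> 0) (at 0)" using assms by (simp add: power_0_left)
    qed
    then show ?thesis using 3 assms by (simp add: DERIV_def power_0_left)
  qed
qed

text \<open>The roots 1 / 10 and 8 are the slope bounds in the assumption \<open>ends\<close> of the
  locale \<open>profile\<close>, so the bump vanishes at both ends of the interval of
  integration.\<close>

definition quad :: "real \<Rightarrow> real" where "quad s = (s - 1 / 10) * (8 - s)"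

text \<open>Squaring the positive part makes \<open>bump\<close> continuously differentiable. Its
  own square, a fourth power, has the second derivative that the two integrations by parts in
  \<open>weight_integral\<close> consume.\<close>

definition bump :: "real \<Rightarrow> real" where "bump s = (max 0 (quad s))\<^sup>2"

definition bump' :: "real \<Rightarrow> real" where "bump' s = 2 * max 0 (quad s) * (81 / 10 - 2 * s)"

lemma DERIV_quad: "(quad has_real_derivative (81 / 10 - 2 * s)) (at s within S)"
  unfolding quad_def by (auto intro!: derivative_eq_intros)

lemma DERIV_quad_power:
  "n \<ge> 2 \<Longrightarrow> ((\<lambda>s. (max 0 (quad s)) ^ n) has_real_derivative
     (real n * (max 0 (quad s)) ^ (n - 1) * (81 / 10 - 2 * s))) (at s within S)"
  by (rule DERIV_chain2[OF has_real_derivative_max_0_power DERIV_quad])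

lemma DERIV_bump: "(bump has_real_derivative bump' s) (at s within S)"
  using DERIV_quad_power[of 2 s S] by (simp add: bump_def[abs_def] bump'_def)

lemma quad_le: "quad s \<le> 16"
proof -
  have "quad s = 156025 / 10000 - (s - 81 / 20)\<^sup>2" by (simp add: quad_def power2_eq_square field_simps)
  then show ?thesis using zero_le_power2[of "s - 81/20"] by linarith
qed

lemma quad_neg: "s \<le> 1 / 10 \<or> s \<ge> 8 \<Longrightarrow> quad s \<le> 0"
  unfolding quad_def by (auto intro: mult_nonpos_nonneg mult_nonneg_nonpos)

lemma max_quad: "0 \<le> max 0 (quad s)" "max 0 (quad s) \<le> 16" "\<bar>max 0 (quad s) * (81 / 10 - 2 * s)\<bar> \<le> 128"
proof -
  show *: "0 \<le> max 0 (quad s)" "max 0 (quad s) \<le> 16" using quad_le[of s] by auto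
  show "\<bar>max 0 (quad s) * (81 / 10 - 2 * s)\<bar> \<le> 128"
  proof (cases "s \<le> 1 / 10 \<or> s \<ge> 8")
    case True then have "max 0 (quad s) = 0" using quad_neg[of s] by simp
    then show ?thesis by simp
  next
    case False
    then have "\<bar>81 / 10 - 2 * s\<bar> \<le> 8" by auto
    then have "max 0 (quad s) * \<bar>81 / 10 - 2 * s\<bar> \<le> 16 * 8" using * by (intro mult_mono) auto
    then show ?thesis using * by (simp add: abs_mult)
  qed
qed

lemma bump_bounds: "0 \<le> bump s" "bump s \<le> 256" "\<bar>bump' s\<bar> \<le> 256"
proof -
  show "0 \<le> bump s" by (simp add: bump_def)
  show "bump s \<le> 256" using power_mono[OF max_quad(2)[of s] max_quad(1), of 2] by (simp add: bump_def)
  show "\<bar>bump' s\<bar> \<le> 256" using max_quad(3)[of s] by (simp add: bump'_def abs_mult)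
qed

lemma bump_eq_0: "s \<le> 1 / 10 \<or> s \<ge> 8 \<Longrightarrow> bump s = 0"
  using quad_neg[of s] by (simp add: bump_def)

lemma bump_ge:
  assumes "1 / 5 \<le> s" "s \<le> 4"
  shows "bump s \<ge> 16 / 100"
proof -
  have "(1 / 10) * 4 \<le> (s - 1 / 10) * (8 - s)" using assms by (intro mult_mono) auto
  then have "(4 / 10)\<^sup>2 \<le> (max 0 (quad s))\<^sup>2" by (intro power_mono) (auto simp: quad_def)
  then show ?thesis by (simp add: bump_def power2_eq_square)
qed

text \<open>At scale \<open>N\<close> this is used for the curve \<tau> \<mapsto> \<phi>(N \<tau>) /
  \<phi>(N), with \<open>c\<close>, \<open>C\<close> and \<open>L\<close> independent of
  \<open>N\<close>. \<open>log_convex\<close> bounds the second derivative of log g1 from below and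
  so controls the stationary points; \<open>ends\<close> makes the weight vanish at both
  endpoints.\<close>

locale profile =
  fixes L c C :: real and g g1 g2 g3 :: "real \<Rightarrow> real"
  assumes L: "1 < L" and c: "0 < c"
    and g: "\<And>t. t \<in> {1/L..L} \<Longrightarrow> (g has_real_derivative g1 t) (at t within {1/L..L})"
    and g1: "\<And>t. t \<in> {1/L..L} \<Longrightarrow> (g1 has_real_derivative g2 t) (at t within {1/L..L})"
    and g2: "\<And>t. t \<in> {1/L..L} \<Longrightarrow> (g2 has_real_derivative g3 t) (at t within {1/L..L})"
    and g1_ge: "\<And>t. t \<in> {1/L..L} \<Longrightarrow> c \<le> g1 t" and g1_le: "\<And>t. t \<in> {1/L..L} \<Longrightarrow> g1 t \<le> C"
    and g2_ge: "\<And>t. t \<in> {1/L..L} \<Longrightarrow> c \<le> - g2 t" and g2_le: "\<And>t. t \<in> {1/L..L} \<Longrightarrow> - g2 t \<le> C"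
    and g3_le: "\<And>t. t \<in> {1/L..L} \<Longrightarrow> \<bar>g3 t\<bar> \<le> C"
    and log_convex: "\<And>t. t \<in> {1/L..L} \<Longrightarrow> c \<le> g3 t * g1 t - (g2 t)\<^sup>2"
    and ends: "8 \<le> g1 (1/L)" "g1 L \<le> 1/10"
begin

lemma inv_L: "0 < 1 / L" "1 / L < 1" "1 / L < L" using L by (auto simp: field_simps intro: less_trans mult_strict_mono)

lemma cC: "c \<le> C" using g1_ge[of L] g1_le[of L] inv_L by auto

lemma C: "0 < C" using c cC by linarith

text \<open>
  The factor \<open>sqrt (- g2)\<close> makes the substitution \<open>s = g1 t\<close> exact in \<open>weight_integral\<close>: there the
  linearised diagonal phase becomes the Fourier transform of a fixed bump, without a fourth derivative of \<open>g\<close>.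
\<close>

definition w :: "real \<Rightarrow> real" where "w t = sqrt (- g2 t) * bump (g1 t)"

definition w' :: "real \<Rightarrow> real" where
  "w' t = - (g3 t / (2 * sqrt (- g2 t))) * bump (g1 t) + sqrt (- g2 t) * (bump' (g1 t) * g2 t)"

text \<open>One constant for \<open>w\<close> and \<open>w'\<close>, since the oscillatory bounds
  ask for a common bound on the amplitude and its derivative.\<close>

definition W :: real where "W = 256 * (sqrt C + C / sqrt c + C * sqrt C)"

lemma W: "W \<ge> 0" using c C by (simp add: W_def)

lemma DERIV_w: assumes t: "t \<in> {1/L..L}" shows "(w has_real_derivative w' t) (at t within {1/L..L})"
proof -
  have pos: "- g2 t > 0" using g2_ge[OF t] c by linarith
  have 1: "((\<lambda>x. - g2 x) has_real_derivative - g3 t) (at t within {1/L..L})"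
    by (rule DERIV_minus[OF g2[OF t]])
  have 2: "((\<lambda>x. sqrt (- g2 x)) has_real_derivative (inverse (sqrt (- g2 t)) / 2) * (- g3 t)) (at t within {1/L..L})"
    by (rule DERIV_chain2[OF DERIV_real_sqrt[OF pos] 1])
  have 3: "((\<lambda>x. bump (g1 x)) has_real_derivative bump' (g1 t) * g2 t) (at t within {1/L..L})"
    by (rule DERIV_chain2[OF DERIV_bump g1[OF t]])
  have "(w has_real_derivative (inverse (sqrt (- g2 t)) / 2) * (- g3 t) * bump (g1 t) + bump' (g1 t) * g2 t * sqrt (- g2 t)) (at t within {1/L..L})"
    unfolding w_def by (rule DERIV_mult[OF 2 3])
  moreover have "(inverse (sqrt (- g2 t)) / 2) * (- g3 t) * bump (g1 t) + bump' (g1 t) * g2 t * sqrt (- g2 t) = w' t"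
    unfolding w'_def by (simp add: field_simps)
  ultimately show ?thesis by simp
qed

lemma w_nonneg: "t \<in> {1/L..L} \<Longrightarrow> 0 \<le> w t"
  using g2_ge[of t] c bump_bounds(1) by (auto simp: w_def)

lemma abs_w_le: assumes t: "t \<in> {1/L..L}" shows "\<bar>w t\<bar> \<le> W"
proof -
  have "w t \<le> sqrt C * 256" unfolding w_def using g2_le[OF t] bump_bounds C
    by (intro mult_mono) auto
  also have "\<dots> \<le> W" unfolding W_def using c C by simp
  finally show ?thesis using w_nonneg[OF t] by simp
qed

lemma abs_w'_le: assumes t: "t \<in> {1/L..L}" shows "\<bar>w' t\<bar> \<le> W"
proof -
  have sq: "sqrt c \<le> sqrt (- g2 t)" "0 < sqrt c" using g2_ge[OF t] c by auto
  have "\<bar>g3 t / (2 * sqrt (- g2 t))\<bar> * \<bar>bump (g1 t)\<bar> \<le> (C / sqrt c) * 256"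
  proof (rule mult_mono)
    have "\<bar>g3 t / (2 * sqrt (- g2 t))\<bar> = \<bar>g3 t\<bar> / (2 * sqrt (- g2 t))" using sq by (simp add: abs_mult)
    also have "\<dots> \<le> C / sqrt c"
    proof (rule frac_le)
      show "sqrt c \<le> 2 * sqrt (- g2 t)" using sq by linarith
    qed (use g3_le[OF t] sq C in auto)
    finally show "\<bar>g3 t / (2 * sqrt (- g2 t))\<bar> \<le> C / sqrt c" .
  qed (use bump_bounds C c in auto)
  moreover have "sqrt (- g2 t) * (\<bar>bump' (g1 t)\<bar> * \<bar>g2 t\<bar>) \<le> sqrt C * (256 * C)"
    using g2_le[OF t] g2_ge[OF t] bump_bounds C c by (intro mult_mono) (auto intro: mult_nonneg_nonpos)
  moreover have "\<bar>sqrt (- g2 t)\<bar> = sqrt (- g2 t)" using g2_ge[OF t] c by simp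
  ultimately have "\<bar>w' t\<bar> \<le> (C / sqrt c) * 256 + sqrt C * (256 * C)"
    unfolding w'_def by (intro order.trans[OF abs_triangle_ineq] add_mono) (auto simp: abs_mult)
  also have "\<dots> \<le> W" unfolding W_def using C by (simp add: algebra_simps)
  finally show ?thesis .
qed

lemma w_ends: "w (1/L) = 0" "w L = 0"
  using ends bump_eq_0 by (auto simp: w_def)

lemma DERIV_shift:
  assumes f: "\<And>t. t \<in> {1/L..L} \<Longrightarrow> (f has_real_derivative f' t) (at t within {1/L..L})"
    and "0 \<le> \<xi>" "t \<in> {1/L..L-\<xi>}"
  shows "((\<lambda>t. f (t + \<xi>)) has_real_derivative f' (t + \<xi>)) (at t within {1/L..L-\<xi>})"
proof -
  have sub: "(\<lambda>t. t + \<xi>) ` {1/L..L-\<xi>} \<subseteq> {1/L..L}" using assms(2) by auto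
  have "(f has_real_derivative f' (t + \<xi>)) (at (t + \<xi>) within (\<lambda>t. t + \<xi>) ` {1/L..L-\<xi>})"
    by (rule DERIV_subset[OF f sub]) (use assms in auto)
  moreover have "((\<lambda>t. t + \<xi>) has_real_derivative 1) (at t within {1/L..L-\<xi>})"
    by (auto intro!: derivative_eq_intros)
  ultimately have "(f \<circ> (\<lambda>t. t + \<xi>) has_real_derivative f' (t + \<xi>) * 1) (at t within {1/L..L-\<xi>})"
    by (rule DERIV_image_chain)
  then show ?thesis by (simp add: o_def)
qed

lemma DERIV_restrict:
  assumes f: "\<And>t. t \<in> {1/L..L} \<Longrightarrow> (f has_real_derivative f' t) (at t within {1/L..L})"
    and "0 \<le> \<xi>" "t \<in> {1/L..L-\<xi>}"
  shows "(f has_real_derivative f' t) (at t within {1/L..L-\<xi>})"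
  by (rule DERIV_subset[OF f]) (use assms in auto)

lemma mean_value_profile:
  assumes f: "\<And>t. t \<in> {1/L..L} \<Longrightarrow> (f has_real_derivative f' t) (at t within {1/L..L})"
    and "1/L \<le> s" "s \<le> t" "t \<le> L"
  shows "\<exists>x\<in>{s..t}. f t - f s = f' x * (t - s)"
  by (rule mean_value_within[OF \<open>s \<le> t\<close>], rule DERIV_subset[OF f]) (use assms in auto)

lemma g1_decrease:
  assumes "1/L \<le> s" "s \<le> t" "t \<le> L"
  shows "c * (t - s) \<le> g1 s - g1 t" "g1 s - g1 t \<le> C * (t - s)"
proof -
  obtain x where x: "x \<in> {s..t}" "g1 t - g1 s = g2 x * (t - s)" using mean_value_profile[OF g1 assms] by blast
  then have "c \<le> - g2 x" "- g2 x \<le> C" using g2_ge[of x] g2_le[of x] assms by auto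
  then have "c * (t - s) \<le> (- g2 x) * (t - s)" "(- g2 x) * (t - s) \<le> C * (t - s)"
    using assms by (intro mult_right_mono; simp)+
  then show "c * (t - s) \<le> g1 s - g1 t" "g1 s - g1 t \<le> C * (t - s)" using x by auto
qed

lemma g_increase:
  assumes "1/L \<le> s" "s \<le> t" "t \<le> L"
  shows "c * (t - s) \<le> g t - g s" "g t - g s \<le> C * (t - s)"
proof -
  obtain x where x: "x \<in> {s..t}" "g t - g s = g1 x * (t - s)" using mean_value_profile[OF g assms] by blast
  then have "c \<le> g1 x" "g1 x \<le> C" using g1_ge[of x] g1_le[of x] assms by auto
  then show "c * (t - s) \<le> g t - g s" "g t - g s \<le> C * (t - s)"
    using assms x by (auto intro: mult_right_mono)
qed

lemma continuous_profile: "continuous_on {1/L..L} g" "continuous_on {1/L..L} g1" "continuous_on {1/L..L} g2" "continuous_on {1/L..L} w"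
  using DERIV_continuous_on[of "{1/L..L}" g g1] DERIV_continuous_on[of "{1/L..L}" g1 g2]
    DERIV_continuous_on[of "{1/L..L}" g2 g3] DERIV_continuous_on[of "{1/L..L}" w w'] g g1 g2 DERIV_w by blast+

lemma continuous_on_shift:
  assumes "continuous_on {1/L..L} f" "0 \<le> \<xi>"
  shows "continuous_on {1/L..L-\<xi>} f" "continuous_on {1/L..L-\<xi>} (\<lambda>t. f (t + \<xi>))"
proof -
  show "continuous_on {1/L..L-\<xi>} f" by (rule continuous_on_subset[OF assms(1)]) (use assms in auto)
  show "continuous_on {1/L..L-\<xi>} (\<lambda>t. f (t + \<xi>))"
    by (rule continuous_on_compose2[OF assms(1)]) (use assms in \<open>auto intro!: continuous_intros\<close>)
qed

section \<open>Oscillatory integrals of a pair of frequencies\<close>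

definition amp :: "real \<Rightarrow> real \<Rightarrow> real" where "amp \<xi> t = w t * w (t + \<xi>)"

text \<open>Frequency \<open>l\<close> sits at the shifted point and \<open>k\<close> at the point
  itself; a negative \<open>k\<close> encodes the difference phase.\<close>

definition osc :: "real \<Rightarrow> real \<Rightarrow> real \<Rightarrow> real \<Rightarrow> real" where
  "osc M \<xi> l k = integral {1/L..L-\<xi>} (\<lambda>t. amp \<xi> t * cos (2 * pi * M * (l * g (t + \<xi>) + k * g t)))"

lemma DERIV_amp:
  assumes "0 \<le> \<xi>" "t \<in> {1/L..L-\<xi>}"
  shows "(amp \<xi> has_real_derivative (w' t * w (t + \<xi>) + w' (t + \<xi>) * w t)) (at t within {1/L..L-\<xi>})"
  unfolding amp_def by (rule DERIV_mult[OF DERIV_restrict[OF DERIV_w assms] DERIV_shift[OF DERIV_w assms]])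

lemma amp_bounds:
  assumes "0 \<le> \<xi>" "t \<in> {1/L..L-\<xi>}"
  shows "\<bar>amp \<xi> t\<bar> \<le> 2 * W\<^sup>2" "\<bar>w' t * w (t + \<xi>) + w' (t + \<xi>) * w t\<bar> \<le> 2 * W\<^sup>2"
proof -
  have t: "t \<in> {1/L..L}" "t + \<xi> \<in> {1/L..L}" using assms by auto
  have "\<bar>w t\<bar> * \<bar>w (t + \<xi>)\<bar> \<le> W * W" using abs_w_le t W by (intro mult_mono) auto
  then have "\<bar>amp \<xi> t\<bar> \<le> W * W" by (simp add: amp_def abs_mult)
  moreover have "W * W \<ge> 0" using W by simp
  ultimately show "\<bar>amp \<xi> t\<bar> \<le> 2 * W\<^sup>2" unfolding power2_eq_square by linarith
  have 1: "\<bar>w' t * w (t + \<xi>)\<bar> \<le> W * W" unfolding abs_mult using abs_w_le abs_w'_le t W by (intro mult_mono) auto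
  have 2: "\<bar>w' (t + \<xi>) * w t\<bar> \<le> W * W" unfolding abs_mult using abs_w_le abs_w'_le t W by (intro mult_mono) auto
  show "\<bar>w' t * w (t + \<xi>) + w' (t + \<xi>) * w t\<bar> \<le> 2 * W\<^sup>2"
    using 1 2 unfolding power2_eq_square by linarith
qed

lemma DERIV_phase:
  assumes "0 \<le> \<xi>" "t \<in> {1/L..L-\<xi>}"
  shows "((\<lambda>t. l * g (t + \<xi>) + k * g t) has_real_derivative (l * g1 (t + \<xi>) + k * g1 t)) (at t within {1/L..L-\<xi>})"
    "((\<lambda>t. l * g1 (t + \<xi>) + k * g1 t) has_real_derivative (l * g2 (t + \<xi>) + k * g2 t)) (at t within {1/L..L-\<xi>})"
  using DERIV_add[OF DERIV_cmult[OF DERIV_shift[OF g assms]] DERIV_cmult[OF DERIV_restrict[OF g assms]]]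
    DERIV_add[OF DERIV_cmult[OF DERIV_shift[OF g1 assms]] DERIV_cmult[OF DERIV_restrict[OF g1 assms]]]
  by auto

lemma two_pi_bound:
  assumes "M > 0" "X \<ge> 0"
  shows "2 * W\<^sup>2 / (2 * pi * M) * X \<le> W\<^sup>2 / (2 * M) * X"
proof (rule mult_right_mono)
  have "W\<^sup>2 / (pi * M) \<le> W\<^sup>2 / (2 * M)"
    using assms pi_gt3 by (intro divide_left_mono mult_right_mono) auto
  then show "2 * W\<^sup>2 / (2 * pi * M) \<le> W\<^sup>2 / (2 * M)" by simp
qed (rule assms)

lemma osc_first:
  assumes \<xi>: "0 \<le> \<xi>" "\<xi> \<le> L - 1/L" and M: "M > 0" and \<eta>: "\<eta> > 0"
    and 1: "\<And>t. t \<in> {1/L..L-\<xi>} \<Longrightarrow> \<bar>l * g1 (t + \<xi>) + k * g1 t\<bar> \<ge> \<eta>"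
    and 2: "\<And>t. t \<in> {1/L..L-\<xi>} \<Longrightarrow> \<bar>l * g2 (t + \<xi>) + k * g2 t\<bar> \<le> \<Gamma>"
  shows "\<bar>osc M \<xi> l k\<bar> \<le> W\<^sup>2 / (2 * M) * ((2 + L) / \<eta> + L * \<Gamma> / \<eta>\<^sup>2)"
proof -
  have G: "\<Gamma> \<ge> 0" using 2[of "1/L"] \<xi> by fastforce
  have le: "L - \<xi> - 1/L \<le> L" "0 \<le> L - \<xi> - 1/L" using \<xi> inv_L by linarith+
  have "\<bar>osc M \<xi> l k\<bar> \<le> 2 * W\<^sup>2 / (2 * pi * M) * ((2 + (L - \<xi> - 1/L)) / \<eta> + (L - \<xi> - 1/L) * \<Gamma> / \<eta>\<^sup>2)"
    unfolding osc_def
    by (rule oscillatory_integral_bound[OF _ _ \<eta> DERIV_amp[OF \<xi>(1)] DERIV_phase[OF \<xi>(1)] amp_bounds[OF \<xi>(1)] 1 2])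
       (use \<xi> M in auto)
  also have "\<dots> \<le> 2 * W\<^sup>2 / (2 * pi * M) * ((2 + L) / \<eta> + L * \<Gamma> / \<eta>\<^sup>2)"
    using M \<eta> G le by (intro mult_left_mono add_mono divide_right_mono mult_right_mono) auto
  also have "\<dots> \<le> W\<^sup>2 / (2 * M) * ((2 + L) / \<eta> + L * \<Gamma> / \<eta>\<^sup>2)"
    using M \<eta> G L by (intro two_pi_bound) auto
  finally show ?thesis .
qed

lemma osc_stationary:
  assumes \<xi>: "0 \<le> \<xi>" "\<xi> \<le> L - 1/L" and M: "M > 0" and \<mu>: "\<mu> > 0" and \<delta>: "\<delta> > 0" and t0: "t0 \<in> {1/L..L-\<xi>}"
    and 1: "\<And>t. t \<in> {1/L..L-\<xi>} \<Longrightarrow> \<bar>l * g1 (t + \<xi>) + k * g1 t\<bar> \<ge> \<mu> * \<bar>t - t0\<bar>"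
    and 2: "\<And>t. t \<in> {1/L..L-\<xi>} \<Longrightarrow> \<bar>l * g2 (t + \<xi>) + k * g2 t\<bar> \<le> \<Gamma>"
  shows "\<bar>osc M \<xi> l k\<bar> \<le> 4 * W\<^sup>2 * \<delta> + W\<^sup>2 / M * ((2 + L) / (\<mu> * \<delta>) + L * \<Gamma> / (\<mu> * \<delta>)\<^sup>2)"
proof -
  have G: "\<Gamma> \<ge> 0" using 2[of "1/L"] \<xi> by fastforce
  have le: "L - \<xi> - 1/L \<le> L" "0 \<le> L - \<xi> - 1/L" using \<xi> inv_L by linarith+
  have "\<bar>osc M \<xi> l k\<bar> \<le> 2 * (2 * W\<^sup>2) * \<delta> + 2 * (2 * W\<^sup>2 / (2 * pi * M) * ((2 + (L - \<xi> - 1/L)) / (\<mu> * \<delta>) + (L - \<xi> - 1/L) * \<Gamma> / (\<mu> * \<delta>)\<^sup>2))"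
    unfolding osc_def
    by (rule stationary_integral_bound[OF _ _ \<mu> \<delta> t0 DERIV_amp[OF \<xi>(1)] DERIV_phase[OF \<xi>(1)] amp_bounds[OF \<xi>(1)] 1 2])
       (use \<xi> M in auto)
  also have "\<dots> \<le> 2 * (2 * W\<^sup>2) * \<delta> + 2 * (2 * W\<^sup>2 / (2 * pi * M) * ((2 + L) / (\<mu> * \<delta>) + L * \<Gamma> / (\<mu> * \<delta>)\<^sup>2))"
    using M \<mu> \<delta> G le by (intro add_left_mono mult_left_mono add_mono divide_right_mono mult_right_mono) auto
  also have "\<dots> \<le> 2 * (2 * W\<^sup>2) * \<delta> + 2 * (W\<^sup>2 / (2 * M) * ((2 + L) / (\<mu> * \<delta>) + L * \<Gamma> / (\<mu> * \<delta>)\<^sup>2))"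
    using M \<mu> \<delta> G L by (intro add_left_mono mult_left_mono two_pi_bound) auto
  finally show ?thesis by simp
qed

lemma phase''_le:
  assumes "0 \<le> \<xi>" "t \<in> {1/L..L-\<xi>}"
  shows "\<bar>l * g2 (t + \<xi>) + k * g2 t\<bar> \<le> (\<bar>l\<bar> + \<bar>k\<bar>) * C"
proof -
  have t: "t \<in> {1/L..L}" "t + \<xi> \<in> {1/L..L}" using assms by auto
  have b: "\<bar>g2 s\<bar> \<le> C" if "s \<in> {1/L..L}" for s using g2_ge[OF that] g2_le[OF that] c by auto
  have "\<bar>l * g2 (t + \<xi>)\<bar> \<le> \<bar>l\<bar> * C" "\<bar>k * g2 t\<bar> \<le> \<bar>k\<bar> * C"
    using b t by (auto simp: abs_mult intro: mult_left_mono)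
  then show ?thesis unfolding distrib_right by linarith
qed

definition B_first :: real where "B_first = W\<^sup>2 * ((2 + L) / c + 4 * L * C / c\<^sup>2)"

text \<open>The phase derivative is bounded below independently of the frequencies while the second
  derivative is of size \<open>K\<close>; this is the source of the single factor
  \<open>K\<close>.\<close>

lemma osc_first':
  assumes \<xi>: "0 \<le> \<xi>" "\<xi> \<le> L - 1/L" and M: "M > 0" and K: "K \<ge> 1" "\<bar>l\<bar> \<le> K" "\<bar>k\<bar> \<le> K"
    and 1: "\<And>t. t \<in> {1/L..L-\<xi>} \<Longrightarrow> \<bar>l * g1 (t + \<xi>) + k * g1 t\<bar> \<ge> c / 2"
  shows "\<bar>osc M \<xi> l k\<bar> \<le> B_first * K / M"
proof -
  have "\<bar>osc M \<xi> l k\<bar> \<le> W\<^sup>2 / (2 * M) * ((2 + L) / (c / 2) + L * (2 * K * C) / (c / 2)\<^sup>2)"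
  proof (rule osc_first[OF \<xi> M])
    fix t assume t: "t \<in> {1/L..L-\<xi>}"
    have "(\<bar>l\<bar> + \<bar>k\<bar>) * C \<le> 2 * K * C" using K C by (intro mult_right_mono) auto
    then show "\<bar>l * g2 (t + \<xi>) + k * g2 t\<bar> \<le> 2 * K * C"
      using phase''_le[OF \<xi>(1) t, of l k] by linarith
  qed (use 1 c in auto)
  also have "\<dots> \<le> W\<^sup>2 / (2 * M) * ((2 + L) / (c / 2) * K + L * (2 * K * C) / (c / 2)\<^sup>2)"
    using K M L c mult_left_mono[of 1 K "(2 + L) / (c / 2)"] by (intro mult_left_mono add_mono) auto
  also have "\<dots> = B_first * K / M" unfolding B_first_def using M c
    by (simp add: field_simps power2_eq_square)
  finally show ?thesis .
qed

text \<open>Both summands of the phase derivative are nonnegative and the first is at least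
  \<open>c\<close>, so sum phases have no stationary point.\<close>

lemma osc_plus:
  assumes \<xi>: "0 \<le> \<xi>" "\<xi> \<le> L - 1/L" and M: "M > 0" and K: "1 \<le> l" "l \<le> K" "0 \<le> k" "k \<le> K"
  shows "\<bar>osc M \<xi> l k\<bar> \<le> B_first * K / M"
proof (rule osc_first'[OF \<xi> M])
  fix t assume t: "t \<in> {1/L..L-\<xi>}"
  then have "c \<le> g1 (t + \<xi>)" "c \<le> g1 t" using g1_ge \<xi> by auto
  then have "1 * c \<le> l * g1 (t + \<xi>)" "0 \<le> k * g1 t" using K c by - ((intro mult_mono; simp), simp)
  then show "c / 2 \<le> \<bar>l * g1 (t + \<xi>) + k * g1 t\<bar>" using c by linarith
qed (use K in auto)

text \<open>For such a short shift, replacing \<open>g1 (t + \<xi>)\<close> by \<open>g1 t\<close>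
  changes the phase derivative by at most \<open>c / 2\<close>, whereas the difference of the
  frequencies contributes at least \<open>c\<close>.\<close>

lemma osc_minus_near:
  fixes k l :: nat
  assumes \<xi>: "0 \<le> \<xi>" "\<xi> \<le> L - 1/L" and M: "M > 0" and K: "1 \<le> l" "real l \<le> K" "1 \<le> k" "real k \<le> K" "k \<noteq> l"
    and near: "2 * C * K * \<xi> \<le> c"
  shows "\<bar>osc M \<xi> l (- real k)\<bar> \<le> B_first * K / M"
proof (rule osc_first'[OF \<xi> M])
  fix t assume t: "t \<in> {1/L..L-\<xi>}"
  have ge: "c \<le> g1 (t + \<xi>)" "c \<le> g1 t" using g1_ge t \<xi> by auto
  have de: "c * \<xi> \<le> g1 t - g1 (t + \<xi>)" "g1 t - g1 (t + \<xi>) \<le> C * \<xi>" using g1_decrease[of t "t + \<xi>"] t \<xi> by auto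
  have "0 \<le> c * \<xi>" using c \<xi> by simp
  then have de0: "0 \<le> g1 t - g1 (t + \<xi>)" using de by linarith
  consider "k < l" | "l < k" using K by linarith
  then have "c / 2 \<le> \<bar>l * g1 (t + \<xi>) - k * g1 t\<bar>"
  proof cases
    case 1
    then have "1 * c \<le> (real l - real k) * g1 t" using ge c by (intro mult_mono) auto
    moreover have "l * (g1 t - g1 (t + \<xi>)) \<le> K * (C * \<xi>)" using de(2) de0 K by (intro mult_mono) auto
    ultimately have "c / 2 \<le> l * g1 (t + \<xi>) - k * g1 t" using near by (simp add: algebra_simps)
    then show ?thesis by linarith
  next
    case 2
    then have "1 * c \<le> (real k - real l) * g1 (t + \<xi>)" using ge c by (intro mult_mono) auto
    moreover have "0 \<le> k * (g1 t - g1 (t + \<xi>))" using de0 by simp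
    ultimately show ?thesis using c by (simp add: algebra_simps)
  qed
  then show "c / 2 \<le> \<bar>real l * g1 (t + \<xi>) + - real k * g1 t\<bar>" by simp
qed (use K in auto)

text \<open>The logarithmic derivative of the ratio is the increment of g2 / g1 over the shift, and
  (g2 / g1)' is positive by \<open>log_convex\<close>. The difference phase has derivative l g1(t)
  times (ratio - k / l), so this locates its only possible zero, quantitatively.\<close>

lemma ratio_increasing:
  assumes \<xi>: "0 \<le> \<xi>" "\<xi> \<le> L - 1/L"
  shows "\<exists>t0\<in>{1/L..L-\<xi>}. \<forall>t\<in>{1/L..L-\<xi>}. \<bar>g1 (t + \<xi>) / g1 t - \<kappa>\<bar> \<ge> (c\<^sup>2 * \<xi> / C ^ 3) * \<bar>t - t0\<bar>"
proof (rule increasing_lower_bound)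
  show "1 / L \<le> L - \<xi>" using \<xi> by linarith
  show "0 \<le> c\<^sup>2 * \<xi> / C ^ 3" using \<xi> C by simp
  fix t assume t: "t \<in> {1/L..L-\<xi>}"
  have tt: "t \<in> {1/L..L}" "t + \<xi> \<in> {1/L..L}" using t \<xi> by auto
  have pos: "0 < g1 t" "0 < g1 (t + \<xi>)" using g1_ge[OF tt(1)] g1_ge[OF tt(2)] c by auto
  show "((\<lambda>t. g1 (t + \<xi>) / g1 t) has_real_derivative
      ((g2 (t + \<xi>) * g1 t - g1 (t + \<xi>) * g2 t) / (g1 t * g1 t))) (at t within {1/L..L-\<xi>})"
    by (rule DERIV_divide[OF DERIV_shift[OF g1 \<xi>(1) t] DERIV_restrict[OF g1 \<xi>(1) t]]) (use pos in auto)
  have S: "((\<lambda>s. g2 s / g1 s) has_real_derivative ((g3 s * g1 s - g2 s * g2 s) / (g1 s * g1 s))) (at s within {1/L..L})"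
    if "s \<in> {1/L..L}" for s
    by (rule DERIV_divide[OF g2[OF that] g1[OF that]]) (use g1_ge[OF that] c in auto)
  obtain s where s: "s \<in> {t..t+\<xi>}" "g2 (t + \<xi>) / g1 (t + \<xi>) - g2 t / g1 t = (g3 s * g1 s - g2 s * g2 s) / (g1 s * g1 s) * (t + \<xi> - t)"
    using mean_value_profile[OF S, of t "t + \<xi>"] t \<xi> by auto
  have ss: "s \<in> {1/L..L}" using s tt by auto
  have "c / (C * C) \<le> (g3 s * g1 s - g2 s * g2 s) / (g1 s * g1 s)"
    using log_convex[OF ss] g1_ge[OF ss] g1_le[OF ss] c
    by (intro frac_le mult_mono) (auto simp: power2_eq_square)
  then have "c / (C * C) * \<xi> \<le> g2 (t + \<xi>) / g1 (t + \<xi>) - g2 t / g1 t"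
    unfolding s(2) using \<xi>(1) mult_right_mono[of "c / (C * C)" _ \<xi>] by (simp del: times_divide_eq_left)
  moreover have "c / C \<le> g1 (t + \<xi>) / g1 t"
    using g1_ge[OF tt(2)] g1_le[OF tt(1)] pos c by (intro frac_le) auto
  ultimately have "(c / C) * (c / (C * C) * \<xi>) \<le> (g1 (t + \<xi>) / g1 t) * (g2 (t + \<xi>) / g1 (t + \<xi>) - g2 t / g1 t)"
    using pos \<xi> c C by (intro mult_mono) auto
  also have "\<dots> = (g2 (t + \<xi>) * g1 t - g1 (t + \<xi>) * g2 t) / (g1 t * g1 t)"
    using pos by (simp add: field_simps)
  also have "(c / C) * (c / (C * C) * \<xi>) = c\<^sup>2 * \<xi> / C ^ 3"
    by (simp add: power2_eq_square power3_eq_cube)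
  finally show "c\<^sup>2 * \<xi> / C ^ 3 \<le> (g2 (t + \<xi>) * g1 t - g1 (t + \<xi>) * g2 t) / (g1 t * g1 t)" .
qed

text \<open>Arises by inserting the smallest shift not covered by \<open>osc_minus_near\<close>,
  \<xi> = c / (2 C K), into \<open>c\<close> times the slope of \<open>ratio_increasing\<close>; the
  factor 1 / K is kept apart.\<close>

definition \<mu>0 :: real where "\<mu>0 = c ^ 4 / (2 * C ^ 4)"

definition B_off :: real where
  "B_off = B_first + W\<^sup>2 * (4 + (2 + L) / \<mu>0 + 2 * L * C / \<mu>0\<^sup>2)"

lemma \<mu>0: "\<mu>0 > 0" using c C by (simp add: \<mu>0_def)

lemma B_nonneg: "B_first \<ge> 0" "B_off \<ge> 0"
  using c C L \<mu>0 unfolding B_off_def B_first_def by (auto intro!: add_nonneg_nonneg mult_nonneg_nonneg)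

lemma osc_minus_far:
  fixes k l :: nat
  assumes \<xi>: "0 \<le> \<xi>" "\<xi> \<le> L - 1/L" and M: "M > 0" and \<delta>: "\<delta> > 0"
    and K: "1 \<le> l" "real l \<le> K" "real k \<le> K"
    and far: "c \<le> 2 * C * K * \<xi>"
  shows "\<bar>osc M \<xi> l (- real k)\<bar>
     \<le> 4 * W\<^sup>2 * \<delta> + W\<^sup>2 / M * ((2 + L) / (\<mu>0 / K * \<delta>) + L * (2 * K * C) / (\<mu>0 / K * \<delta>)\<^sup>2)"
proof -
  have K1: "K \<ge> 1" using K by linarith
  obtain t0 where t0: "t0 \<in> {1/L..L-\<xi>}"
    "\<And>t. t \<in> {1/L..L-\<xi>} \<Longrightarrow> \<bar>g1 (t + \<xi>) / g1 t - real k / real l\<bar> \<ge> (c\<^sup>2 * \<xi> / C ^ 3) * \<bar>t - t0\<bar>"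
    using ratio_increasing[OF \<xi>, of "real k / real l"] by blast
  have "c / (2 * C * K) \<le> \<xi>" using far C K1 by (simp add: field_simps)
  then have "c ^ 3 / C ^ 3 * (c / (2 * C * K)) \<le> c ^ 3 / C ^ 3 * \<xi>" using c C by (intro mult_left_mono) auto
  then have \<mu>: "\<mu>0 / K \<le> c * (c\<^sup>2 * \<xi> / C ^ 3)"
    unfolding \<mu>0_def by (simp add: power2_eq_square power3_eq_cube power4_eq_xxxx algebra_simps)
  show ?thesis
  proof (rule osc_stationary[OF \<xi> M _ \<delta> t0(1)])
    show "0 < \<mu>0 / K" using \<mu>0 K1 by simp
    fix t assume t: "t \<in> {1/L..L-\<xi>}"
    have tt: "t \<in> {1/L..L}" using t \<xi> by auto
    have pos: "0 < g1 t" using g1_ge[OF tt] c by auto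
    have "\<mu>0 / K * \<bar>t - t0\<bar> \<le> c * (c\<^sup>2 * \<xi> / C ^ 3) * \<bar>t - t0\<bar>" using \<mu> by (intro mult_right_mono) auto
    also have "\<dots> \<le> (real l * g1 t) * ((c\<^sup>2 * \<xi> / C ^ 3) * \<bar>t - t0\<bar>)"
    proof -
      have "1 * c \<le> real l * g1 t" using K g1_ge[OF tt] c by (intro mult_mono) auto
      then have "c * ((c\<^sup>2 * \<xi> / C ^ 3) * \<bar>t - t0\<bar>) \<le> (real l * g1 t) * ((c\<^sup>2 * \<xi> / C ^ 3) * \<bar>t - t0\<bar>)"
        using \<xi> C by (intro mult_right_mono) auto
      then show ?thesis by (simp add: mult.assoc)
    qed
    also have "\<dots> \<le> (real l * g1 t) * \<bar>g1 (t + \<xi>) / g1 t - real k / real l\<bar>"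
      using pos t0(2)[OF t] by (intro mult_left_mono) auto
    also have "\<dots> = \<bar>(real l * g1 t) * (g1 (t + \<xi>) / g1 t - real k / real l)\<bar>"
      using pos by (simp add: abs_mult)
    also have "(real l * g1 t) * (g1 (t + \<xi>) / g1 t - real k / real l) = real l * g1 (t + \<xi>) + - real k * g1 t"
      using pos K by (simp add: field_simps)
    finally show "\<mu>0 / K * \<bar>t - t0\<bar> \<le> \<bar>real l * g1 (t + \<xi>) + - real k * g1 t\<bar>" .
    have "(\<bar>real l\<bar> + \<bar>- real k\<bar>) * C \<le> 2 * K * C" using K C by (intro mult_right_mono) auto
    then show "\<bar>real l * g2 (t + \<xi>) + - real k * g2 t\<bar> \<le> 2 * K * C"
      using phase''_le[OF \<xi>(1) t, of "real l" "- real k"] by linarith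
  qed
qed

text \<open>With \<delta> = M^(-1/4) the window around the stationary point costs \<delta>, and the
  two terms outside it cost K \<delta>^3 and K^3 \<delta>^2. All are absorbed into K^3
  \<delta>.\<close>

lemma osc_off_diagonal:
  fixes k l :: nat
  assumes \<xi>: "0 \<le> \<xi>" "\<xi> \<le> L - 1/L" and \<delta>: "0 < \<delta>" "\<delta> \<le> 1" and M: "M * \<delta> ^ 4 = 1"
    and K: "1 \<le> l" "real l \<le> K" "1 \<le> k" "real k \<le> K"
  shows "\<bar>osc M \<xi> l k\<bar> \<le> B_off * K ^ 3 * \<delta>"
    and "k \<noteq> l \<Longrightarrow> \<bar>osc M \<xi> l (- real k)\<bar> \<le> B_off * K ^ 3 * \<delta>"
proof -
  have K1: "K \<ge> 1" using K by linarith
  have "M = 1 / \<delta> ^ 4" using M \<delta> by (simp add: field_simps)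
  then have M0: "M > 0" and iM: "1 / M = \<delta> ^ 4" using \<delta> by auto
  have d: "\<delta> ^ 4 \<le> \<delta>" "\<delta> ^ 3 \<le> \<delta>" "\<delta>\<^sup>2 \<le> \<delta>"
    using \<delta> power_decreasing[of 1 4 \<delta>] power_decreasing[of 1 3 \<delta>] power_decreasing[of 1 2 \<delta>] by auto
  have k: "1 \<le> K ^ 3" "K \<le> K ^ 3" using K1 power_increasing[of 1 3 K] by auto
  have X: "0 \<le> (2 + L) / \<mu>0" "0 \<le> 2 * L * C / \<mu>0\<^sup>2" using L C \<mu>0 by auto
  have first: "B_first * K / M \<le> B_off * K ^ 3 * \<delta>"
  proof -
    have "B_first * K / M = B_first * K * \<delta> ^ 4" unfolding iM[symmetric] by simp
    also have "\<dots> \<le> B_off * K ^ 3 * \<delta>"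
      using B_nonneg X d k \<delta> K1 by (intro mult_mono) (auto simp: B_off_def)
    finally show ?thesis .
  qed
  show "\<bar>osc M \<xi> l k\<bar> \<le> B_off * K ^ 3 * \<delta>"
    using osc_plus[OF \<xi> M0, of "real l" K "real k"] K first by linarith
  assume kl: "k \<noteq> l"
  show "\<bar>osc M \<xi> l (- real k)\<bar> \<le> B_off * K ^ 3 * \<delta>"
  proof (cases "2 * C * K * \<xi> \<le> c")
    case True
    then show ?thesis using osc_minus_near[OF \<xi> M0 K kl] first by linarith
  next
    case False
    have "\<bar>osc M \<xi> l (- real k)\<bar>
       \<le> 4 * W\<^sup>2 * \<delta> + W\<^sup>2 / M * ((2 + L) / (\<mu>0 / K * \<delta>) + L * (2 * K * C) / (\<mu>0 / K * \<delta>)\<^sup>2)"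
      using osc_minus_far[OF \<xi> M0 \<delta>(1) K(1,2,4)] False by simp
    also have "W\<^sup>2 / M * ((2 + L) / (\<mu>0 / K * \<delta>) + L * (2 * K * C) / (\<mu>0 / K * \<delta>)\<^sup>2)
        = W\<^sup>2 * ((2 + L) / \<mu>0 * K * \<delta> ^ 3 + 2 * L * C / \<mu>0\<^sup>2 * K ^ 3 * \<delta>\<^sup>2)"
    proof -
      have "W\<^sup>2 / M * ((2 + L) / (\<mu>0 / K * \<delta>) + L * (2 * K * C) / (\<mu>0 / K * \<delta>)\<^sup>2)
          = W\<^sup>2 * \<delta> ^ 4 * ((2 + L) / (\<mu>0 / K * \<delta>) + L * (2 * K * C) / (\<mu>0 / K * \<delta>)\<^sup>2)"
        unfolding iM[symmetric] by simp
      also have "\<dots> = W\<^sup>2 * ((2 + L) / \<mu>0 * K * \<delta> ^ 3 + 2 * L * C / \<mu>0\<^sup>2 * K ^ 3 * \<delta>\<^sup>2)"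
        using \<mu>0 K1 \<delta> by (simp add: field_simps power2_eq_square power3_eq_cube power4_eq_xxxx)
      finally show ?thesis .
    qed
    also have "4 * W\<^sup>2 * \<delta> + \<dots> = W\<^sup>2 * (4 * 1 * \<delta> + (2 + L) / \<mu>0 * K * \<delta> ^ 3 + 2 * L * C / \<mu>0\<^sup>2 * K ^ 3 * \<delta>\<^sup>2)"
      by (simp add: algebra_simps)
    also have "\<dots> \<le> W\<^sup>2 * (4 * K ^ 3 * \<delta> + (2 + L) / \<mu>0 * K ^ 3 * \<delta> + 2 * L * C / \<mu>0\<^sup>2 * K ^ 3 * \<delta>)"
      using X d k \<delta> K1 L C \<mu>0 by (intro mult_left_mono add_mono mult_mono) auto
    also have "\<dots> = (W\<^sup>2 * (4 + (2 + L) / \<mu>0 + 2 * L * C / \<mu>0\<^sup>2)) * K ^ 3 * \<delta>" by (simp add: algebra_simps)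
    also have "\<dots> \<le> B_off * K ^ 3 * \<delta>"
      using B_nonneg(1) K1 \<delta> by (intro mult_right_mono) (auto simp: B_off_def)
    finally show ?thesis .
  qed
qed

definition B_diag :: real where "B_diag = W\<^sup>2 * ((2 + L) / c + L * C / c\<^sup>2)"

text \<open>For equal frequencies the first two derivatives of the phase are both of size k \<xi>,
  so the remainder is again of order 1 / (k \<xi>) and no power of \<open>K\<close> is lost. The
  decay is of first order only.\<close>

lemma osc_diagonal:
  fixes k :: nat and \<xi> M :: real
  assumes \<xi>: "0 < \<xi>" "\<xi> \<le> L - 1/L" and M: "M > 0" and k: "1 \<le> k"
  shows "\<bar>osc M \<xi> k (- real k)\<bar> \<le> B_diag / (k * (M * \<xi>))"
proof -
  have "\<bar>osc M \<xi> k (- real k)\<bar> \<le> W\<^sup>2 / (2 * M) * ((2 + L) / (k * c * \<xi>) + L * (k * C * \<xi>) / (k * c * \<xi>)\<^sup>2)"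
  proof (rule osc_first)
    fix t assume t: "t \<in> {1/L..L-\<xi>}"
    have "c * \<xi> \<le> g1 t - g1 (t + \<xi>)" using g1_decrease[of t "t + \<xi>"] t \<xi> by auto
    then have "k * (c * \<xi>) \<le> k * (g1 t - g1 (t + \<xi>))" by (intro mult_left_mono) auto
    then show "k * c * \<xi> \<le> \<bar>real k * g1 (t + \<xi>) + - real k * g1 t\<bar>" by (simp add: algebra_simps)
    obtain s where s: "s \<in> {t..t+\<xi>}" "g2 (t + \<xi>) - g2 t = g3 s * (t + \<xi> - t)"
      using mean_value_profile[OF g2, of t "t + \<xi>"] t \<xi> by auto
    have "\<bar>real k * g2 (t + \<xi>) + - real k * g2 t\<bar> = k * \<bar>g2 (t + \<xi>) - g2 t\<bar>"
      by (simp add: abs_mult flip: right_diff_distrib)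
    also have "\<dots> = k * (\<bar>g3 s\<bar> * \<xi>)" using s \<xi> by (simp add: abs_mult)
    also have "\<dots> \<le> k * (C * \<xi>)" using g3_le[of s] s t \<xi> by (intro mult_left_mono mult_right_mono) auto
    finally show "\<bar>real k * g2 (t + \<xi>) + - real k * g2 t\<bar> \<le> k * C * \<xi>" by simp
  qed (use \<xi> M k c in auto)
  also have "\<dots> = B_diag / 2 / (k * (M * \<xi>))"
    unfolding B_diag_def using \<xi> M k c by (simp add: field_simps power2_eq_square)
  also have "\<dots> \<le> B_diag / (k * (M * \<xi>))"
    using \<xi> M k c L C unfolding B_diag_def by (intro divide_right_mono) (auto intro!: mult_nonneg_nonneg add_nonneg_nonneg)
  finally show ?thesis .
qed

end

section \<open>Equal frequencies: second order decay\<close>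

lemma abs_cos_diff_le: "\<bar>cos x - cos y\<bar> \<le> \<bar>x - y\<bar>" for x y :: real
proof -
  have "\<bar>cos x - cos y\<bar> = 2 * \<bar>sin ((x + y) / 2)\<bar> * \<bar>sin ((y - x) / 2)\<bar>"
    by (simp add: cos_diff_cos abs_mult)
  also have "\<dots> \<le> 2 * 1 * \<bar>(y - x) / 2\<bar>"
    by (intro mult_mono abs_sin_x_le_abs_x) auto
  finally show ?thesis by simp
qed

context profile
begin

text \<open>In the variable s = g1 t a fixed function m^4 is integrated against cos (\<kappa> s).
  \<open>\<Phi>\<close> packs two integrations by parts and vanishes at both ends; \<open>R\<close>
  contains the second derivative of m^4.\<close>

lemma weight_integral:
  assumes \<kappa>: "\<kappa> > 0"
  shows "\<bar>integral {1/L..L} (\<lambda>t. (w t)\<^sup>2 * cos (\<kappa> * g1 t))\<bar> \<le> 229376 * C * L / \<kappa>\<^sup>2"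
proof -
  define m where "m s = max 0 (quad s)" for s
  define q where "q s = 81 / 10 - 2 * s" for s :: real
  define \<Phi> where "\<Phi> t = m (g1 t) ^ 4 * (sin (\<kappa> * g1 t) / \<kappa>) + 4 * m (g1 t) ^ 3 * q (g1 t) * (cos (\<kappa> * g1 t) / \<kappa>\<^sup>2)" for t
  define R where "R t = g2 t * ((12 * (m (g1 t) * q (g1 t))\<^sup>2 - 8 * m (g1 t) ^ 3) * cos (\<kappa> * g1 t) / \<kappa>\<^sup>2)" for t
  define I where "I = integral {1/L..L} (\<lambda>t. (w t)\<^sup>2 * cos (\<kappa> * g1 t))"
  have d4: "((\<lambda>s. m s ^ 4) has_real_derivative 4 * m s ^ 3 * q s) (at s within S)" for s S
    using DERIV_quad_power[of 4 s S] by (simp add: m_def q_def)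
  have d3: "((\<lambda>s. 4 * m s ^ 3 * q s) has_real_derivative 12 * (m s * q s)\<^sup>2 - 8 * m s ^ 3) (at s within S)" for s S
  proof -
    have "((\<lambda>s. m s ^ 3) has_real_derivative 3 * m s ^ 2 * q s) (at s within S)"
      using DERIV_quad_power[of 3 s S] by (simp add: m_def q_def)
    from DERIV_cmult[OF this, of 4]
    have "((\<lambda>s. 4 * m s ^ 3) has_real_derivative 4 * (3 * m s ^ 2 * q s)) (at s within S)" .
    moreover have "(q has_real_derivative - 2) (at s within S)"
      unfolding q_def by (auto intro!: derivative_eq_intros)
    ultimately have "((\<lambda>s. 4 * m s ^ 3 * q s) has_real_derivative 4 * (3 * m s ^ 2 * q s) * q s + - 2 * (4 * m s ^ 3)) (at s within S)"
      by (rule DERIV_mult)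
    then show ?thesis by (simp add: algebra_simps power2_eq_square)
  qed
  have w2: "(w t)\<^sup>2 = - g2 t * m (g1 t) ^ 4" if "t \<in> {1/L..L}" for t
    using g2_ge[OF that] c by (simp add: w_def bump_def m_def power_mult_distrib flip: power_mult)
  have d\<Phi>: "(\<Phi> has_real_derivative R t - (w t)\<^sup>2 * cos (\<kappa> * g1 t)) (at t within {1/L..L})" if t: "t \<in> {1/L..L}" for t
  proof -
    note D = g1[OF t]
    have 1: "((\<lambda>t. m (g1 t) ^ 4) has_real_derivative 4 * m (g1 t) ^ 3 * q (g1 t) * g2 t) (at t within {1/L..L})"
      by (rule DERIV_chain2[OF d4 D])
    have 2: "((\<lambda>t. 4 * m (g1 t) ^ 3 * q (g1 t)) has_real_derivative (12 * (m (g1 t) * q (g1 t))\<^sup>2 - 8 * m (g1 t) ^ 3) * g2 t) (at t within {1/L..L})"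
      by (rule DERIV_chain2[OF d3 D])
    have 3: "((\<lambda>t. sin (\<kappa> * g1 t) / \<kappa>) has_real_derivative cos (\<kappa> * g1 t) * (\<kappa> * g2 t) / \<kappa>) (at t within {1/L..L})"
      by (intro DERIV_cdivide DERIV_chain2[where f=sin, OF DERIV_sin] DERIV_cmult D)
    have 4: "((\<lambda>t. cos (\<kappa> * g1 t) / \<kappa>\<^sup>2) has_real_derivative - sin (\<kappa> * g1 t) * (\<kappa> * g2 t) / \<kappa>\<^sup>2) (at t within {1/L..L})"
      by (intro DERIV_cdivide DERIV_chain2[where f=cos, OF DERIV_cos] DERIV_cmult D)
    show ?thesis unfolding \<Phi>_def w2[OF t] R_def
      by (rule DERIV_cong[OF DERIV_add[OF DERIV_mult[OF 1 3] DERIV_mult[OF 2 4]]])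
         (use \<kappa> in \<open>simp add: field_simps power2_eq_square\<close>)
  qed
  have ends0: "m (g1 (1/L)) = 0" "m (g1 L) = 0"
    using quad_neg[of "g1 (1/L)"] quad_neg[of "g1 L"] ends by (auto simp: m_def)
  have "((\<lambda>t. R t - (w t)\<^sup>2 * cos (\<kappa> * g1 t)) has_integral (\<Phi> L - \<Phi> (1/L))) {1/L..L}"
    by (rule fundamental_theorem_of_calculus)
       (use inv_L d\<Phi> in \<open>auto simp: has_real_derivative_iff_has_vector_derivative\<close>)
  moreover have "\<Phi> L - \<Phi> (1/L) = 0" by (simp add: \<Phi>_def ends0)
  moreover have "((\<lambda>t. (w t)\<^sup>2 * cos (\<kappa> * g1 t)) has_integral I) {1/L..L}"
    unfolding I_def by (intro integrable_integral integrable_continuous_real continuous_intros continuous_profile)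
  ultimately have RI: "(R has_integral I) {1/L..L}"
    using has_integral_add[of "\<lambda>t. R t - (w t)\<^sup>2 * cos (\<kappa> * g1 t)" 0 "{1/L..L}" "\<lambda>t. (w t)\<^sup>2 * cos (\<kappa> * g1 t)" I] by simp
  have Rb: "norm (R t) \<le> C * (229376 / \<kappa>\<^sup>2)" if t: "t \<in> {1/L..L}" for t
  proof -
    have "\<bar>m (g1 t) * q (g1 t)\<bar> \<le> 128" using max_quad(3) by (simp add: m_def q_def)
    then have "\<bar>m (g1 t) * q (g1 t)\<bar>\<^sup>2 \<le> 128\<^sup>2" by (intro power_mono) auto
    moreover have "m (g1 t) ^ 3 \<le> 16 ^ 3" "0 \<le> m (g1 t) ^ 3"
      using power_mono[OF max_quad(2)[of "g1 t"] max_quad(1), of 3] max_quad(1)[of "g1 t"] by (simp_all add: m_def)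
    \<comment> \<open>Here 16384 = 128^2 and 4096 = 16^3, so the constant is 12 * 128^2 + 8 *
      16^3.\<close>
    moreover have "\<bar>12 * a - 8 * b\<bar> \<le> 229376" if "a \<le> 16384" "0 \<le> a" "b \<le> 4096" "0 \<le> b" for a b :: real
      using that by linarith
    ultimately have "\<bar>12 * (m (g1 t) * q (g1 t))\<^sup>2 - 8 * m (g1 t) ^ 3\<bar> \<le> 229376" by simp
    then have "\<bar>12 * (m (g1 t) * q (g1 t))\<^sup>2 - 8 * m (g1 t) ^ 3\<bar> * \<bar>cos (\<kappa> * g1 t)\<bar> \<le> 229376 * 1"
      by (intro mult_mono) auto
    then have "\<bar>(12 * (m (g1 t) * q (g1 t))\<^sup>2 - 8 * m (g1 t) ^ 3) * cos (\<kappa> * g1 t) / \<kappa>\<^sup>2\<bar> \<le> 229376 / \<kappa>\<^sup>2"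
      unfolding abs_divide abs_mult by (intro frac_le) (use \<kappa> in auto)
    moreover have "\<bar>g2 t\<bar> \<le> C" using g2_ge[OF t] g2_le[OF t] c by auto
    ultimately show ?thesis unfolding R_def real_norm_def abs_mult[of "g2 t"] using C by (intro mult_mono) auto
  qed
  have "norm I \<le> C * (229376 / \<kappa>\<^sup>2) * Henstock_Kurzweil_Integration.content {1/L..L}"
    by (rule has_integral_bound_real[OF _ finite.emptyI RI]) (use Rb C in auto)
  also have "\<dots> \<le> C * (229376 / \<kappa>\<^sup>2) * L" using inv_L C by (intro mult_left_mono) (auto simp: content_real)
  finally show ?thesis unfolding I_def by (simp add: algebra_simps)
qed

definition B_near :: real where "B_near = W\<^sup>2 * (L + 1) + 7 * W\<^sup>2 * C * L + 229376 * C * L"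

text \<open>Freezing the amplitude at w^2 costs \<xi>, and replacing g(t + \<xi>) - g(t) by \<xi>
  g1(t) costs k M \<xi>^2; the remaining model integral has second order decay by
  \<open>weight_integral\<close>. This avoids the logarithms that first order decay would lose in
  the sums over k and over the shift.\<close>

lemma osc_diagonal_near:
  fixes k :: nat and \<xi> M :: real
  assumes \<xi>: "0 < \<xi>" "\<xi> \<le> L - 1/L" and M: "M > 0" and k: "1 \<le> k"
  shows "\<bar>osc M \<xi> k (- real k)\<bar> \<le> B_near * (1 / (k * (M * \<xi>))\<^sup>2 + \<xi> + k * (M * \<xi>\<^sup>2))"
proof -
  define \<kappa> where "\<kappa> = 2 * pi * M * (k * \<xi>)"
  define f where "f t = amp \<xi> t * cos (2 * pi * M * (k * g (t + \<xi>) + - real k * g t))" for t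
  define h where "h t = (w t)\<^sup>2 * cos (\<kappa> * g1 t)" for t
  define e where "e = W\<^sup>2 * \<xi> + W\<^sup>2 * (7 * (k * (M * \<xi>\<^sup>2)) * C)"
  have X: "k * (M * \<xi>) > 0" "k * (M * \<xi>\<^sup>2) \<ge> 0" using \<xi> M k by auto
  have \<kappa>: "\<kappa> \<ge> k * (M * \<xi>)"
    unfolding \<kappa>_def using X pi_gt3 mult_right_mono[of 1 "2 * pi" "k * (M * \<xi>)"] by (simp add: algebra_simps)
  have \<kappa>0: "\<kappa> > 0" using \<kappa> X(1) by linarith
  have cf: "continuous_on {1/L..L-\<xi>} f" unfolding f_def amp_def
    using \<xi> by (intro continuous_intros continuous_on_shift[OF continuous_profile(4)] continuous_on_shift[OF continuous_profile(1)]) auto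
  have ch: "continuous_on {1/L..L} h" unfolding h_def
    by (intro continuous_intros continuous_profile)
  have ch': "continuous_on {1/L..L-\<xi>} h" "continuous_on {L-\<xi>..L} h"
    using \<xi> by (auto intro!: continuous_on_subset[OF ch])
  have diff: "\<bar>f t - h t\<bar> \<le> e" if t: "t \<in> {1/L..L-\<xi>}" for t
  proof -
    have tt: "t \<in> {1/L..L}" "t + \<xi> \<in> {1/L..L}" using t \<xi> by auto
    obtain s where s: "s \<in> {t..t+\<xi>}" "w (t + \<xi>) - w t = w' s * (t + \<xi> - t)"
      using mean_value_profile[OF DERIV_w, of t "t + \<xi>"] t \<xi> by auto
    have 1: "\<bar>w (t + \<xi>) - w t\<bar> \<le> W * \<xi>"
      using abs_w'_le[of s] s t \<xi> by (simp add: abs_mult mult_right_mono)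
    obtain s where s: "s \<in> {t..t+\<xi>}" "g (t + \<xi>) - g t = g1 s * (t + \<xi> - t)"
      using mean_value_profile[OF g, of t "t + \<xi>"] t \<xi> by auto
    have "\<bar>g1 s - g1 t\<bar> \<le> C * \<xi>"
    proof -
      have "0 \<le> c * (s - t)" "C * (s - t) \<le> C * \<xi>" using c C s by auto
      then show ?thesis using g1_decrease[of t s] s tt by auto
    qed
    then have "\<bar>g1 s - g1 t\<bar> * \<xi> \<le> C * \<xi> * \<xi>" using \<xi> by (intro mult_right_mono) auto
    moreover have "(g (t + \<xi>) - g t) - \<xi> * g1 t = (g1 s - g1 t) * \<xi>" using s(2) by (simp add: algebra_simps)
    ultimately have "\<bar>(g (t + \<xi>) - g t) - \<xi> * g1 t\<bar> \<le> C * \<xi> * \<xi>" using \<xi> by (simp add: abs_mult)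
    then have "2 * pi * M * k * \<bar>(g (t + \<xi>) - g t) - \<xi> * g1 t\<bar> \<le> 2 * pi * M * k * (C * \<xi> * \<xi>)"
      using M by (intro mult_left_mono) auto
    also have "\<dots> = 2 * pi * (k * (M * \<xi>\<^sup>2) * C)" by (simp add: power2_eq_square)
    also have "\<dots> \<le> 7 * (k * (M * \<xi>\<^sup>2) * C)" using X C pi_approx by (intro mult_right_mono) auto
    finally have 2: "2 * pi * M * k * \<bar>(g (t + \<xi>) - g t) - \<xi> * g1 t\<bar> \<le> 7 * (k * (M * \<xi>\<^sup>2)) * C" by simp
    have "\<bar>cos (2 * pi * M * (k * g (t + \<xi>) + - real k * g t)) - cos (\<kappa> * g1 t)\<bar>
        \<le> \<bar>2 * pi * M * (k * g (t + \<xi>) + - real k * g t) - \<kappa> * g1 t\<bar>" by (rule abs_cos_diff_le)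
    also have "2 * pi * M * (k * g (t + \<xi>) + - real k * g t) - \<kappa> * g1 t = (2 * pi * M * k) * ((g (t + \<xi>) - g t) - \<xi> * g1 t)"
      unfolding \<kappa>_def by (simp add: algebra_simps)
    also have "\<bar>\<dots>\<bar> = 2 * pi * M * k * \<bar>(g (t + \<xi>) - g t) - \<xi> * g1 t\<bar>" using M by (simp add: abs_mult)
    finally have 3: "\<bar>cos (2 * pi * M * (k * g (t + \<xi>) + - real k * g t)) - cos (\<kappa> * g1 t)\<bar> \<le> 7 * (k * (M * \<xi>\<^sup>2)) * C"
      using 2 by linarith
    have wt: "\<bar>w t\<bar> \<le> W" by (rule abs_w_le[OF tt(1)])
    define P where "P = w t * (w (t + \<xi>) - w t) * cos (2 * pi * M * (k * g (t + \<xi>) + - real k * g t))"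
    define Q where "Q = w t * w t * (cos (2 * pi * M * (k * g (t + \<xi>) + - real k * g t)) - cos (\<kappa> * g1 t))"
    have "\<bar>w t\<bar> * \<bar>w (t + \<xi>) - w t\<bar> \<le> W * (W * \<xi>)" by (rule mult_mono[OF wt 1 W]) simp
    then have "\<bar>w t * (w (t + \<xi>) - w t)\<bar> \<le> W * (W * \<xi>)" by (simp only: abs_mult)
    then have P: "\<bar>P\<bar> \<le> W * (W * \<xi>) * 1"
      unfolding P_def abs_mult[of "w t * (w (t + \<xi>) - w t)"] using W \<xi> by (intro mult_mono) auto
    have "\<bar>w t\<bar> * \<bar>w t\<bar> \<le> W * W" by (rule mult_mono[OF wt wt W]) simp
    then have "\<bar>w t * w t\<bar> \<le> W * W" by (simp only: abs_mult)
    then have Q: "\<bar>Q\<bar> \<le> W * W * (7 * (k * (M * \<xi>\<^sup>2)) * C)"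
      unfolding Q_def abs_mult[of "w t * w t"] using W 3 by (intro mult_mono) auto
    have "f t - h t = P + Q"
      unfolding f_def h_def amp_def P_def Q_def by (simp add: algebra_simps power2_eq_square)
    then have "\<bar>f t - h t\<bar> \<le> W * (W * \<xi>) * 1 + W * W * (7 * (k * (M * \<xi>\<^sup>2)) * C)"
      using P Q by linarith
    then show ?thesis by (simp add: e_def power2_eq_square)
  qed
  have i1: "\<bar>integral {1/L..L-\<xi>} (\<lambda>t. f t - h t)\<bar> \<le> e * (L - \<xi> - 1/L)"
    by (rule abs_integral_le) (use \<xi> diff in \<open>auto intro!: continuous_intros cf ch'\<close>)
  have e0: "e \<ge> 0" unfolding e_def using \<xi> X M C by (intro add_nonneg_nonneg mult_nonneg_nonneg) auto
  have i2: "integral {1/L..L-\<xi>} (\<lambda>t. f t - h t) = integral {1/L..L-\<xi>} f - integral {1/L..L-\<xi>} h"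
    by (intro Henstock_Kurzweil_Integration.integral_diff integrable_continuous_real cf ch')
  \<comment> \<open>The model integral must extend to \<open>L\<close> for its boundary terms to
    vanish; the added piece has length \<open>\<xi>\<close>.\<close>
  have i3: "integral {1/L..L-\<xi>} h + integral {L-\<xi>..L} h = integral {1/L..L} h"
    by (rule Henstock_Kurzweil_Integration.integral_combine) (use \<xi> in \<open>auto intro!: integrable_continuous_real ch\<close>)
  have i4: "\<bar>integral {L-\<xi>..L} h\<bar> \<le> W\<^sup>2 * (L - (L - \<xi>))"
  proof (rule abs_integral_le[OF _ ch'(2)])
    fix t assume "t \<in> {L-\<xi>..L}"
    then have "\<bar>w t\<bar> \<le> W" using \<xi> by (intro abs_w_le) auto
    then have "\<bar>w t\<bar>\<^sup>2 * \<bar>cos (\<kappa> * g1 t)\<bar> \<le> W\<^sup>2 * 1" by (intro mult_mono power_mono) auto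
    then show "\<bar>h t\<bar> \<le> W\<^sup>2" by (simp add: h_def abs_mult)
  qed (use \<xi> in auto)
  have "\<bar>integral {1/L..L} h\<bar> \<le> 229376 * C * L / \<kappa>\<^sup>2"
    unfolding h_def by (rule weight_integral) (use \<kappa> X in linarith)
  also have "\<dots> \<le> 229376 * C * L / (k * (M * \<xi>))\<^sup>2"
    by (intro divide_left_mono power_mono mult_pos_pos zero_less_power \<kappa> \<kappa>0) (use C L \<xi> M k in auto)
  finally have i5: "\<bar>integral {1/L..L} h\<bar> \<le> 229376 * C * L / (k * (M * \<xi>))\<^sup>2" .
  have "osc M \<xi> k (- real k) = integral {1/L..L-\<xi>} f" unfolding osc_def f_def ..
  then have "\<bar>osc M \<xi> k (- real k)\<bar> \<le> e * (L - \<xi> - 1/L) + W\<^sup>2 * \<xi> + 229376 * C * L / (k * (M * \<xi>))\<^sup>2"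
    using i1 i2 i3 i4 i5 by (simp add: algebra_simps)
  also have "e * (L - \<xi> - 1/L) \<le> e * L"
  proof (rule mult_left_mono[OF _ e0])
    show "L - \<xi> - 1/L \<le> L" using \<xi> inv_L by linarith
  qed
  also have "e * L + W\<^sup>2 * \<xi> + 229376 * C * L / (k * (M * \<xi>))\<^sup>2
      = W\<^sup>2 * (L + 1) * \<xi> + 7 * W\<^sup>2 * C * L * (k * (M * \<xi>\<^sup>2)) + 229376 * C * L * (1 / (k * (M * \<xi>))\<^sup>2)"
    unfolding e_def by (simp add: algebra_simps)
  also have "\<dots> \<le> B_near * \<xi> + B_near * (k * (M * \<xi>\<^sup>2)) + B_near * (1 / (k * (M * \<xi>))\<^sup>2)"
    unfolding B_near_def using \<xi> X C L W by (intro add_mono mult_right_mono) auto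
  also have "\<dots> = B_near * (1 / (k * (M * \<xi>))\<^sup>2 + \<xi> + k * (M * \<xi>\<^sup>2))" by (simp add: algebra_simps)
  finally show ?thesis by simp
qed

section \<open>Correlations of the kernel in the three ranges of the shift\<close>

definition B_fej :: real where "B_fej = W * L + W * ((2 + L) / c + L * C / c\<^sup>2)"

text \<open>Each of the K - 1 nonconstant modes integrates to O(1 / M), and K <= M. So the kernel
  has bounded mean along the curve although its height is \<open>K\<close>.\<close>

lemma integral_w_fejer:
  assumes K: "1 \<le> K" "real K \<le> M"
  shows "integral {1/L..L} (\<lambda>t. w t * fejer K (M * g t)) \<le> B_fej"
proof -
  define X where "X = (2 + L) / c + L * C / c\<^sup>2"
  define f where "f k t = w t * cos (2 * pi * M * (real k * g t))" for k :: nat and t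
  have M: "M > 0" "M \<ge> 1" using K by linarith+
  have X0: "X \<ge> 0" unfolding X_def using L c C by (intro add_nonneg_nonneg divide_nonneg_nonneg mult_nonneg_nonneg) auto
  have cf: "continuous_on {1/L..L} (f k)" for k unfolding f_def by (intro continuous_intros continuous_profile)
  have fk: "\<bar>integral {1/L..L} (f k)\<bar> \<le> W * X / (2 * M)" if k: "k \<in> {1..<K}" for k
  proof -
    have k1: "real k \<ge> 1" using k by auto
    have kc: "c \<le> k * c" using k1 c mult_right_mono[of 1 "real k" c] by simp
    have "\<bar>integral {1/L..L} (f k)\<bar> \<le> W / (2 * pi * M) * ((2 + (L - 1/L)) / (k * c) + (L - 1/L) * (k * C) / (k * c)\<^sup>2)"
      unfolding f_def
    proof (rule oscillatory_integral_bound[OF _ _ _ DERIV_w DERIV_cmult[OF g] DERIV_cmult[OF g1] abs_w_le abs_w'_le])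
      fix t assume t: "t \<in> {1/L..L}"
      show "k * c \<le> \<bar>real k * g1 t\<bar>" using g1_ge[OF t] c by (simp add: abs_mult mult_left_mono)
      have "\<bar>g2 t\<bar> \<le> C" using g2_ge[OF t] g2_le[OF t] c by auto
      then show "\<bar>real k * g2 t\<bar> \<le> k * C" by (simp add: abs_mult mult_left_mono)
    qed (use inv_L M k1 c in auto)
    also have "\<dots> \<le> W / (2 * pi * M) * X"
    proof (rule mult_left_mono)
      have "(2 + (L - 1/L)) / (k * c) \<le> (2 + L) / c"
        using kc c inv_L by (intro frac_le) auto
      moreover have "(L - 1/L) * (k * C) / (k * c)\<^sup>2 \<le> L * C / c\<^sup>2"
      proof -
        have "(L - 1/L) * (k * C) / (k * c)\<^sup>2 = (L - 1/L) * C / (k * c\<^sup>2)"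
          using k1 c by (simp add: field_simps power2_eq_square)
        also have "\<dots> \<le> L * C / c\<^sup>2"
          using k1 c C inv_L mult_right_mono[of 1 "real k" "c\<^sup>2"] by (intro frac_le mult_right_mono) auto
        finally show ?thesis .
      qed
      ultimately show "(2 + (L - 1/L)) / (k * c) + (L - 1/L) * (k * C) / (k * c)\<^sup>2 \<le> X"
        unfolding X_def by linarith
    qed (use W M in auto)
    also have "\<dots> \<le> W / (2 * M) * X"
      using W M X0 pi_gt3 by (intro mult_right_mono divide_left_mono) auto
    finally show ?thesis by simp
  qed
  have "integral {1/L..L} (\<lambda>t. w t * fejer K (M * g t))
      = integral {1/L..L} (\<lambda>t. w t + (\<Sum>k=1..<K. 2 * (1 - real k / real K) * f k t))"
    unfolding fejer_expand[OF K(1)] f_def by (simp add: algebra_simps sum_distrib_left)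
  also have "\<dots> = integral {1/L..L} w + (\<Sum>k=1..<K. 2 * (1 - real k / real K) * integral {1/L..L} (f k))"
    by (subst Henstock_Kurzweil_Integration.integral_add, (intro integrable_continuous_real continuous_intros continuous_profile cf)+,
        subst Henstock_Kurzweil_Integration.integral_sum, (intro finite_atLeastLessThan integrable_continuous_real continuous_intros cf)+) simp
  also have "\<dots> \<le> W * L + (\<Sum>k=1..<K. W * X / M)"
  proof (intro add_mono sum_mono)
    have "\<bar>integral {1/L..L} w\<bar> \<le> W * (L - 1/L)"
      by (rule abs_integral_le[OF _ continuous_profile(4) abs_w_le]) (use inv_L in auto)
    also have "\<dots> \<le> W * L" using W inv_L by (intro mult_left_mono) auto
    finally show "integral {1/L..L} w \<le> W * L" by linarith
    fix k assume k: "k \<in> {1..<K}"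
    then have "real k / real K \<le> 1" by simp
    then have q: "0 \<le> 1 - real k / real K" by linarith
    have "2 * (1 - real k / real K) * integral {1/L..L} (f k) \<le> 2 * (1 - real k / real K) * (W * X / (2 * M))"
      using fk[OF k] q by (intro mult_left_mono mult_nonneg_nonneg) auto
    also have "\<dots> \<le> 2 * 1 * (W * X / (2 * M))" using k W X0 M by (intro mult_right_mono) auto
    finally show "2 * (1 - real k / real K) * integral {1/L..L} (f k) \<le> W * X / M" by simp
  qed
  also have "(\<Sum>k=1..<K. W * X / M) = (real K - 1) / M * (W * X)" using K by (simp add: of_nat_diff)
  also have "\<dots> \<le> 1 * (W * X)" using K M W X0 by (intro mult_right_mono) (auto simp: divide_le_eq)
  finally show ?thesis by (simp add: B_fej_def X_def)
qed

text \<open>Subtracting 1 removes the zeroth mode: the weighted kernel is \<open>w + V\<close>,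
  where \<open>w\<close> yields the bounded average and \<open>V\<close> the oscillating
  kernel.\<close>

definition V :: "real \<Rightarrow> nat \<Rightarrow> real \<Rightarrow> real" where "V M K t = w t * (fejer K (M * g t) - 1)"

definition corr :: "real \<Rightarrow> nat \<Rightarrow> real \<Rightarrow> real" where
  "corr M K \<xi> = integral {1/L..L-\<xi>} (\<lambda>t. V M K t * V M K (t + \<xi>))"

lemma continuous_V: "continuous_on {1/L..L} (V M K)"
  unfolding V_def by (intro continuous_intros continuous_profile)

text \<open>For a, b >= 0 the modulus of (a - 1) (b - 1) is at most a b + a + b + 1, and the linear
  terms integrate to O(1) by \<open>integral_w_fejer\<close>. Bounding the product of the two
  kernels by a multiple of their sum is therefore enough.\<close>

lemma abs_corr_le:
  assumes \<xi>: "0 \<le> \<xi>" "\<xi> \<le> L - 1/L" and K: "1 \<le> K" "real K \<le> M" and \<kappa>: "\<kappa> \<ge> 0"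
    and le: "\<And>t. t \<in> {1/L..L-\<xi>} \<Longrightarrow> fejer K (M * g t) * fejer K (M * g (t + \<xi>)) \<le> \<kappa> * (fejer K (M * g t) + fejer K (M * g (t + \<xi>)))"
  shows "\<bar>corr M K \<xi>\<bar> \<le> (2 * W * B_fej + W\<^sup>2 * L) * (1 + \<kappa>)"
proof -
  define f where "f t = w t * fejer K (M * g t)" for t
  have cf: "continuous_on {1/L..L} f" unfolding f_def by (intro continuous_intros continuous_profile)
  have f0: "0 \<le> f t" if "t \<in> {1/L..L}" for t
    unfolding f_def using w_nonneg[OF that] fejer_nonneg by simp
  have If: "integral {1/L..L} f \<le> B_fej" unfolding f_def by (rule integral_w_fejer[OF K])
  have B0: "B_fej \<ge> 0" unfolding B_fej_def using W L c C by (intro add_nonneg_nonneg mult_nonneg_nonneg divide_nonneg_nonneg) auto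
  define H where "H t = (1 + \<kappa>) * W * (f t + f (t + \<xi>)) + W\<^sup>2" for t
  have cont: "continuous_on {1/L..L-\<xi>} f" "continuous_on {1/L..L-\<xi>} (\<lambda>t. f (t + \<xi>))"
    "continuous_on {1/L..L-\<xi>} (V M K)" "continuous_on {1/L..L-\<xi>} (\<lambda>t. V M K (t + \<xi>))"
    using continuous_on_shift[OF cf \<xi>(1)] continuous_on_shift[OF continuous_V \<xi>(1)] by auto
  have VH: "norm (V M K t * V M K (t + \<xi>)) \<le> H t" if t: "t \<in> {1/L..L-\<xi>}" for t
  proof -
    have tt: "t \<in> {1/L..L}" "t + \<xi> \<in> {1/L..L}" using t \<xi> by auto
    define a b u v where "a = fejer K (M * g t)" "b = fejer K (M * g (t + \<xi>))" "u = w t" "v = w (t + \<xi>)"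
    have n: "0 \<le> a" "0 \<le> b" "0 \<le> u" "0 \<le> v" "u \<le> W" "v \<le> W"
      using fejer_nonneg w_nonneg tt abs_w_le[OF tt(1)] abs_w_le[OF tt(2)] by (auto simp: a_b_u_v_def)
    have uv: "u * v \<le> W * W" using n by (intro mult_mono) auto
    have ab: "a * b \<le> \<kappa> * (a + b)" using le[OF t] by (simp add: a_b_u_v_def)
    have "\<bar>(a - 1) * (b - 1)\<bar> \<le> a * b + (a + b) + 1"
      using n by (auto simp: algebra_simps abs_le_iff)
    also have "\<dots> \<le> (1 + \<kappa>) * (a + b) + 1" using ab by (simp add: algebra_simps)
    finally have "u * v * \<bar>(a - 1) * (b - 1)\<bar> \<le> u * v * ((1 + \<kappa>) * (a + b) + 1)" using n by (intro mult_left_mono) auto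
    also have "\<dots> = (1 + \<kappa>) * (u * a * v) + (1 + \<kappa>) * (v * b * u) + u * v" by (simp add: algebra_simps)
    also have "\<dots> \<le> (1 + \<kappa>) * (u * a * W) + (1 + \<kappa>) * (v * b * W) + W * W"
      using n uv \<kappa> by (intro add_mono mult_left_mono) auto
    also have "\<dots> = H t" by (simp add: H_def f_def a_b_u_v_def power2_eq_square algebra_simps)
    finally have "u * v * \<bar>(a - 1) * (b - 1)\<bar> \<le> H t" .
    moreover have "\<bar>V M K t * V M K (t + \<xi>)\<bar> = u * v * \<bar>(a - 1) * (b - 1)\<bar>"
      using n unfolding V_def by (simp add: a_b_u_v_def abs_mult)
    ultimately show ?thesis by simp
  qed
  have "\<bar>corr M K \<xi>\<bar> \<le> integral {1/L..L-\<xi>} H"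
    unfolding corr_def real_norm_def[symmetric] H_def
    by (rule integral_norm_bound_integral)
       (use VH in \<open>auto simp: H_def intro!: integrable_continuous_real continuous_intros cont\<close>)
  also have "\<dots> = (1 + \<kappa>) * W * (integral {1/L..L-\<xi>} f + integral {1/L..L-\<xi>} (\<lambda>t. f (t + \<xi>))) + W\<^sup>2 * (L - \<xi> - 1/L)"
    unfolding H_def using \<xi>
    by (subst Henstock_Kurzweil_Integration.integral_add, (intro integrable_continuous_real continuous_intros cont)+,
        subst Henstock_Kurzweil_Integration.integral_mult_right,
        subst Henstock_Kurzweil_Integration.integral_add, (intro integrable_continuous_real continuous_intros cont)+)
       (simp add: content_real)
  also have "\<dots> \<le> (1 + \<kappa>) * W * (B_fej + B_fej) + W\<^sup>2 * L"
  proof (intro add_mono mult_left_mono)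
    show "integral {1/L..L-\<xi>} f \<le> B_fej"
      using If integral_subset_le[of "{1/L..L-\<xi>}" "{1/L..L}" f] \<xi> f0
      by (force intro: integrable_continuous_real cont cf)
    have "integral {1/L..L-\<xi>} (\<lambda>t. f (t + \<xi>)) = integral {1/L+\<xi>..L} f"
      using integral_shift_Icc_real[of "1/L" "L-\<xi>" f \<xi>] by (simp add: o_def add.commute)
    also have "\<dots> \<le> integral {1/L..L} f"
      using f0 \<xi> by (intro integral_subset_le integrable_continuous_real cf continuous_on_subset[OF cf]) auto
    finally show "integral {1/L..L-\<xi>} (\<lambda>t. f (t + \<xi>)) \<le> B_fej" using If by simp
    show "L - \<xi> - 1/L \<le> L" using \<xi> inv_L by linarith
  qed (use \<kappa> W in auto)
  also have "\<dots> \<le> (1 + \<kappa>) * W * (B_fej + B_fej) + (1 + \<kappa>) * (W\<^sup>2 * L)"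
    using \<kappa> L mult_right_mono[of 1 "1 + \<kappa>" "W\<^sup>2 * L"] by simp
  finally show ?thesis by (simp add: algebra_simps)
qed

text \<open>The product-to-sum formula turns the two cosine expansions into the phases l g(t +
  \<xi>) \<plusminus> k g(t).\<close>

lemma corr_expand:
  assumes \<xi>: "0 \<le> \<xi>" "\<xi> \<le> L - 1/L" and K: "1 \<le> K"
  shows "corr M K \<xi> = (\<Sum>k=1..<K. \<Sum>l=1..<K. 2 * ((1 - real k / real K) * (1 - real l / real K))
      * (osc M \<xi> (real l) (real k) + osc M \<xi> (real l) (- real k)))"
proof -
  define q where "q k = 1 - real k / real K" for k
  define f where "f l k t = amp \<xi> t * cos (2 * pi * M * (l * g (t + \<xi>) + k * g t))" for l k t
  have cf: "continuous_on {1/L..L-\<xi>} (f l k)" for l k unfolding f_def amp_def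
    using \<xi> by (intro continuous_intros continuous_on_shift[OF continuous_profile(4)] continuous_on_shift[OF continuous_profile(1)]) auto
  have "V M K t * V M K (t + \<xi>) = (\<Sum>k=1..<K. \<Sum>l=1..<K. 2 * (q k * q l) * (f (real l) (real k) t + f (real l) (- real k) t))" for t
  proof -
    define A where "A k = 2 * pi * (real k * (M * g t))" for k :: nat
    define B where "B l = 2 * pi * (real l * (M * g (t + \<xi>)))" for l :: nat
    have f: "f (real l) (real k) t + f (real l) (- real k) t = 2 * (amp \<xi> t * cos (A k) * cos (B l))" for k l
    proof -
      have "2 * pi * M * (real l * g (t + \<xi>) + real k * g t) = B l + A k"
        "2 * pi * M * (real l * g (t + \<xi>) + - real k * g t) = B l - A k"
        unfolding A_def B_def by (simp_all add: algebra_simps)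
      note * = this
      show ?thesis unfolding f_def * by (simp add: cos_add cos_diff algebra_simps)
    qed
    have "V M K t * V M K (t + \<xi>) = w t * w (t + \<xi>) * (2 * (\<Sum>k=1..<K. q k * cos (A k))) * (2 * (\<Sum>l=1..<K. q l * cos (B l)))"
      unfolding V_def fejer_expand[OF K] q_def A_def B_def by simp
    also have "\<dots> = amp \<xi> t * 4 * ((\<Sum>k=1..<K. q k * cos (A k)) * (\<Sum>l=1..<K. q l * cos (B l)))"
      by (simp add: amp_def)
    also have "\<dots> = (\<Sum>k=1..<K. \<Sum>l=1..<K. amp \<xi> t * 4 * (q k * cos (A k) * (q l * cos (B l))))"
      unfolding sum_product by (simp add: sum_distrib_left)
    also have "\<dots> = (\<Sum>k=1..<K. \<Sum>l=1..<K. 2 * (q k * q l) * (f (real l) (real k) t + f (real l) (- real k) t))"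
      unfolding f by (simp add: algebra_simps)
    finally show ?thesis .
  qed
  then have "corr M K \<xi> = integral {1/L..L-\<xi>} (\<lambda>t. \<Sum>k=1..<K. \<Sum>l=1..<K. 2 * (q k * q l) * (f (real l) (real k) t + f (real l) (- real k) t))"
    unfolding corr_def by simp
  also have "\<dots> = (\<Sum>k=1..<K. \<Sum>l=1..<K. 2 * (q k * q l) * (osc M \<xi> (real l) (real k) + osc M \<xi> (real l) (- real k)))"
  proof (rule integral_unique)
    have "(f l k has_integral osc M \<xi> l k) {1/L..L-\<xi>}" for l k
      unfolding osc_def f_def[symmetric] by (intro integrable_integral integrable_continuous_real cf)
    then show "((\<lambda>t. \<Sum>k=1..<K. \<Sum>l=1..<K. 2 * (q k * q l) * (f (real l) (real k) t + f (real l) (- real k) t))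
        has_integral (\<Sum>k=1..<K. \<Sum>l=1..<K. 2 * (q k * q l) * (osc M \<xi> (real l) (real k) + osc M \<xi> (real l) (- real k)))) {1/L..L-\<xi>}"
      by (intro has_integral_sum has_integral_mult_right has_integral_add finite_atLeastLessThan)
  qed
  finally show ?thesis unfolding q_def .
qed

lemma sum_inverse_squares_le: "(\<Sum>k=1..<K. 1 / (real k)\<^sup>2) \<le> 2"
proof -
  have 1: "(\<Sum>k=1..<Suc n. 1 / (real k)\<^sup>2) \<le> 2 - 1 / real n" if "n \<ge> 1" for n
    using that
  proof (induction n rule: dec_induct)
    case (step n)
    have "1 / (real (Suc n))\<^sup>2 \<le> 1 / real n - 1 / real (Suc n)"
    proof -
      have "1 / (real (Suc n))\<^sup>2 \<le> 1 / (real n * real (Suc n))"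
        unfolding power2_eq_square using step(1) by (intro divide_left_mono mult_right_mono) auto
      also have "\<dots> = 1 / real n - 1 / real (Suc n)" using step(1) by (simp add: field_simps)
      finally show ?thesis .
    qed
    then show ?case using step by simp
  qed simp
  show ?thesis
  proof (cases "K \<ge> 2")
    case True
    then obtain n where n: "K = Suc n" "n \<ge> 1" by (cases K) auto
    have "0 \<le> 1 / real n" by simp
    then show ?thesis using 1[OF n(2)] unfolding n(1) by linarith
  next
    case False
    then have "{1..<K} = {}" by auto
    then show ?thesis by (simp only: sum.empty)
  qed
qed

text \<open>The threshold is y \<delta> = 1 with y = M \<xi>. Below it the freezing errors \<xi> = y
  \<delta>^4 and k M \<xi>^2 = k y^2 \<delta>^4 are at most \<delta> and K \<delta>, and 1 / (k y)^2
  is summable in k. Above it first order decay already gives 1 / (k y) <= \<delta>.\<close>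

lemma diagonal_sum_le:
  fixes \<xi> M \<delta> :: real
  assumes \<xi>: "0 < \<xi>" "\<xi> \<le> L - 1/L" and \<delta>: "0 < \<delta>" "\<delta> \<le> 1" and M: "M * \<delta> ^ 4 = 1" and K: "1 \<le> K"
  shows "(\<Sum>k=1..<K. \<bar>osc M \<xi> (real k) (- real k)\<bar>) \<le> (B_near + B_diag) * (2 / (M * \<xi>)\<^sup>2 + 2 * (real K)\<^sup>2 * \<delta>)"
proof -
  define y where "y = M * \<xi>"
  have iM: "M = 1 / \<delta> ^ 4" using M \<delta> by (simp add: field_simps)
  then have M0: "M > 0" using \<delta> by auto
  have y0: "y > 0" using M0 \<xi> by (simp add: y_def)
  have \<xi>y: "\<xi> = y * \<delta> ^ 4" unfolding y_def using iM \<delta> by simp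
  have K2: "1 \<le> real K" "real K \<le> (real K)\<^sup>2" using K by (auto simp: power2_eq_square)
  have B: "B_near \<ge> 0" "B_diag \<ge> 0"
    unfolding B_near_def B_diag_def using C L c by (auto intro!: add_nonneg_nonneg mult_nonneg_nonneg)
  show ?thesis
  proof (cases "y * \<delta> \<le> 1")
    case True
    have yd: "y * \<delta> ^ 4 \<le> \<delta>" "y\<^sup>2 * \<delta> ^ 4 \<le> \<delta>"
    proof -
      have "y * \<delta> ^ 4 = (y * \<delta>) * \<delta>\<^sup>2 * \<delta>" by (simp add: power2_eq_square power4_eq_xxxx)
      also have "\<dots> \<le> 1 * 1 * \<delta>" using True y0 \<delta> by (intro mult_right_mono mult_mono power_le_one) auto
      finally show "y * \<delta> ^ 4 \<le> \<delta>" by simp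
      have "y\<^sup>2 * \<delta> ^ 4 = (y * \<delta>)\<^sup>2 * \<delta> * \<delta>" by (simp add: power2_eq_square power4_eq_xxxx)
      also have "\<dots> \<le> 1 * 1 * \<delta>" using True y0 \<delta> by (intro mult_right_mono mult_mono power_le_one) auto
      finally show "y\<^sup>2 * \<delta> ^ 4 \<le> \<delta>" by simp
    qed
    have tb: "\<bar>osc M \<xi> (real k) (- real k)\<bar> \<le> B_near * (1 / y\<^sup>2 * (1 / (real k)\<^sup>2) + 2 * (real K * \<delta>))" if k: "k \<in> {1..<K}" for k
    proof -
      have "\<bar>osc M \<xi> (real k) (- real k)\<bar> \<le> B_near * (1 / (k * (M * \<xi>))\<^sup>2 + \<xi> + k * (M * \<xi>\<^sup>2))"
        using osc_diagonal_near[OF \<xi> M0, of k] k by simp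
      also have "1 / (k * (M * \<xi>))\<^sup>2 + \<xi> + k * (M * \<xi>\<^sup>2) = 1 / y\<^sup>2 * (1 / (real k)\<^sup>2) + y * \<delta> ^ 4 + k * (y\<^sup>2 * \<delta> ^ 4)"
      proof -
        have "1 / (k * (M * \<xi>))\<^sup>2 = 1 / y\<^sup>2 * (1 / (real k)\<^sup>2)" unfolding y_def by (simp add: power_mult_distrib)
        moreover have "k * (M * \<xi>\<^sup>2) = k * (y\<^sup>2 * \<delta> ^ 4)" using \<xi>y unfolding y_def by (simp add: power2_eq_square)
        ultimately show ?thesis using \<xi>y by linarith
      qed
      also have "B_near * (1 / y\<^sup>2 * (1 / (real k)\<^sup>2) + y * \<delta> ^ 4 + k * (y\<^sup>2 * \<delta> ^ 4)) \<le> B_near * (1 / y\<^sup>2 * (1 / (real k)\<^sup>2) + 2 * (real K * \<delta>))"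
      proof (rule mult_left_mono[OF _ B(1)])
        have "k * (y\<^sup>2 * \<delta> ^ 4) \<le> K * \<delta>" using yd k by (intro mult_mono) auto
        moreover have "1 * \<delta> \<le> K * \<delta>" using K2 \<delta> by (intro mult_right_mono) auto
        ultimately show "1 / y\<^sup>2 * (1 / (real k)\<^sup>2) + y * \<delta> ^ 4 + k * (y\<^sup>2 * \<delta> ^ 4) \<le> 1 / y\<^sup>2 * (1 / (real k)\<^sup>2) + 2 * (real K * \<delta>)"
          using yd by linarith
      qed
      finally show ?thesis .
    qed
    have "(\<Sum>k=1..<K. \<bar>osc M \<xi> (real k) (- real k)\<bar>) \<le> (\<Sum>k=1..<K. B_near * (1 / y\<^sup>2 * (1 / (real k)\<^sup>2) + 2 * (real K * \<delta>)))"
      by (rule sum_mono[OF tb])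
    also have "\<dots> = B_near * (1 / y\<^sup>2 * (\<Sum>k=1..<K. 1 / (real k)\<^sup>2) + (real K - 1) * (2 * (real K * \<delta>)))"
      using K by (simp only: sum_distrib_left[symmetric] sum.distrib sum_constant card_atLeastLessThan of_nat_diff of_nat_1 mult_ac)
    also have "\<dots> \<le> B_near * (1 / y\<^sup>2 * 2 + real K * (2 * (real K * \<delta>)))"
    proof (intro mult_left_mono[OF _ B(1)] add_mono mult_left_mono mult_right_mono)
      show "(\<Sum>k=1..<K. 1 / (real k)\<^sup>2) \<le> 2" by (rule sum_inverse_squares_le)
    qed (use \<delta> in auto)
    also have "\<dots> = B_near * (2 / y\<^sup>2 + 2 * (real K)\<^sup>2 * \<delta>)" by (simp add: power2_eq_square)
    also have "\<dots> \<le> (B_near + B_diag) * (2 / y\<^sup>2 + 2 * (real K)\<^sup>2 * \<delta>)"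
      using B \<delta> by (intro mult_right_mono) auto
    finally show ?thesis unfolding y_def .
  next
    case False
    then have "1 / y \<le> \<delta>" using y0 by (simp add: field_simps)
    have tb: "\<bar>osc M \<xi> (real k) (- real k)\<bar> \<le> B_diag * \<delta>" if k: "k \<in> {1..<K}" for k
    proof -
      have "\<bar>osc M \<xi> (real k) (- real k)\<bar> \<le> B_diag / (k * (M * \<xi>))" using osc_diagonal[OF \<xi> M0, of k] k by simp
      also have "\<dots> = B_diag * (1 / k * (1 / y))" by (simp add: y_def)
      also have "\<dots> \<le> B_diag * (1 * \<delta>)" using B k \<open>1 / y \<le> \<delta>\<close> y0 by (intro mult_left_mono mult_mono) auto
      finally show ?thesis by simp
    qed
    have "(\<Sum>k=1..<K. \<bar>osc M \<xi> (real k) (- real k)\<bar>) \<le> (\<Sum>k=1..<K. B_diag * \<delta>)"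
      by (rule sum_mono[OF tb])
    also have "\<dots> = (real K - 1) * (B_diag * \<delta>)" using K by (simp add: of_nat_diff)
    also have "\<dots> \<le> (real K)\<^sup>2 * (B_diag * \<delta>)" using order.trans[of "real K - 1" "real K"] K2 B \<delta> by (intro mult_right_mono mult_nonneg_nonneg) linarith+
    also have "\<dots> = B_diag * ((real K)\<^sup>2 * \<delta>)" by simp
    also have "\<dots> \<le> (B_near + B_diag) * (2 / y\<^sup>2 + 2 * (real K)\<^sup>2 * \<delta>)"
    proof (rule mult_mono)
      have "0 \<le> 2 / y\<^sup>2" "0 \<le> (real K)\<^sup>2 * \<delta>" using \<delta> by auto
      then show "(real K)\<^sup>2 * \<delta> \<le> 2 / y\<^sup>2 + 2 * (real K)\<^sup>2 * \<delta>" by linarith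
    qed (use B \<delta> in auto)
    finally show ?thesis unfolding y_def .
  qed
qed

text \<open>Fewer than K^2 pairs, each costing O(K^3 \<delta>), give K^5 \<delta>; the difference
  phases with k = l add (M \<xi>)^(-2) and a term K^2 \<delta>, which K^5 \<delta> absorbs.\<close>

lemma corr_far:
  fixes \<xi> M \<delta> :: real
  assumes \<xi>: "0 < \<xi>" "\<xi> \<le> L - 1/L" and \<delta>: "0 < \<delta>" "\<delta> \<le> 1" and M: "M * \<delta> ^ 4 = 1" and K: "1 \<le> K"
  shows "\<bar>corr M K \<xi>\<bar> \<le> 4 * (B_off + B_near + B_diag) * (1 / (M * \<xi>)\<^sup>2 + real K ^ 5 * \<delta>)"
proof -
  define D where "D k = \<bar>osc M \<xi> (real k) (- real k)\<bar>" for k :: nat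
  define E where "E = B_off * real K ^ 3 * \<delta>"
  have E0: "E \<ge> 0" unfolding E_def using B_nonneg \<delta> by simp
  have \<xi>0: "0 \<le> \<xi>" using \<xi> by simp
  have tb: "\<bar>2 * ((1 - real k / real K) * (1 - real l / real K)) * (osc M \<xi> (real l) (real k) + osc M \<xi> (real l) (- real k))\<bar>
     \<le> 4 * E + (if l = k then 2 * D k else 0)" if kl: "k \<in> {1..<K}" "l \<in> {1..<K}" for k l
  proof -
    have q: "0 \<le> 1 - real k / real K" "1 - real k / real K \<le> 1" "0 \<le> 1 - real l / real K" "1 - real l / real K \<le> 1" using kl by auto
    have "\<bar>(1 - real k / real K) * (1 - real l / real K)\<bar> \<le> 1 * 1" unfolding abs_mult using q by (intro mult_mono) auto
    moreover have "\<bar>osc M \<xi> (real l) (real k) + osc M \<xi> (real l) (- real k)\<bar> \<le> 2 * E + (if l = k then D k else 0)"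
    proof -
      have 1: "\<bar>osc M \<xi> l k\<bar> \<le> E" unfolding E_def
        using osc_off_diagonal(1)[OF \<xi>0 \<xi>(2) \<delta> M, of l "real K" k] kl by simp
      have 2: "\<bar>osc M \<xi> l (- real k)\<bar> \<le> E" if "k \<noteq> l" unfolding E_def
        using osc_off_diagonal(2)[OF \<xi>0 \<xi>(2) \<delta> M, of l "real K" k] kl that by simp
      show ?thesis
      proof (cases "l = k")
        case True
        then have "D k = \<bar>osc M \<xi> l (- real k)\<bar>" by (simp add: D_def)
        then have "\<bar>osc M \<xi> (real l) (real k) + osc M \<xi> (real l) (- real k)\<bar> \<le> 2 * E + D k"
          using 1 E0 by linarith
        then show ?thesis using True by simp
      next
        case False
        then show ?thesis using 1 2 by (simp only: if_False) linarith
      qed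
    qed
    ultimately have "2 * \<bar>(1 - real k / real K) * (1 - real l / real K)\<bar> * \<bar>osc M \<xi> (real l) (real k) + osc M \<xi> (real l) (- real k)\<bar>
       \<le> 2 * 1 * (2 * E + (if l = k then D k else 0))"
      by (intro mult_mono) auto
    then show ?thesis by (simp add: abs_mult mult.assoc split: if_splits)
  qed
  have "\<bar>corr M K \<xi>\<bar> \<le> (\<Sum>k=1..<K. \<Sum>l=1..<K. 4 * E + (if l = k then 2 * D k else 0))"
    unfolding corr_expand[OF \<xi>0 \<xi>(2) K]
    by (rule order.trans[OF sum_abs sum_mono[OF order.trans[OF sum_abs sum_mono]]]) (rule tb)
  also have "\<dots> = (real K - 1)\<^sup>2 * (4 * E) + 2 * (\<Sum>k=1..<K. D k)"
    using K by (simp add: sum.distrib of_nat_diff power2_eq_square sum_distrib_left)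
  also have "\<dots> \<le> (real K)\<^sup>2 * (4 * E) + 2 * ((B_near + B_diag) * (2 / (M * \<xi>)\<^sup>2 + 2 * (real K)\<^sup>2 * \<delta>))"
    using diagonal_sum_le[OF assms] K E0 unfolding D_def by (intro add_mono mult_right_mono power_mono mult_left_mono) auto
  also have "\<dots> \<le> (4 * B_off) * (1 / (M * \<xi>)\<^sup>2 + real K ^ 5 * \<delta>) + 4 * (B_near + B_diag) * (1 / (M * \<xi>)\<^sup>2 + real K ^ 5 * \<delta>)"
  proof (rule add_mono)
    have "(real K)\<^sup>2 * (4 * E) = (4 * B_off) * (real K ^ 5 * \<delta>)" unfolding E_def
      by (simp add: power_numeral_reduce)
    also have "\<dots> \<le> (4 * B_off) * (1 / (M * \<xi>)\<^sup>2 + real K ^ 5 * \<delta>)" using B_nonneg by (intro mult_left_mono) auto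
    finally show "(real K)\<^sup>2 * (4 * E) \<le> (4 * B_off) * (1 / (M * \<xi>)\<^sup>2 + real K ^ 5 * \<delta>)" .
    have "(real K)\<^sup>2 \<le> real K ^ 5" using K by (intro power_increasing) auto
    then have "(real K)\<^sup>2 * \<delta> \<le> real K ^ 5 * \<delta>" using \<delta> by (intro mult_right_mono) auto
    then have *: "(B_near + B_diag) * (1 / (M * \<xi>)\<^sup>2 + (real K)\<^sup>2 * \<delta>) \<le> (B_near + B_diag) * (1 / (M * \<xi>)\<^sup>2 + real K ^ 5 * \<delta>)"
      unfolding B_near_def B_diag_def using C L c by (intro mult_left_mono) (auto intro!: add_nonneg_nonneg mult_nonneg_nonneg)
    then show "2 * ((B_near + B_diag) * (2 / (M * \<xi>)\<^sup>2 + 2 * (real K)\<^sup>2 * \<delta>)) \<le> 4 * (B_near + B_diag) * (1 / (M * \<xi>)\<^sup>2 + real K ^ 5 * \<delta>)"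
    proof -
      have "2 * (\<beta> * (2 * a + 2 * b)) = 4 * (\<beta> * (a + b))" for \<beta> a b :: real by (simp add: algebra_simps)
      from this[of "B_near + B_diag" "1 / (M * \<xi>)\<^sup>2" "(real K)\<^sup>2 * \<delta>"]
      have "2 * ((B_near + B_diag) * (2 / (M * \<xi>)\<^sup>2 + 2 * (real K)\<^sup>2 * \<delta>)) = 4 * ((B_near + B_diag) * (1 / (M * \<xi>)\<^sup>2 + (real K)\<^sup>2 * \<delta>))"
        by (simp add: mult.assoc)
      with * show ?thesis by (simp only: mult.assoc mult_left_mono)
    qed
  qed
  also have "\<dots> = 4 * (B_off + B_near + B_diag) * (1 / (M * \<xi>)\<^sup>2 + real K ^ 5 * \<delta>)" by (simp add: algebra_simps)
  finally show ?thesis .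
qed

text \<open>Meant for the shift 0, where both kernels peak together and the height \<open>K\<close>
  is the available bound.\<close>

lemma corr_trivial:
  assumes \<xi>: "0 \<le> \<xi>" "\<xi> \<le> L - 1/L" and K: "1 \<le> K" "real K \<le> M"
  shows "\<bar>corr M K \<xi>\<bar> \<le> (2 * W * B_fej + W\<^sup>2 * L) * (1 + real K)"
  by (rule abs_corr_le[OF \<xi> K]) (auto intro: fejer_mult_le_trivial)

text \<open>The hypothesis \<open>near\<close> keeps the phase difference \<theta> in (0, 1/2],
  where \<open>fejer_mult_le\<close> applies. In this range the frequency expansion would give (M
  \<xi>)^(-2) without the factor 1 / K, too much when summed over shifts below the gap.\<close>

lemma corr_near:
  assumes \<xi>: "0 < \<xi>" "\<xi> \<le> L - 1/L" and K: "1 \<le> K" "real K \<le> M" and near: "C * (M * \<xi>) \<le> 1 / 2"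
  shows "\<bar>corr M K \<xi>\<bar> \<le> (2 * W * B_fej + W\<^sup>2 * L) * (1 + 4 / (real K * (c * (M * \<xi>))\<^sup>2))"
proof (rule abs_corr_le[OF _ \<xi>(2) K])
  fix t assume t: "t \<in> {1/L..L-\<xi>}"
  define \<theta> where "\<theta> = M * (g (t + \<xi>) - g t)"
  have M: "M > 0" using K by linarith
  have gi: "c * \<xi> \<le> g (t + \<xi>) - g t" "g (t + \<xi>) - g t \<le> C * \<xi>" using g_increase[of t "t + \<xi>"] t \<xi> by auto
  have 1: "c * (M * \<xi>) \<le> \<theta>" "\<theta> \<le> C * (M * \<xi>)"
    using mult_left_mono[OF gi(1), of M] mult_left_mono[OF gi(2), of M] M by (auto simp: \<theta>_def algebra_simps)
  have pos: "0 < c * (M * \<xi>)" using c M \<xi> by simp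
  have \<theta>: "0 < \<theta>" using 1 pos by linarith
  have "fejer K (M * g t) * fejer K (M * g t + \<theta>) \<le> 4 / (real K * \<theta>\<^sup>2) * (fejer K (M * g t) + fejer K (M * g t + \<theta>))"
    by (rule fejer_mult_le) (use 1 pos near in linarith)+
  also have "\<dots> \<le> 4 / (real K * (c * (M * \<xi>))\<^sup>2) * (fejer K (M * g t) + fejer K (M * g t + \<theta>))"
    using 1 pos \<theta> K M c \<xi> fejer_nonneg by (intro mult_right_mono divide_left_mono mult_left_mono power_mono mult_pos_pos zero_less_power add_nonneg_nonneg) auto
  also have "M * g t + \<theta> = M * g (t + \<xi>)" by (simp add: \<theta>_def algebra_simps)
  finally show "fejer K (M * g t) * fejer K (M * g (t + \<xi>)) \<le> 4 / (real K * (c * (M * \<xi>))\<^sup>2) * (fejer K (M * g t) + fejer K (M * g (t + \<xi>)))" .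
qed (use \<xi> in auto)

end

section \<open>A weak type criterion for thin averages\<close>

text \<open>Growth by a factor \<open>\<rho>\<close> per step makes the largest index dominate the
  first sum and the smallest index the second; the geometric series supplies \<rho> / (\<rho> -
  1).\<close>

lemma sum_geometric_growth_le:
  fixes D :: "nat \<Rightarrow> real"
  assumes fin: "finite A" and \<rho>: "\<rho> > 1" and pos: "\<And>n. n \<ge> base \<Longrightarrow> D n > 0"
    and gr: "\<And>n. n \<ge> base \<Longrightarrow> D (Suc n) \<ge> \<rho> * D n" and A: "\<And>n. n \<in> A \<Longrightarrow> n \<ge> base"
  shows "(\<And>n. n \<in> A \<Longrightarrow> D n \<le> X) \<Longrightarrow> X \<ge> 0 \<Longrightarrow> (\<Sum>n\<in>A. D n) \<le> X * (\<rho> / (\<rho> - 1))"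
    and "(\<And>n. n \<in> A \<Longrightarrow> X \<le> D n) \<Longrightarrow> X > 0 \<Longrightarrow> (\<Sum>n\<in>A. 1 / D n) \<le> 1 / X * (\<rho> / (\<rho> - 1))"
proof -
  have grow: "D m * \<rho> ^ (n - m) \<le> D n" if "base \<le> m" "m \<le> n" for m n
    using that(2)
  proof (induction n rule: dec_induct)
    case (step k)
    have "D m * \<rho> ^ (Suc k - m) = \<rho> * (D m * \<rho> ^ (k - m))" using step by (simp add: Suc_diff_le)
    also have "\<dots> \<le> \<rho> * D k" using step \<rho> by simp
    also have "\<dots> \<le> D (Suc k)" using gr[of k] step that by simp
    finally show ?case .
  qed simp
  have geo: "(\<Sum>i\<in>B. (1 / \<rho>) ^ i) \<le> \<rho> / (\<rho> - 1)" if "finite B" for B :: "nat set"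
  proof -
    have "norm (1 / \<rho>) < 1" using \<rho> by simp
    then have "summable (\<lambda>i. (1 / \<rho>) ^ i)" "(\<Sum>i. (1 / \<rho>) ^ i) = 1 / (1 - 1 / \<rho>)"
      using summable_geometric suminf_geometric by blast+
    moreover have "1 / (1 - 1 / \<rho>) = \<rho> / (\<rho> - 1)" using \<rho> by (simp add: field_simps)
    ultimately show ?thesis using sum_le_suminf[of "\<lambda>i. (1 / \<rho>) ^ i" B] that \<rho> by simp
  qed
  show "(\<Sum>n\<in>A. D n) \<le> X * (\<rho> / (\<rho> - 1))" if le: "\<And>n. n \<in> A \<Longrightarrow> D n \<le> X" and X: "X \<ge> 0"
  proof (cases "A = {}")
    case False
    define m where "m = Max A"
    have m: "m \<in> A" "\<And>n. n \<in> A \<Longrightarrow> n \<le> m" using fin False by (auto simp: m_def)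
    have "(\<Sum>n\<in>A. D n) \<le> (\<Sum>n\<in>A. X * (1 / \<rho>) ^ (m - n))"
    proof (rule sum_mono)
      fix n assume n: "n \<in> A"
      have "D n * \<rho> ^ (m - n) \<le> X" using grow[of n m] A[OF n] m(2)[OF n] le[OF m(1)] by simp
      then show "D n \<le> X * (1 / \<rho>) ^ (m - n)" using \<rho> by (simp add: power_one_over field_simps)
    qed
    also have "\<dots> = X * (\<Sum>i\<in>(\<lambda>n. m - n) ` A. (1 / \<rho>) ^ i)"
    proof -
      have "inj_on (\<lambda>n. m - n) A" using m(2) by (intro inj_onI) (metis diff_diff_cancel)
      then show ?thesis by (simp add: sum.reindex sum_distrib_left)
    qed
    also have "\<dots> \<le> X * (\<rho> / (\<rho> - 1))" using geo fin X by (intro mult_left_mono) auto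
    finally show ?thesis .
  qed (use X \<rho> in simp)
  show "(\<Sum>n\<in>A. 1 / D n) \<le> 1 / X * (\<rho> / (\<rho> - 1))" if le: "\<And>n. n \<in> A \<Longrightarrow> X \<le> D n" and X: "X > 0"
  proof (cases "A = {}")
    case False
    define m where "m = Min A"
    have m: "m \<in> A" "\<And>n. n \<in> A \<Longrightarrow> m \<le> n" using fin False by (auto simp: m_def)
    have "(\<Sum>n\<in>A. 1 / D n) \<le> (\<Sum>n\<in>A. 1 / X * (1 / \<rho>) ^ (n - m))"
    proof (rule sum_mono)
      fix n assume n: "n \<in> A"
      have "X * \<rho> ^ (n - m) \<le> D m * \<rho> ^ (n - m)" using le[OF m(1)] \<rho> by (intro mult_right_mono) auto
      also have "\<dots> \<le> D n" using grow[of m n] A[OF m(1)] m(2)[OF n] by simp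
      finally have "1 / D n \<le> 1 / (X * \<rho> ^ (n - m))" using X \<rho> by (intro divide_left_mono) (auto intro!: mult_pos_pos pos A n)
      then show "1 / D n \<le> 1 / X * (1 / \<rho>) ^ (n - m)" by (simp add: power_one_over)
    qed
    also have "\<dots> = 1 / X * (\<Sum>i\<in>(\<lambda>n. n - m) ` A. (1 / \<rho>) ^ i)"
    proof -
      have "inj_on (\<lambda>n. n - m) A" using m(2) by (intro inj_onI) (metis le_add_diff_inverse2)
      then show ?thesis by (simp add: sum.reindex sum_distrib_left)
    qed
    also have "\<dots> \<le> 1 / X * (\<rho> / (\<rho> - 1))" using geo fin X by (intro mult_left_mono) auto
    finally show ?thesis .
  qed (use X \<rho> in simp)
qed

lemma sum_Un_le:
  fixes f :: "'a \<Rightarrow> real"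
  assumes "finite A" "finite B" "\<And>x. f x \<ge> 0"
  shows "sum f (A \<union> B) \<le> sum f A + sum f B"
  using sum.union_inter[OF assms(1,2), of f] sum_nonneg[of "A \<inter> B" f] assms(3) by simp

text \<open>Comparison with the increments of r arctan (x / r): each half line contributes at most r
  pi / 2 <= 2 r, and the point 0 contributes 1.\<close>

lemma sum_lorentz_le:
  fixes r :: real
  assumes r: "r > 0" and X: "finite (X :: int set)"
  shows "(\<Sum>x\<in>X. r\<^sup>2 / (r\<^sup>2 + (of_int x)\<^sup>2)) \<le> 1 + 4 * r"
proof -
  define q where "q x = r\<^sup>2 / (r\<^sup>2 + x\<^sup>2)" for x :: real
  have q0: "q x \<ge> 0" for x unfolding q_def by simp
  have step: "q (real (Suc x)) \<le> r * (arctan (real (Suc x) / r) - arctan (real x / r))" for x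
  proof -
    have d: "((\<lambda>u. arctan (u / r)) has_real_derivative inverse (1 + (u / r)\<^sup>2) * (1 / r)) (at u)" for u
      by (rule DERIV_chain2[OF DERIV_arctan DERIV_cdivide[OF DERIV_ident]])
    obtain u where u: "real x < u" "u < real (Suc x)"
      "arctan (real (Suc x) / r) - arctan (real x / r) = (real (Suc x) - real x) * (inverse (1 + (u / r)\<^sup>2) * (1 / r))"
      using MVT2[of "real x" "real (Suc x)" "\<lambda>u. arctan (u / r)" "\<lambda>u. inverse (1 + (u / r)\<^sup>2) * (1 / r)"] d by auto
    have "r * (arctan (real (Suc x) / r) - arctan (real x / r)) = inverse (1 + (u / r)\<^sup>2)"
      unfolding u(3) using r by simp
    also have "\<dots> = q u" using r by (simp add: q_def field_simps)
    also have "q u \<ge> q (real (Suc x))" unfolding q_def using u r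
      by (intro divide_left_mono add_left_mono power_mono) (auto intro!: mult_pos_pos add_pos_nonneg)
    finally show ?thesis .
  qed
  have half: "(\<Sum>x\<in>{1..N}. q (real x)) \<le> 2 * r" for N
  proof -
    have "(\<Sum>x\<in>{1..N}. q (real x)) = (\<Sum>x<N. q (real (Suc x)))"
      by (rule sum.reindex_bij_witness[of _ Suc "\<lambda>x. x - 1"]) auto
    also have "\<dots> \<le> (\<Sum>x<N. r * (arctan (real (Suc x) / r) - arctan (real x / r)))"
      by (intro sum_mono step)
    also have "\<dots> = r * (arctan (real N / r) - arctan (real 0 / r))"
      unfolding sum_distrib_left[symmetric] by (subst sum_lessThan_telescope[of "\<lambda>x. arctan (real x / r)"]) simp
    also have "\<dots> \<le> r * 2" using arctan_ubound[of "real N / r"] pi_less_4 r by (intro mult_left_mono) auto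
    finally show ?thesis by simp
  qed
  define N where "N = nat (Max (insert 0 (abs ` X)))"
  have N: "\<bar>x\<bar> \<le> int N" if "x \<in> X" for x
  proof -
    have "\<bar>x\<bar> \<le> Max (insert 0 (abs ` X))" using that X by (intro Max_ge) auto
    moreover from this have "0 \<le> Max (insert 0 (abs ` X))" by linarith
    ultimately show ?thesis by (simp add: N_def)
  qed
  have sub: "X \<subseteq> {0} \<union> int ` {1..N} \<union> (\<lambda>x. - int x) ` {1..N}"
  proof
    fix x assume "x \<in> X"
    with N[of x] have "\<bar>x\<bar> \<le> int N" by blast
    note le = this
    consider "x = 0" | "x > 0" | "x < 0" by linarith
    then show "x \<in> {0} \<union> int ` {1..N} \<union> (\<lambda>x. - int x) ` {1..N}"
    proof cases
      case 2
      then have "nat x \<in> {1..N}" "x = int (nat x)" using le by (simp_all add: nat_le_iff Suc_le_eq)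
      then show ?thesis by blast
    next
      case 3
      then have "nat (- x) \<in> {1..N}" "x = - int (nat (- x))" using le by (simp_all add: nat_le_iff Suc_le_eq)
      then show ?thesis by blast
    qed simp
  qed
  have "(\<Sum>x\<in>X. q (of_int x)) \<le> (\<Sum>x\<in>{0} \<union> int ` {1..N} \<union> (\<lambda>x. - int x) ` {1..N}. q (of_int x))"
    by (rule sum_mono2) (use sub q0 in auto)
  also have "\<dots> \<le> (\<Sum>x\<in>{0} \<union> int ` {1..N}. q (of_int x)) + (\<Sum>x\<in>(\<lambda>x. - int x) ` {1..N}. q (of_int x))"
    using q0 by (intro sum_Un_le) auto
  also have "\<dots> \<le> (\<Sum>x\<in>{0}. q (of_int x)) + (\<Sum>x\<in>int ` {1..N}. q (of_int x)) + (\<Sum>x\<in>(\<lambda>x. - int x) ` {1..N}. q (of_int x))"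
    using q0 by (intro add_right_mono sum_Un_le) auto
  also have "\<dots> = 1 + (\<Sum>x\<in>{1..N}. q (real x)) + (\<Sum>x\<in>{1..N}. q (real x))"
    using r by (simp add: sum.reindex inj_on_def q_def)
  also have "\<dots> \<le> 1 + 4 * r" using half[of N] by linarith
  finally show ?thesis by (simp add: q_def)
qed

text \<open>In the application \<open>D n\<close> is \<phi>(2^n), \<open>S n\<close> the thin set
  near 2^n, and \<open>A\<close>, \<open>T\<close> the smooth and the oscillating kernel.
  \<open>lower\<close> is required on whole unit intervals so that counts of integers can be
  compared with integrals. The two quotients in \<open>correlation\<close> sum over the shifts to
  O(2^n / D n), hence to a kernel of mass O(1 / D n).\<close>

locale kernels =
  fixes S :: "nat \<Rightarrow> nat set" and D :: "nat \<Rightarrow> real" and A T :: "nat \<Rightarrow> real \<Rightarrow> real"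
    and \<epsilon> :: "nat \<Rightarrow> real" and n0 Q :: nat and \<rho> \<kappa> C1 C2 C3 :: real
  assumes S: "\<And>n. n \<ge> n0 \<Longrightarrow> S n \<subseteq> {0..2 * 2 ^ n}" "\<And>n. n \<ge> n0 \<Longrightarrow> real (card (S n)) \<le> C1 * D n"
    and D: "\<And>n. n \<ge> n0 \<Longrightarrow> D n > 0" "\<And>n. n \<ge> n0 \<Longrightarrow> D (Suc n) \<ge> \<rho> * D n" "\<And>n. n \<ge> n0 \<Longrightarrow> D n \<le> 2 ^ n"
    and \<rho>: "\<rho> > 1" and \<kappa>: "\<kappa> > 0" and C: "C1 \<ge> 0" "C2 \<ge> 0" "C3 \<ge> 0"
    and lower: "\<And>n y s. n \<ge> n0 \<Longrightarrow> y \<in> S n \<Longrightarrow> 0 \<le> s \<Longrightarrow> s \<le> 1 \<Longrightarrow> \<kappa> / D n \<le> A n (real y + s) + T n (real y + s)"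
    and nonneg: "\<And>n t. n \<ge> n0 \<Longrightarrow> 0 \<le> A n t + T n t"
    and A: "\<And>n t. n \<ge> n0 \<Longrightarrow> 0 \<le> A n t" "\<And>n t. n \<ge> n0 \<Longrightarrow> A n t \<le> C2 / 2 ^ n"
      "\<And>n t. n \<ge> n0 \<Longrightarrow> t \<notin> {0..real Q * 2 ^ n} \<Longrightarrow> A n t = 0"
    and T: "\<And>n. n \<ge> n0 \<Longrightarrow> continuous_on UNIV (T n)" "\<And>n t. n \<ge> n0 \<Longrightarrow> t \<notin> {0..real Q * 2 ^ n} \<Longrightarrow> T n t = 0"
    and correlation: "\<And>n x. n \<ge> n0 \<Longrightarrow> \<bar>integral {0..real Q * 2 ^ n} (\<lambda>t. T n t * T n (t + real x))\<bar>
        \<le> C3 / 2 ^ n * (2 ^ n / D n / (1 + (real x)\<^sup>2) + (2 ^ n / D n)\<^sup>2 / ((2 ^ n / D n)\<^sup>2 + (real x)\<^sup>2) + \<epsilon> n)"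
    and \<epsilon>: "\<And>n. \<epsilon> n \<ge> 0" "summable \<epsilon>"

locale density = kernels +
  fixes f :: "int \<Rightarrow> real" and Z :: "int set" and lam :: real
  assumes Z: "finite Z" and f_out: "\<And>z. z \<notin> Z \<Longrightarrow> f z = 0" and f_nonneg: "\<And>z. f z \<ge> 0" and lam: "lam > 0"
begin

section \<open>Discarding the large part of a function, scale by scale\<close>

definition total :: real where "total = (\<Sum>z\<in>Z. f z)"

definition mass :: "nat \<Rightarrow> int \<Rightarrow> real" where "mass n j = (\<Sum>z\<in>{z\<in>Z. z div 2 ^ n = j}. f z)"

definition bad :: "nat \<Rightarrow> int \<Rightarrow> bool" where "bad n z \<longleftrightarrow> mass n (z div 2 ^ n) > lam * 2 ^ n"

text \<open>The height condition loosens with the scale: a value too tall at small scales passes it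
  once \<open>lam * D n\<close> has grown past it. The summation in \<open>sum_energy_le\<close>
  rests on this.\<close>

definition good_part :: "nat \<Rightarrow> int \<Rightarrow> real" where
  "good_part n z = (if bad n z \<or> f z > lam * D n then 0 else f z)"

lemma total_nonneg: "total \<ge> 0" unfolding total_def by (rule sum_nonneg) (rule f_nonneg)

lemma mass_le_total: "mass n j \<le> total"
  unfolding mass_def total_def using Z f_nonneg by (intro sum_mono2) auto

lemma good_part: "0 \<le> good_part n z" "good_part n z \<le> f z" "z \<notin> Z \<Longrightarrow> good_part n z = 0"
    "n \<ge> n0 \<Longrightarrow> good_part n z \<le> lam * D n"
  using f_nonneg f_out lam D(1)[of n] by (auto simp: good_part_def)

lemma nested_div:
  fixes z z' :: int
  assumes "z div 2 ^ n = z' div 2 ^ n" "n \<le> m" shows "z div 2 ^ m = z' div 2 ^ m"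
proof -
  have "(2::int) ^ m = 2 ^ n * 2 ^ (m - n)" using assms(2) by (simp flip: power_add)
  then show ?thesis using assms(1) by (simp add: div_mult2_eq zdiv_zmult2_eq)
qed

text \<open>A bad block of length 2^n has mass above lam 2^n, and this mass is at most
  \<open>total\<close>. So every point that is bad at some scale has a largest bad scale.\<close>

lemma finite_bad_scales: "finite {n. bad n z}"
proof -
  obtain N where N: "total / lam < 2 ^ N" using real_arch_pow[of 2 "total / lam"] by auto
  have "n < N" if "bad n z" for n
  proof (rule ccontr)
    assume "\<not> n < N"
    then have "(2::real) ^ N \<le> 2 ^ n" by (intro power_increasing) auto
    then have "lam * 2 ^ N \<le> lam * 2 ^ n" using lam by (intro mult_left_mono) auto
    moreover have "total < lam * 2 ^ N" using N lam by (simp add: pos_divide_less_eq mult.commute)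
    ultimately have "total < lam * 2 ^ n" by linarith
    then show False using that mass_le_total[of n "z div 2 ^ n"] by (simp add: bad_def)
  qed
  then have "{n. bad n z} \<subseteq> {..<N}" by auto
  then show ?thesis by (rule finite_subset) simp
qed

definition exceptional :: "int set" where
  "exceptional = {x. \<exists>n\<ge>n0. \<exists>y\<in>S n. x - int y \<in> Z \<and> bad n (x - int y)}"

text \<open>Each bad point is charged to its largest bad block. These blocks are disjoint, and each
  is shorter than its mass over lam. Since \<open>S n\<close> lies in [0, 2 * 2^n] and n is at most
  the maximal scale m, the image of a block lies among 3 * 2^m + 1 <= 4 * 2^m integers.\<close>

lemma card_exceptional: "finite exceptional \<and> real (card exceptional) \<le> 4 * total / lam"
proof -
  define N where "N z = Max {n. bad n z}" for z
  define Zb where "Zb = {z\<in>Z. \<exists>n. bad n z}"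
  define P where "P = (\<lambda>z. (N z, z div 2 ^ N z)) ` Zb"
  define J where "J p = {snd p * 2 ^ fst p..(snd p + 3) * 2 ^ fst p}" for p :: "nat \<times> int"
  define B where "B p = {z\<in>Z. z div 2 ^ fst p = snd p}" for p :: "nat \<times> int"
  have finP: "finite P" unfolding P_def Zb_def using Z by simp
  have N: "bad (N z) z" "\<And>n. bad n z \<Longrightarrow> n \<le> N z" if "z \<in> Zb" for z
    using Max_in[OF finite_bad_scales[of z]] Max_ge[OF finite_bad_scales[of z]] that by (auto simp: N_def Zb_def)
  have sub: "exceptional \<subseteq> (\<Union>p\<in>P. J p)"
  proof
    fix x assume "x \<in> exceptional"
    then obtain n y where ny: "n \<ge> n0" "y \<in> S n" "x - int y \<in> Z" "bad n (x - int y)" by (auto simp: exceptional_def)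
    define z where "z = x - int y"
    have zb: "z \<in> Zb" using ny by (auto simp: Zb_def z_def)
    have nN: "n \<le> N z" using N(2)[OF zb] ny by (simp add: z_def)
    define m where "m = N z"
    have y: "int y \<le> 2 * 2 ^ n" using S(1)[OF ny(1)] ny(2) by (auto simp: subset_iff simp flip: of_nat_le_iff[where 'a=int])
    have "(2::int) ^ n \<le> 2 ^ m" using nN by (intro power_increasing) (auto simp: m_def)
    then have y': "int y \<le> 2 * 2 ^ m" using y by linarith
    have "z div 2 ^ m * 2 ^ m + z mod 2 ^ m = z" by (rule div_mult_mod_eq)
    moreover have "0 \<le> z mod 2 ^ m" "z mod 2 ^ m < 2 ^ m" by auto
    moreover have "x = z + int y" by (simp add: z_def)
    ultimately have "z div 2 ^ m * 2 ^ m \<le> x" "x \<le> z div 2 ^ m * 2 ^ m + 3 * 2 ^ m"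
      using y' by linarith+
    then have "z div 2 ^ m * 2 ^ m \<le> x" "x \<le> (z div 2 ^ m + 3) * 2 ^ m"
      by (simp_all add: distrib_right)
    then have "x \<in> J (m, z div 2 ^ m)" by (simp add: J_def)
    then show "x \<in> (\<Union>p\<in>P. J p)" using zb by (auto simp: P_def m_def)
  qed
  have finU: "finite (\<Union>p\<in>P. J p)" using finP by (simp add: J_def)
  have cardJ: "real (card (J p)) \<le> 4 / lam * (\<Sum>z\<in>B p. f z)" if p: "p \<in> P" for p
  proof -
    obtain z where z: "z \<in> Zb" "p = (N z, z div 2 ^ N z)" using p by (auto simp: P_def)
    have "card (J p) = nat (3 * 2 ^ fst p + 1)" unfolding J_def by (simp add: algebra_simps)
    then have "real (card (J p)) = 3 * 2 ^ fst p + 1" by simp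
    also have "\<dots> \<le> 4 * 2 ^ fst p" by simp
    also have "\<dots> \<le> 4 / lam * (\<Sum>z\<in>B p. f z)"
      using N(1)[OF z(1)] z(2) lam by (simp add: bad_def mass_def B_def field_simps)
    finally show ?thesis .
  qed
  \<comment> \<open>Dyadic blocks that meet are nested; the larger one would be bad also for the
    point of the smaller one, against the maximality of that point's scale.\<close>
  have disj: "B p \<inter> B p' = {}" if "p \<in> P" "p' \<in> P" "p \<noteq> p'" for p p'
  proof -
    have *: False if p: "p \<in> P" "p' \<in> P" "p \<noteq> p'" "x \<in> B p" "x \<in> B p'" "fst p \<le> fst p'" for p p' x
    proof -
      obtain z where z: "z \<in> Zb" "p = (N z, z div 2 ^ N z)" using p by (auto simp: P_def)
      obtain z' where z': "z' \<in> Zb" "p' = (N z', z' div 2 ^ N z')" using p by (auto simp: P_def)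
      have "z div 2 ^ N z' = x div 2 ^ N z'" using nested_div[of z "N z" x "N z'"] that z z' by (auto simp: B_def)
      then have e: "z div 2 ^ N z' = z' div 2 ^ N z'" using that z' by (auto simp: B_def)
      then have "bad (N z') z" using N(1)[OF z'(1)] by (simp add: bad_def)
      then have "N z' \<le> N z" using N(2)[OF z(1)] by simp
      then have "N z = N z'" using that z z' by simp
      then show False using that z z' e by simp
    qed
    show ?thesis using *[of p p'] *[of p' p] that by (cases "fst p \<le> fst p'") auto
  qed
  have "real (card exceptional) \<le> real (card (\<Union>p\<in>P. J p))"
    using card_mono[OF finU sub] by simp
  also have "\<dots> \<le> (\<Sum>p\<in>P. real (card (J p)))"
    using card_UN_le[OF finP, of J] by (simp flip: of_nat_sum)
  also have "\<dots> \<le> (\<Sum>p\<in>P. 4 / lam * (\<Sum>z\<in>B p. f z))" by (rule sum_mono[OF cardJ])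
  also have "\<dots> = 4 / lam * (\<Sum>z\<in>(\<Union>p\<in>P. B p). f z)"
    using finP Z disj by (subst sum.UNION_disjoint) (auto simp: sum_distrib_left B_def)
  also have "\<dots> \<le> 4 / lam * total"
    unfolding total_def using lam Z f_nonneg by (intro mult_left_mono sum_mono2) (auto simp: B_def)
  finally show ?thesis using finite_subset[OF sub finU] by simp
qed

lemma finite_scales_le: "finite {n. n \<ge> n0 \<and> D n < X}"
proof -
  obtain k where k: "X / D n0 < \<rho> ^ k" using real_arch_pow[OF \<rho>] by blast
  have grow: "D n0 * \<rho> ^ i \<le> D (n0 + i)" for i
  proof (induction i)
    case (Suc i)
    have "D n0 * \<rho> ^ Suc i = \<rho> * (D n0 * \<rho> ^ i)" by simp
    also have "\<dots> \<le> \<rho> * D (n0 + i)" using Suc \<rho> by simp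
    also have "\<dots> \<le> D (n0 + Suc i)" using D(2)[of "n0 + i"] by simp
    finally show ?case .
  qed simp
  have "n < n0 + k" if "n \<ge> n0" "D n < X" for n
  proof (rule ccontr)
    assume "\<not> n < n0 + k"
    then have "\<rho> ^ k \<le> \<rho> ^ (n - n0)" using \<rho> by (intro power_increasing) auto
    then have "D n0 * \<rho> ^ k \<le> D n0 * \<rho> ^ (n - n0)" using D(1)[of n0] by simp
    also have "\<dots> \<le> D n" using grow[of "n - n0"] that by simp
    finally show False using that k D(1)[of n0] by (simp add: field_simps)
  qed
  then have "{n. n \<ge> n0 \<and> D n < X} \<subseteq> {..<n0 + k}" by auto
  then show ?thesis by (rule finite_subset) simp
qed

definition tall :: "int set" where
  "tall = {x. \<exists>n\<ge>n0. \<exists>y\<in>S n. x - int y \<in> Z \<and> f (x - int y) > lam * D n}"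

lemma finite_S: "n \<ge> n0 \<Longrightarrow> finite (S n)"
  using S(1)[of n] by (rule finite_subset) simp_all

text \<open>The value f z is too tall only at scales with D n < f z / lam, and there z reaches at
  most C1 D n points. Geometric growth sums this to a multiple of f z / lam.\<close>

lemma card_tall: "finite tall \<and> real (card tall) \<le> C1 * (\<rho> / (\<rho> - 1)) * total / lam"
proof -
  define I where "I z = {n. n \<ge> n0 \<and> D n < f z / lam}" for z
  have finI: "finite (I z)" for z unfolding I_def by (rule finite_scales_le)
  define U where "U z = (\<Union>n\<in>I z. (\<lambda>y. z + int y) ` S n)" for z
  have finU: "finite (U z)" for z unfolding U_def using finI finite_S by (auto simp: I_def)
  have sub: "tall \<subseteq> (\<Union>z\<in>Z. U z)"
  proof
    fix x assume "x \<in> tall"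
    then obtain n y where ny: "n \<ge> n0" "y \<in> S n" "x - int y \<in> Z" "f (x - int y) > lam * D n" by (auto simp: tall_def)
    then have "n \<in> I (x - int y)" using lam by (simp add: I_def field_simps)
    then have "x \<in> U (x - int y)" unfolding U_def using ny(2) by (force intro!: image_eqI[of _ _ y])
    then show "x \<in> (\<Union>z\<in>Z. U z)" using ny by blast
  qed
  have cU: "real (card (U z)) \<le> C1 * (f z / lam * (\<rho> / (\<rho> - 1)))" for z
  proof -
    have "card (U z) \<le> (\<Sum>n\<in>I z. card ((\<lambda>y. z + int y) ` S n))" unfolding U_def by (rule card_UN_le[OF finI])
    also have "\<dots> \<le> (\<Sum>n\<in>I z. card (S n))" by (intro sum_mono card_image_le finite_S) (auto simp: I_def)
    finally have "real (card (U z)) \<le> (\<Sum>n\<in>I z. real (card (S n)))" by (simp flip: of_nat_sum)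
    also have "\<dots> \<le> (\<Sum>n\<in>I z. C1 * D n)" by (intro sum_mono S(2)) (auto simp: I_def)
    also have "\<dots> = C1 * (\<Sum>n\<in>I z. D n)" by (simp add: sum_distrib_left)
    also have "\<dots> \<le> C1 * (f z / lam * (\<rho> / (\<rho> - 1)))"
      by (intro mult_left_mono C sum_geometric_growth_le(1)[where D=D and base=n0, OF finI \<rho> D(1) D(2)]) (use f_nonneg lam in \<open>auto simp: I_def\<close>)
    finally show ?thesis .
  qed
  have finZ: "finite (\<Union>z\<in>Z. U z)" using Z finU by simp
  have "real (card tall) \<le> real (card (\<Union>z\<in>Z. U z))" using card_mono[OF finZ sub] by simp
  also have "\<dots> \<le> (\<Sum>z\<in>Z. real (card (U z)))" using card_UN_le[OF Z, of U] by (simp flip: of_nat_sum)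
  also have "\<dots> \<le> (\<Sum>z\<in>Z. C1 * (f z / lam * (\<rho> / (\<rho> - 1))))" by (rule sum_mono[OF cU])
  also have "\<dots> = C1 * (\<rho> / (\<rho> - 1)) * total / lam"
    by (simp add: total_def sum_distrib_left sum_divide_distrib algebra_simps)
  finally show ?thesis using finite_subset[OF sub finZ] by simp
qed

text \<open>In a bad block every value is discarded; in any other block the mass of f itself obeys
  the bound.\<close>

lemma block_sum_le: 
  assumes "finite X" shows "(\<Sum>z\<in>{z\<in>X. z div 2 ^ n = j}. good_part n z) \<le> lam * 2 ^ n"
proof (cases "mass n j > lam * 2 ^ n")
  case True
  then have "(\<Sum>z\<in>{z\<in>X. z div 2 ^ n = j}. good_part n z) = 0"
    by (intro sum.neutral) (auto simp: good_part_def bad_def)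
  then show ?thesis using lam by simp
next
  case False
  have "(\<Sum>z\<in>{z\<in>X. z div 2 ^ n = j}. good_part n z) = (\<Sum>z\<in>{z\<in>X. z div 2 ^ n = j} \<inter> Z. good_part n z)"
    using assms good_part(3) by (intro sum.mono_neutral_right) auto
  also have "\<dots> \<le> (\<Sum>z\<in>{z\<in>X. z div 2 ^ n = j} \<inter> Z. f z)" by (intro sum_mono good_part)
  also have "\<dots> \<le> mass n j" unfolding mass_def using Z f_nonneg by (intro sum_mono2) auto
  finally show ?thesis using False by linarith
qed

lemma interval_sum_le: "(\<Sum>z\<in>{a..a + int Q * 2 ^ n}. good_part n z) \<le> real (Q + 1) * (lam * 2 ^ n)"
proof -
  let ?X = "{a..a + int Q * 2 ^ n}" and ?J = "{a div 2 ^ n..a div 2 ^ n + int Q}"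
  have "(\<lambda>z. z div 2 ^ n) ` ?X \<subseteq> ?J"
  proof (clarsimp)
    fix z :: int assume z: "a \<le> z" "z \<le> a + int Q * 2 ^ n"
    have "z div 2 ^ n \<le> (a + int Q * 2 ^ n) div 2 ^ n" using z by (intro zdiv_mono1) auto
    then show "a div 2 ^ n \<le> z div 2 ^ n \<and> z div 2 ^ n \<le> a div 2 ^ n + int Q"
      using z by (auto intro: zdiv_mono1)
  qed
  then have "(\<Sum>z\<in>?X. good_part n z) = (\<Sum>j\<in>?J. \<Sum>z\<in>{z\<in>?X. z div 2 ^ n = j}. good_part n z)"
    by (intro sum.group[symmetric]) auto
  also have "\<dots> \<le> (\<Sum>j\<in>?J. lam * 2 ^ n)" by (intro sum_mono block_sum_le) auto
  also have "\<dots> = real (Q + 1) * (lam * 2 ^ n)" by simp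
  finally show ?thesis .
qed

section \<open>Smooth and oscillating part of the averages; energy estimate\<close>

definition avg :: "nat \<Rightarrow> int \<Rightarrow> real" where "avg n x = 1 / D n * (\<Sum>y\<in>S n. f (x - int y))"

definition A_sum :: "nat \<Rightarrow> real \<Rightarrow> real" where "A_sum n u = (\<Sum>z\<in>Z. good_part n z * A n (u - of_int z))"

definition T_sum :: "nat \<Rightarrow> real \<Rightarrow> real" where "T_sum n u = (\<Sum>z\<in>Z. good_part n z * T n (u - of_int z))"

lemma A_sum_le:
  assumes n: "n \<ge> n0" shows "A_sum n u \<le> C2 * (real (Q + 1) * lam)"
proof -
  define a where "a = \<lceil>u\<rceil> - int Q * 2 ^ n"
  have out: "A n (u - of_int z) = 0" if "z \<notin> {a..a + int Q * 2 ^ n}" for z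
  proof (rule A(3)[OF n])
    show "u - of_int z \<notin> {0..real Q * 2 ^ n}"
    proof
      assume *: "u - of_int z \<in> {0..real Q * 2 ^ n}"
      then have "of_int z \<le> u" "u \<le> of_int (z + int Q * 2 ^ n)" by auto
      then have "z \<le> \<lceil>u\<rceil>" "\<lceil>u\<rceil> \<le> z + int Q * 2 ^ n" by (simp_all only: ceiling_le_iff) linarith
      then show False using that by (auto simp: a_def)
    qed
  qed
  have "A_sum n u = (\<Sum>z\<in>Z \<inter> {a..a + int Q * 2 ^ n}. good_part n z * A n (u - of_int z))"
    unfolding A_sum_def using Z out by (intro sum.mono_neutral_right) auto
  also have "\<dots> \<le> (\<Sum>z\<in>Z \<inter> {a..a + int Q * 2 ^ n}. good_part n z * (C2 / 2 ^ n))"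
    by (intro sum_mono mult_left_mono A(2)[OF n] good_part)
  also have "\<dots> \<le> (\<Sum>z\<in>{a..a + int Q * 2 ^ n}. good_part n z * (C2 / 2 ^ n))"
    using good_part(1) C by (intro sum_mono2) auto
  also have "\<dots> = (\<Sum>z\<in>{a..a + int Q * 2 ^ n}. good_part n z) * (C2 / 2 ^ n)" by (simp only: sum_distrib_right)
  also have "\<dots> \<le> real (Q + 1) * (lam * 2 ^ n) * (C2 / 2 ^ n)" using interval_sum_le C by (intro mult_right_mono) auto
  also have "\<dots> = C2 * (real (Q + 1) * lam)" by simp
  finally show ?thesis .
qed

text \<open>Off the two exceptional sets, all values met by the average survive the truncation.
  Nonnegativity of A + T then allows the sum to be enlarged from the points of \<open>S n\<close> to
  all of \<open>Z\<close>.\<close>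

lemma avg_le:
  assumes n: "n \<ge> n0" and x: "x \<notin> exceptional" "x \<notin> tall" and s: "0 \<le> s" "s \<le> 1"
  shows "\<kappa> * avg n x \<le> A_sum n (of_int x + s) + T_sum n (of_int x + s)"
proof -
  define P where "P t = A n t + T n t" for t
  have eq: "f (x - int y) = good_part n (x - int y)" if "y \<in> S n" for y
  proof (cases "x - int y \<in> Z")
    case True
    then show ?thesis using x that n by (auto simp: good_part_def exceptional_def tall_def)
  next
    case False
    then show ?thesis using f_out good_part(3) by simp
  qed
  have "\<kappa> * avg n x = (\<Sum>y\<in>S n. good_part n (x - int y) * (\<kappa> / D n))"
    unfolding avg_def by (simp add: eq sum_distrib_left sum_divide_distrib mult.commute)
  also have "\<dots> \<le> (\<Sum>y\<in>S n. good_part n (x - int y) * P (real y + s))"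
    unfolding P_def using lower[OF n _ s] good_part(1) by (intro sum_mono mult_left_mono) auto
  also have "\<dots> = (\<Sum>z\<in>(\<lambda>y. x - int y) ` S n. good_part n z * P (of_int x + s - of_int z))"
    by (subst sum.reindex) (auto simp: inj_on_def algebra_simps)
  also have "\<dots> = (\<Sum>z\<in>(\<lambda>y. x - int y) ` S n \<inter> Z. good_part n z * P (of_int x + s - of_int z))"
    using finite_S[OF n] good_part(3) by (intro sum.mono_neutral_right) auto
  also have "\<dots> \<le> (\<Sum>z\<in>Z. good_part n z * P (of_int x + s - of_int z))"
    unfolding P_def using Z good_part(1) nonneg[OF n] by (intro sum_mono2) auto
  also have "\<dots> = A_sum n (of_int x + s) + T_sum n (of_int x + s)"
    unfolding A_sum_def T_sum_def P_def by (simp add: sum.distrib distrib_left)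
  finally show ?thesis .
qed

definition lorentz :: "nat \<Rightarrow> real \<Rightarrow> real" where
  "lorentz n x = 2 ^ n / D n / (1 + x\<^sup>2) + (2 ^ n / D n)\<^sup>2 / ((2 ^ n / D n)\<^sup>2 + x\<^sup>2)"

lemma sum_lorentz_shift_le:
  assumes n: "n \<ge> n0" shows "(\<Sum>z'\<in>Z. lorentz n (of_int (z - z'))) \<le> 10 * (2 ^ n / D n)"
proof -
  let ?r = "2 ^ n / D n" and ?X = "(\<lambda>z'. z - z') ` Z"
  have r: "?r \<ge> 1" using D(1,3)[OF n] by simp
  have "(\<Sum>z'\<in>Z. lorentz n (of_int (z - z'))) = (\<Sum>x\<in>?X. lorentz n (of_int x))"
    by (subst sum.reindex) (auto simp: inj_on_def)
  also have "\<dots> = ?r * (\<Sum>x\<in>?X. 1\<^sup>2 / (1\<^sup>2 + (of_int x)\<^sup>2)) + (\<Sum>x\<in>?X. ?r\<^sup>2 / (?r\<^sup>2 + (of_int x)\<^sup>2))"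
    unfolding lorentz_def sum.distrib by (simp add: sum_distrib_left)
  also have "\<dots> \<le> ?r * (1 + 4 * 1) + (1 + 4 * ?r)"
    using r Z by (intro add_mono mult_left_mono sum_lorentz_le) auto
  also have "\<dots> \<le> 10 * ?r"
  proof -
    have "s * (1 + 4 * 1) + (1 + 4 * s) \<le> 10 * s" if "s \<ge> 1" for s :: real using that by simp
    from this[OF r] show ?thesis .
  qed
  finally show ?thesis .
qed

text \<open>A translation reduces to \<open>correlation\<close> at the distance of z and z'. Pairs
  farther apart than the support length give 0, which keeps the constant error
  \<open>\<epsilon> n\<close> from being summed over all of \<open>Z\<close>.\<close>

lemma T_correlation:
  assumes n: "n \<ge> n0" and R: "\<And>z. z \<in> Z \<Longrightarrow> \<bar>of_int z\<bar> + real Q * 2 ^ n \<le> R" and z: "z \<in> Z" "z' \<in> Z"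
  shows "\<bar>integral {-R..R} (\<lambda>u. T n (u - of_int z) * T n (u - of_int z'))\<bar>
     \<le> (if \<bar>z - z'\<bar> \<le> int Q * 2 ^ n then C3 / 2 ^ n * (lorentz n (of_int (z - z')) + \<epsilon> n) else 0)"
proof -
  have *: "\<bar>integral {-R..R} (\<lambda>u. T n (u - of_int z) * T n (u - of_int z'))\<bar>
     \<le> (if \<bar>z - z'\<bar> \<le> int Q * 2 ^ n then C3 / 2 ^ n * (lorentz n (of_int (z - z')) + \<epsilon> n) else 0)"
    if z: "z \<in> Z" "z' \<in> Z" "z' \<le> z" for z z'
  proof -
    define x where "x = nat (z - z')"
    have x: "real x = of_int z - of_int z'" using z by (simp add: x_def)
    define h where "h t = T n t * T n (t + real x)" for t
    have ch: "continuous_on B h" for B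
      unfolding h_def by (intro continuous_intros continuous_on_compose2[OF T(1)[OF n]]) auto
    have out: "h t = 0" if "t \<notin> {0..real Q * 2 ^ n}" for t
      unfolding h_def using T(2)[OF n that] by simp
    have "integral {-R..R} (\<lambda>u. T n (u - of_int z) * T n (u - of_int z')) = integral {-R - of_int z + of_int z..R - of_int z + of_int z} (\<lambda>u. h (- of_int z + u))"
      unfolding h_def x by (simp add: algebra_simps)
    also have "\<dots> = integral {-R - of_int z..R - of_int z} ((\<lambda>u. h (- of_int z + u)) \<circ> (+) (of_int z))"
      by (rule integral_shift_Icc_real[symmetric])
    also have "\<dots> = integral {-R - of_int z..R - of_int z} h" by (simp add: o_def)
    also have "\<dots> = integral {0..real Q * 2 ^ n} h"
    proof (rule integral_unique)
      have i1: "(h has_integral integral {0..real Q * 2 ^ n} h) {0..real Q * 2 ^ n}"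
        by (intro integrable_integral integrable_continuous_real ch)
      have i2: "{0..real Q * 2 ^ n} \<subseteq> {-R - of_int z..R - of_int z}"
      proof -
        have "0 \<le> real Q * 2 ^ n" by simp
        then have "-R - of_int z \<le> 0" "real Q * 2 ^ n \<le> R - of_int z" using R[OF z(1)] by linarith+
        then show ?thesis by auto
      qed
      show "(h has_integral integral {0..real Q * 2 ^ n} h) {-R - of_int z..R - of_int z}"
        by (rule has_integral_on_superset[OF i1 out i2])
    qed
    finally have eq: "integral {-R..R} (\<lambda>u. T n (u - of_int z) * T n (u - of_int z')) = integral {0..real Q * 2 ^ n} h" .
    show ?thesis
    proof (cases "z - z' \<le> int Q * 2 ^ n")
      case True
      have "\<bar>integral {0..real Q * 2 ^ n} h\<bar> \<le> C3 / 2 ^ n * (lorentz n (real x) + \<epsilon> n)"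
        using correlation[OF n, of x] unfolding lorentz_def h_def[abs_def] by simp
      then show ?thesis using True z eq x by simp
    next
      case False
      then have "int Q * 2 ^ n < int x" using z by (simp add: x_def)
      then have gt: "real Q * 2 ^ n < real x" by (simp flip: of_int_less_iff[where 'a=real])
      have "h t = 0" for t
      proof (cases "t \<in> {0..real Q * 2 ^ n}")
        case True
        then have "t + real x \<notin> {0..real Q * 2 ^ n}" using gt by auto
        then show ?thesis using T(2)[OF n] by (simp add: h_def)
      qed (use out in auto)
      then have "h = (\<lambda>_. 0)" by auto
      then have "integral {0..real Q * 2 ^ n} h = 0" by simp
      then show ?thesis using False z eq by simp
    qed
  qed
  show ?thesis
  proof (cases "z' \<le> z")
    case True then show ?thesis using * z by simp
  next
    case False
    have "lorentz n (of_int (z - z')) = lorentz n (of_int (z' - z))"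
      by (simp add: lorentz_def power2_commute)
    moreover have "\<bar>z - z'\<bar> = \<bar>z' - z\<bar>" by (rule abs_minus_commute)
    moreover have "(\<lambda>u. T n (u - of_int z) * T n (u - of_int z')) = (\<lambda>u. T n (u - of_int z') * T n (u - of_int z))"
      by (simp add: mult.commute)
    ultimately show ?thesis using *[OF z(2,1)] False by (simp only:)
  qed
qed

text \<open>The Lorentz part has row sums O(2^n / D n), so Schur's test, in the form b b' <= (b^2 +
  b'^2) / 2, bounds it by the sum of squares. The error part runs over near pairs only, and there
  the truncated function has mass O(lam 2^n).\<close>

lemma energy_le:
  assumes n: "n \<ge> n0" and R: "\<And>z. z \<in> Z \<Longrightarrow> \<bar>of_int z\<bar> + real Q * 2 ^ n \<le> R"
  shows "integral {-R..R} (\<lambda>u. (T_sum n u)\<^sup>2)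
    \<le> 10 * C3 / D n * (\<Sum>z\<in>Z. (good_part n z)\<^sup>2) + 2 * C3 * real (Q + 1) * \<epsilon> n * lam * total"
proof -
  define b where "b z = good_part n z" for z
  define near where "near z z' \<longleftrightarrow> \<bar>z - z'\<bar> \<le> int Q * 2 ^ n" for z z'
  have b0: "b z \<ge> 0" for z by (simp add: b_def good_part)
  have l0: "lorentz n x \<ge> 0" for x using D(1)[OF n] by (auto simp: lorentz_def)
  have cT: "continuous_on {-R..R} (\<lambda>u. T n (u - of_int z))" for z :: int
    by (intro continuous_on_compose2[OF T(1)[OF n]] continuous_intros) auto
  have "integral {-R..R} (\<lambda>u. (T_sum n u)\<^sup>2) = integral {-R..R} (\<lambda>u. \<Sum>z\<in>Z. \<Sum>z'\<in>Z. b z * b z' * (T n (u - of_int z) * T n (u - of_int z')))"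
    unfolding T_sum_def power2_eq_square sum_product b_def by (simp add: algebra_simps)
  also have "\<dots> = (\<Sum>z\<in>Z. \<Sum>z'\<in>Z. b z * b z' * integral {-R..R} (\<lambda>u. T n (u - of_int z) * T n (u - of_int z')))"
    by (rule integral_unique)
       (intro has_integral_sum has_integral_mult_right integrable_integral integrable_continuous_real continuous_intros cT Z)
  also have "\<dots> \<le> (\<Sum>z\<in>Z. \<Sum>z'\<in>Z. C3 / 2 ^ n * (((b z)\<^sup>2 + (b z')\<^sup>2) / 2 * lorentz n (of_int (z - z'))) + C3 / 2 ^ n * \<epsilon> n * (b z * (if near z z' then b z' else 0)))"
  proof (intro sum_mono)
    fix z z' assume z: "z \<in> Z" "z' \<in> Z"
    have bb: "b z * b z' \<le> ((b z)\<^sup>2 + (b z')\<^sup>2) / 2" using sum_squares_bound[of "b z" "b z'"] by simp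
    have "b z * b z' * integral {-R..R} (\<lambda>u. T n (u - of_int z) * T n (u - of_int z'))
      \<le> b z * b z' * (if near z z' then C3 / 2 ^ n * (lorentz n (of_int (z - z')) + \<epsilon> n) else 0)"
      using T_correlation[OF n R z] b0 unfolding near_def by (intro mult_left_mono) auto
    also have "\<dots> \<le> C3 / 2 ^ n * (b z * b z' * lorentz n (of_int (z - z'))) + C3 / 2 ^ n * \<epsilon> n * (b z * (if near z z' then b z' else 0))"
      using b0 l0 C by (auto simp: algebra_simps)
    also have "\<dots> \<le> C3 / 2 ^ n * (((b z)\<^sup>2 + (b z')\<^sup>2) / 2 * lorentz n (of_int (z - z'))) + C3 / 2 ^ n * \<epsilon> n * (b z * (if near z z' then b z' else 0))"
      using bb l0 C by (intro add_right_mono mult_left_mono mult_right_mono) auto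
    finally show "b z * b z' * integral {-R..R} (\<lambda>u. T n (u - of_int z) * T n (u - of_int z'))
      \<le> C3 / 2 ^ n * (((b z)\<^sup>2 + (b z')\<^sup>2) / 2 * lorentz n (of_int (z - z'))) + C3 / 2 ^ n * \<epsilon> n * (b z * (if near z z' then b z' else 0))" .
  qed
  also have "\<dots> = C3 / 2 ^ n * (\<Sum>z\<in>Z. \<Sum>z'\<in>Z. ((b z)\<^sup>2 + (b z')\<^sup>2) / 2 * lorentz n (of_int (z - z')))
      + C3 / 2 ^ n * \<epsilon> n * (\<Sum>z\<in>Z. b z * (\<Sum>z'\<in>Z. if near z z' then b z' else 0))"
    by (simp only: sum.distrib sum_distrib_left)
  also have "\<dots> \<le> C3 / 2 ^ n * (\<Sum>z\<in>Z. (b z)\<^sup>2 * (10 * (2 ^ n / D n)))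
      + C3 / 2 ^ n * \<epsilon> n * (\<Sum>z\<in>Z. f z * (2 * (real (Q + 1) * (lam * 2 ^ n))))"
  proof (intro add_mono mult_left_mono)
    have sym: "(\<Sum>z\<in>Z. \<Sum>z'\<in>Z. (b z')\<^sup>2 * lorentz n (of_int (z - z'))) = (\<Sum>z\<in>Z. \<Sum>z'\<in>Z. (b z)\<^sup>2 * lorentz n (of_int (z - z')))"
      by (subst sum.swap) (simp add: lorentz_def power2_commute)
    have "(\<Sum>z\<in>Z. \<Sum>z'\<in>Z. ((b z)\<^sup>2 + (b z')\<^sup>2) / 2 * lorentz n (of_int (z - z')))
       = 1 / 2 * (\<Sum>z\<in>Z. \<Sum>z'\<in>Z. (b z)\<^sup>2 * lorentz n (of_int (z - z'))) + 1 / 2 * (\<Sum>z\<in>Z. \<Sum>z'\<in>Z. (b z')\<^sup>2 * lorentz n (of_int (z - z')))"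
      unfolding sum_distrib_left sum.distrib[symmetric] by (intro sum.cong refl) (simp add: field_simps)
    also have "\<dots> = (\<Sum>z\<in>Z. (b z)\<^sup>2 * (\<Sum>z'\<in>Z. lorentz n (of_int (z - z'))))"
      unfolding sym by (simp add: sum_distrib_left)
    also have "\<dots> \<le> (\<Sum>z\<in>Z. (b z)\<^sup>2 * (10 * (2 ^ n / D n)))"
      by (intro sum_mono mult_left_mono sum_lorentz_shift_le n) auto
    finally show "(\<Sum>z\<in>Z. \<Sum>z'\<in>Z. ((b z)\<^sup>2 + (b z')\<^sup>2) / 2 * lorentz n (of_int (z - z'))) \<le> (\<Sum>z\<in>Z. (b z)\<^sup>2 * (10 * (2 ^ n / D n)))" .
    show "(\<Sum>z\<in>Z. b z * (\<Sum>z'\<in>Z. if near z z' then b z' else 0)) \<le> (\<Sum>z\<in>Z. f z * (2 * (real (Q + 1) * (lam * 2 ^ n))))"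
    proof (intro sum_mono mult_mono)
      fix z assume "z \<in> Z"
      show "b z \<le> f z" by (simp add: b_def good_part)
      let ?I = "{z - int Q * 2 ^ n..z - int Q * 2 ^ n + int Q * 2 ^ n}" and ?J = "{z..z + int Q * 2 ^ n}"
      have "(\<Sum>z'\<in>Z. if near z z' then b z' else 0) = (\<Sum>z'\<in>{z'\<in>Z. near z z'}. b z')"
        using Z by (simp add: sum.inter_filter)
      also have "\<dots> \<le> (\<Sum>z'\<in>?I \<union> ?J. b z')"
        by (intro sum_mono2) (auto simp: near_def b0)
      also have "\<dots> \<le> (\<Sum>z'\<in>?I. b z') + (\<Sum>z'\<in>?J. b z')" by (intro sum_Un_le) (auto simp: b0)
      also have "\<dots> \<le> real (Q + 1) * (lam * 2 ^ n) + real (Q + 1) * (lam * 2 ^ n)"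
        unfolding b_def by (intro add_mono interval_sum_le)
      finally show "(\<Sum>z'\<in>Z. if near z z' then b z' else 0) \<le> 2 * (real (Q + 1) * (lam * 2 ^ n))"
        by (simp only: mult_2)
    qed (use f_nonneg b0 in \<open>auto intro: sum_nonneg\<close>)
  qed (use C \<epsilon> in auto)
  also have "\<dots> = 10 * C3 / D n * (\<Sum>z\<in>Z. (b z)\<^sup>2) + 2 * C3 * real (Q + 1) * \<epsilon> n * lam * total"
    unfolding total_def sum_distrib_right[symmetric] by simp
  finally show ?thesis unfolding b_def .
qed

text \<open>The lower bound holds on a whole unit interval at each point of \<open>X\<close>, and
  these intervals meet only in endpoints, so Chebyshev's inequality on the line counts
  integers.\<close>

lemma card_le_energy:
  assumes n: "n \<ge> n0" and X: "finite X" and big: "\<And>x s. x \<in> X \<Longrightarrow> 0 \<le> s \<Longrightarrow> s \<le> 1 \<Longrightarrow> lam \<le> T_sum n (of_int x + s)"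
  shows "real (card X) * lam\<^sup>2
    \<le> 10 * C3 / D n * (\<Sum>z\<in>Z. (good_part n z)\<^sup>2) + 2 * C3 * real (Q + 1) * \<epsilon> n * lam * total"
proof -
  \<comment> \<open>An integer bound makes the integers the nodes of the partition of
    \<open>{-R..R}\<close>; the summands 1 and \<open>Q * 2 ^ n\<close> make room for the unit
    intervals and the supports of the kernels.\<close>
  define B where "B = nat (Max (insert 0 (abs ` (X \<union> Z)))) + 1 + Q * 2 ^ n"
  define R where "R = real B"
  define h where "h u = (T_sum n u)\<^sup>2" for u
  have Bge: "\<bar>x\<bar> + 1 + int Q * 2 ^ n \<le> int B" if "x \<in> X \<union> Z" for x
  proof -
    have "\<bar>x\<bar> \<le> Max (insert 0 (abs ` (X \<union> Z)))" using that X Z by (intro Max_ge) auto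
    moreover from this have "0 \<le> Max (insert 0 (abs ` (X \<union> Z)))" by linarith
    ultimately show ?thesis by (simp add: B_def)
  qed
  have Zb: "\<bar>of_int z\<bar> + real Q * 2 ^ n \<le> R" if "z \<in> Z" for z
  proof -
    have "real_of_int (\<bar>z\<bar> + 1 + int Q * 2 ^ n) \<le> real_of_int (int B)"
      using Bge[of z] that by (simp only: of_int_le_iff) auto
    then show ?thesis by (simp add: R_def)
  qed
  have Xb: "nat (x + int B) < 2 * B" "x + int B \<ge> 0" if "x \<in> X" for x
  proof -
    have "0 \<le> int Q * 2 ^ n" by simp
    then have "\<bar>x\<bar> + 1 \<le> int B" using Bge[OF UnI1[OF that]] by linarith
    then show "nat (x + int B) < 2 * B" "x + int B \<ge> 0" by linarith+
  qed
  have ch: "continuous_on U h" for U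
    unfolding h_def T_sum_def by (intro continuous_intros continuous_on_compose2[OF T(1)[OF n]]) auto
  have split: "(\<Sum>i<m. integral {-R + real i..-R + real i + 1} h) = integral {-R..-R + real m} h" for m
  proof (induction m)
    case (Suc m)
    have "integral {-R..-R + real m} h + integral {-R + real m..-R + real m + 1} h = integral {-R..-R + real m + 1} h"
      by (rule Henstock_Kurzweil_Integration.integral_combine) (auto intro: integrable_continuous_real ch)
    moreover have "-R + real (Suc m) = -R + real m + 1" by simp
    ultimately show ?case using Suc by (simp only: sum.lessThan_Suc)
  qed simp
  have h0: "0 \<le> integral {a..b} h" for a b
    unfolding h_def by (rule Henstock_Kurzweil_Integration.integral_nonneg)
      (use ch[of "{a..b}"] in \<open>auto intro: integrable_continuous_real simp: h_def[abs_def]\<close>)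
  define i where "i x = nat (x + int B)" for x
  have inj: "inj_on i X" unfolding i_def using Xb(2) by (intro inj_onI) (auto simp: eq_nat_nat_iff)
  have "real (card X) * lam\<^sup>2 = (\<Sum>x\<in>X. lam\<^sup>2)" by simp
  also have "\<dots> \<le> (\<Sum>x\<in>X. integral {-R + real (i x)..-R + real (i x) + 1} h)"
  proof (rule sum_mono)
    fix x assume x: "x \<in> X"
    have ix: "-R + real (i x) = of_int x" using Xb(2)[OF x] by (simp add: i_def R_def)
    have "integral {real_of_int x..real_of_int x + 1} (\<lambda>u. lam\<^sup>2) \<le> integral {real_of_int x..real_of_int x + 1} h"
    proof (rule Henstock_Kurzweil_Integration.integral_le)
      fix u :: real assume u: "u \<in> {of_int x..of_int x + 1}"
      then have "lam \<le> T_sum n (of_int x + (u - of_int x))" by (intro big x) auto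
      then show "lam\<^sup>2 \<le> h u" unfolding h_def using lam by (intro power_mono) auto
    qed (auto intro: integrable_continuous_real ch)
    then show "lam\<^sup>2 \<le> integral {-R + real (i x)..-R + real (i x) + 1} h" unfolding ix by simp
  qed
  also have "\<dots> = (\<Sum>j\<in>i ` X. integral {-R + real j..-R + real j + 1} h)" using inj by (simp add: sum.reindex)
  also have "\<dots> \<le> (\<Sum>j<2 * B. integral {-R + real j..-R + real j + 1} h)"
    by (intro sum_mono2) (use Xb(1) h0 in \<open>auto simp: i_def\<close>)
  also have "\<dots> = integral {-R..R} h" unfolding split by (simp add: R_def)
  also have "\<dots> \<le> 10 * C3 / D n * (\<Sum>z\<in>Z. (good_part n z)\<^sup>2) + 2 * C3 * real (Q + 1) * \<epsilon> n * lam * total"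
    unfolding h_def by (rule energy_le[OF n Zb])
  finally show ?thesis .
qed

text \<open>After multiplication by \<open>\<kappa>\<close> and removal of the smooth part, at most
  C2 (Q + 1) lam, exactly \<open>lam\<close> is left for the oscillating part.\<close>

definition threshold :: real where "threshold = (C2 * real (Q + 1) + 1) / \<kappa>"

text \<open>The summands come, in order, from \<open>exceptional\<close>, \<open>tall\<close>, the
  sums of squares and the summable errors.\<close>

definition weak_const :: real where
  "weak_const = 4 + C1 * (\<rho> / (\<rho> - 1)) + 10 * C3 * (\<rho> / (\<rho> - 1)) + 2 * C3 * real (Q + 1) * suminf \<epsilon>"

text \<open>\<open>good_part n z\<close> vanishes unless D n >= f z / lam. Over the remaining scales
  the sum of 1 / D n is at most a multiple of lam / f z, which turns the square of f z into lam f
  z.\<close>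

lemma sum_energy_le:
  assumes Ns: "finite Ns" "\<And>n. n \<in> Ns \<Longrightarrow> n \<ge> n0"
  shows "(\<Sum>n\<in>Ns. 10 * C3 / D n * (\<Sum>z\<in>Z. (good_part n z)\<^sup>2) + 2 * C3 * real (Q + 1) * \<epsilon> n * lam * total)
    \<le> (10 * C3 * (\<rho> / (\<rho> - 1)) + 2 * C3 * real (Q + 1) * suminf \<epsilon>) * lam * total"
proof -
  have each: "(\<Sum>n\<in>Ns. (good_part n z)\<^sup>2 / D n) \<le> lam * f z * (\<rho> / (\<rho> - 1))" for z
  proof (cases "f z = 0")
    case True
    then have "good_part n z = 0" for n by (simp add: good_part_def)
    then show ?thesis using True by simp
  next
    case False
    then have fz: "f z > 0" using f_nonneg[of z] by linarith
    let ?N = "{n\<in>Ns. f z / lam \<le> D n}"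
    have "(\<Sum>n\<in>Ns. (good_part n z)\<^sup>2 / D n) = (\<Sum>n\<in>?N. (good_part n z)\<^sup>2 / D n)"
    proof (rule sum.mono_neutral_right)
      show "\<forall>n\<in>Ns - ?N. (good_part n z)\<^sup>2 / D n = 0"
        using lam by (auto simp: good_part_def field_simps)
    qed (use Ns in auto)
    also have "\<dots> \<le> (\<Sum>n\<in>?N. (f z)\<^sup>2 * (1 / D n))"
    proof (rule sum_mono)
      fix n assume "n \<in> ?N"
      then have "D n > 0" using Ns D by auto
      moreover have "(good_part n z)\<^sup>2 \<le> (f z)\<^sup>2" by (intro power_mono good_part)
      ultimately show "(good_part n z)\<^sup>2 / D n \<le> (f z)\<^sup>2 * (1 / D n)" by (simp add: divide_right_mono)
    qed
    also have "\<dots> = (f z)\<^sup>2 * (\<Sum>n\<in>?N. 1 / D n)" by (simp only: sum_distrib_left)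
    also have "\<dots> \<le> (f z)\<^sup>2 * (1 / (f z / lam) * (\<rho> / (\<rho> - 1)))"
    proof (rule mult_left_mono)
      show "(\<Sum>n\<in>?N. 1 / D n) \<le> 1 / (f z / lam) * (\<rho> / (\<rho> - 1))"
        by (rule sum_geometric_growth_le(2)[where base=n0]) (use Ns fz lam \<rho> D in auto)
    qed simp
    also have "\<dots> = lam * f z * (\<rho> / (\<rho> - 1))" using fz lam by (simp add: power2_eq_square)
    finally show ?thesis .
  qed
  have "(\<Sum>n\<in>Ns. 10 * C3 / D n * (\<Sum>z\<in>Z. (good_part n z)\<^sup>2)) = 10 * C3 * (\<Sum>n\<in>Ns. \<Sum>z\<in>Z. (good_part n z)\<^sup>2 / D n)"
    by (simp add: sum_distrib_left)
  also have "(\<Sum>n\<in>Ns. \<Sum>z\<in>Z. (good_part n z)\<^sup>2 / D n) = (\<Sum>z\<in>Z. \<Sum>n\<in>Ns. (good_part n z)\<^sup>2 / D n)" by (rule sum.swap)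
  also have "10 * C3 * \<dots> \<le> 10 * C3 * (\<Sum>z\<in>Z. lam * f z * (\<rho> / (\<rho> - 1)))"
    using C by (intro mult_left_mono sum_mono each) auto
  also have "\<dots> = 10 * C3 * (\<rho> / (\<rho> - 1)) * lam * total"
    unfolding total_def sum_distrib_right[symmetric] sum_distrib_left[symmetric] by (simp add: mult_ac)
  finally have 1: "(\<Sum>n\<in>Ns. 10 * C3 / D n * (\<Sum>z\<in>Z. (good_part n z)\<^sup>2)) \<le> 10 * C3 * (\<rho> / (\<rho> - 1)) * lam * total" .
  have "(\<Sum>n\<in>Ns. 2 * C3 * real (Q + 1) * \<epsilon> n * lam * total) = (\<Sum>n\<in>Ns. \<epsilon> n) * (2 * C3 * real (Q + 1) * lam * total)"
    unfolding sum_distrib_right by (intro sum.cong refl) (simp only: mult_ac)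
  also have "\<dots> \<le> suminf \<epsilon> * (2 * C3 * real (Q + 1) * lam * total)"
    using C lam total_nonneg \<epsilon> Ns by (intro mult_right_mono sum_le_suminf) auto
  finally have 2: "(\<Sum>n\<in>Ns. 2 * C3 * real (Q + 1) * \<epsilon> n * lam * total) \<le> suminf \<epsilon> * (2 * C3 * real (Q + 1) * lam * total)" .
  show ?thesis unfolding sum.distrib using add_mono[OF 1 2] by (simp add: algebra_simps)
qed

theorem weak_type_finite:
  "finite {x. \<exists>n\<ge>n0. avg n x > threshold * lam} \<and>
   real (card {x. \<exists>n\<ge>n0. avg n x > threshold * lam}) \<le> weak_const * total / lam"
proof -
  define c where "c = threshold * lam"
  have c0: "c > 0" unfolding c_def threshold_def using \<kappa> C lam by (intro mult_pos_pos divide_pos_pos add_nonneg_pos) auto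
  \<comment> \<open>An average is at most total / D n, so only these finitely many scales can exceed
    the height \<open>c\<close>.\<close>
  define Ns where "Ns = {n. n \<ge> n0 \<and> D n < total / c}"
  have Ns: "finite Ns" "\<And>n. n \<in> Ns \<Longrightarrow> n \<ge> n0" unfolding Ns_def using finite_scales_le by auto
  define X where "X n = {x. x \<notin> exceptional \<and> x \<notin> tall \<and> avg n x > c}" for n
  have avg_total: "avg n x \<le> total / D n" if n: "n \<ge> n0" for n x
  proof -
    have "(\<Sum>y\<in>S n. f (x - int y)) = (\<Sum>z\<in>(\<lambda>y. x - int y) ` S n. f z)"
      by (subst sum.reindex) (auto simp: inj_on_def)
    also have "\<dots> = (\<Sum>z\<in>(\<lambda>y. x - int y) ` S n \<inter> Z. f z)"
      using finite_S[OF n] f_out by (intro sum.mono_neutral_right) auto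
    also have "\<dots> \<le> total" unfolding total_def using Z f_nonneg by (intro sum_mono2) auto
    finally show ?thesis unfolding avg_def using D(1)[OF n] by (simp add: divide_right_mono)
  qed
  have finX: "finite (X n)" if n: "n \<in> Ns" for n
  proof (rule finite_subset)
    show "X n \<subseteq> (\<Union>z\<in>Z. (\<lambda>y. z + int y) ` S n)"
    proof
      fix x assume "x \<in> X n"
      then have "avg n x \<noteq> 0" using c0 by (auto simp: X_def)
      then obtain y where "y \<in> S n" "f (x - int y) \<noteq> 0" unfolding avg_def by (metis mult_zero_right sum.neutral)
      then have "x - int y \<in> Z" "y \<in> S n" "x = (x - int y) + int y" using f_out by auto
      then show "x \<in> (\<Union>z\<in>Z. (\<lambda>y. z + int y) ` S n)" by blast
    qed
    show "finite (\<Union>z\<in>Z. (\<lambda>y. z + int y) ` S n)" using Z finite_S Ns(2)[OF n] by auto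
  qed
  have cardX: "real (card (X n)) * lam\<^sup>2 \<le> 10 * C3 / D n * (\<Sum>z\<in>Z. (good_part n z)\<^sup>2) + 2 * C3 * real (Q + 1) * \<epsilon> n * lam * total"
    if n: "n \<in> Ns" for n
  proof (rule card_le_energy[OF Ns(2)[OF n] finX[OF n]])
    fix x s assume x: "x \<in> X n" and s: "0 \<le> s" "s \<le> (1::real)"
    have "\<kappa> * c < \<kappa> * avg n x" using x \<kappa> by (simp add: X_def)
    also have "\<dots> \<le> A_sum n (of_int x + s) + T_sum n (of_int x + s)"
      using avg_le[OF Ns(2)[OF n] _ _ s] x by (simp add: X_def)
    also have "A_sum n (of_int x + s) \<le> C2 * (real (Q + 1) * lam)" by (rule A_sum_le[OF Ns(2)[OF n]])
    also have "\<kappa> * c = C2 * (real (Q + 1) * lam) + lam"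
      unfolding c_def threshold_def using \<kappa> by (simp add: field_simps)
    finally show "lam \<le> T_sum n (of_int x + s)" by simp
  qed
  have sub: "{x. \<exists>n\<ge>n0. avg n x > c} \<subseteq> exceptional \<union> tall \<union> (\<Union>n\<in>Ns. X n)"
  proof
    fix x assume "x \<in> {x. \<exists>n\<ge>n0. avg n x > c}"
    then obtain n where n: "n \<ge> n0" "avg n x > c" by auto
    have "c < total / D n" using n avg_total[OF n(1), of x] by linarith
    then have "n \<in> Ns" unfolding Ns_def using n c0 D(1)[OF n(1)] by (simp add: field_simps)
    then show "x \<in> exceptional \<union> tall \<union> (\<Union>n\<in>Ns. X n)" using n by (auto simp: X_def)
  qed
  have fin: "finite (exceptional \<union> tall \<union> (\<Union>n\<in>Ns. X n))" using card_exceptional card_tall Ns finX by auto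
  have divide: "s \<le> k * total / lam" if "lam\<^sup>2 * s \<le> k * lam * total" for s k
  proof -
    have "lam * (lam * s) \<le> lam * (k * total)" using that by (simp add: power2_eq_square mult_ac)
    then have "lam * s \<le> k * total" using lam by simp
    then show ?thesis using lam by (simp add: pos_le_divide_eq mult.commute)
  qed
  have "lam\<^sup>2 * (\<Sum>n\<in>Ns. real (card (X n))) \<le> (10 * C3 * (\<rho> / (\<rho> - 1)) + 2 * C3 * real (Q + 1) * suminf \<epsilon>) * lam * total"
    unfolding sum_distrib_left
    using order.trans[OF sum_mono[OF cardX] sum_energy_le[OF Ns]] by (simp add: mult.commute)
  then have EX: "(\<Sum>n\<in>Ns. real (card (X n))) \<le> (10 * C3 * (\<rho> / (\<rho> - 1)) + 2 * C3 * real (Q + 1) * suminf \<epsilon>) * total / lam"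
    by (rule divide)
  have "real (card {x. \<exists>n\<ge>n0. avg n x > c}) \<le> real (card (exceptional \<union> tall \<union> (\<Union>n\<in>Ns. X n)))"
    using card_mono[OF fin sub] by simp
  also have "\<dots> \<le> real (card exceptional) + real (card tall) + real (card (\<Union>n\<in>Ns. X n))"
    using card_Un_le[of "exceptional \<union> tall" "\<Union>n\<in>Ns. X n"] card_Un_le[of exceptional tall] by linarith
  also have "real (card (\<Union>n\<in>Ns. X n)) \<le> (\<Sum>n\<in>Ns. real (card (X n)))"
    using card_UN_le[OF Ns(1), of X] by (simp flip: of_nat_sum)
  finally have "real (card {x. \<exists>n\<ge>n0. avg n x > c}) \<le> 4 * total / lam + C1 * (\<rho> / (\<rho> - 1)) * total / lam + (10 * C3 * (\<rho> / (\<rho> - 1)) + 2 * C3 * real (Q + 1) * suminf \<epsilon>) * total / lam"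
    using card_exceptional card_tall EX by linarith
  also have "\<dots> = weak_const * total / lam" unfolding weak_const_def by (simp add: add_divide_distrib distrib_right)
  finally show ?thesis using finite_subset[OF sub fin] unfolding c_def by simp
qed

end

section \<open>Kernels attached to a regularly varying function\<close>

text \<open>\<open>Q1\<close>, \<open>Q2\<close>, \<open>Q3\<close> are t \<phi>' / \<phi>, t^2
  \<phi>'' / \<phi> and t^3 \<phi>''' / \<phi>. For the inverse of h they tend to \<gamma>, \<gamma>
  (\<gamma> - 1) and \<gamma> (\<gamma> - 1) (\<gamma> - 2), where \<gamma> > 29 / 30 is the
  reciprocal of the degree of h.\<close>

locale regular =
  fixes \<phi> Q1 Q2 Q3 :: "real \<Rightarrow> real" and y0 b a2 b2 b3 a4 :: real
  assumes y0: "y0 \<ge> 1" and b: "b < 1" and a: "a2 > 0" "a4 > 0"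
    and \<phi>_pos: "\<And>t. t \<ge> y0 \<Longrightarrow> \<phi> t > 0"
    and d1: "\<And>t. t \<ge> y0 \<Longrightarrow> (\<phi> has_real_derivative \<phi> t / t * Q1 t) (at t)"
    and d2: "\<And>t. t \<ge> y0 \<Longrightarrow> ((\<lambda>t. \<phi> t / t * Q1 t) has_real_derivative \<phi> t / t ^ 2 * Q2 t) (at t)"
    and d3: "\<And>t. t \<ge> y0 \<Longrightarrow> ((\<lambda>t. \<phi> t / t ^ 2 * Q2 t) has_real_derivative \<phi> t / t ^ 3 * Q3 t) (at t)"
    and Q1: "\<And>t. t \<ge> y0 \<Longrightarrow> 29 / 30 \<le> Q1 t" "\<And>t. t \<ge> y0 \<Longrightarrow> Q1 t \<le> b"
    and Q2: "\<And>t. t \<ge> y0 \<Longrightarrow> a2 \<le> - Q2 t" "\<And>t. t \<ge> y0 \<Longrightarrow> - Q2 t \<le> b2"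
    and Q3: "\<And>t. t \<ge> y0 \<Longrightarrow> \<bar>Q3 t\<bar> \<le> b3"
    and Q4: "\<And>t. t \<ge> y0 \<Longrightarrow> a4 \<le> Q3 t * Q1 t - (Q2 t)\<^sup>2"
begin

text \<open>The function ln \<phi>(t) - k ln t has derivative (Q1 - k) / t, whose sign is known for
  k = 29 / 30 and for k = b.\<close>

lemma growth:
  assumes s: "y0 \<le> s" "s \<le> t"
  shows "\<phi> s * (t / s) powr (29 / 30) \<le> \<phi> t" "\<phi> t \<le> \<phi> s * (t / s) powr b"
proof -
  have sp: "0 < s" "0 < t" "0 < \<phi> s" "0 < \<phi> t" using s y0 \<phi>_pos[of s] \<phi>_pos[of t] by auto
  have d: "((\<lambda>u. ln (\<phi> u) - k * ln u) has_real_derivative (Q1 u - k) / u) (at u)" if "s \<le> u" "u \<le> t" for u k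
  proof -
    have u: "u \<ge> y0" "u > 0" using that s sp by auto
    have "((\<lambda>u. ln (\<phi> u) - k * ln u) has_real_derivative (1 / \<phi> u * (\<phi> u / u * Q1 u) - k * (1 / u))) (at u)"
      using \<phi>_pos[OF u(1)] u(2)
      by (intro DERIV_diff DERIV_cmult DERIV_chain2[OF DERIV_ln_divide d1[OF u(1)]] DERIV_ln_divide) auto
    moreover have "1 / \<phi> u * (\<phi> u / u * Q1 u) - k * (1 / u) = (Q1 u - k) / u"
      using \<phi>_pos[OF u(1)] u(2) by (simp add: field_simps)
    ultimately show ?thesis by simp
  qed
  have "ln (\<phi> s) - 29 / 30 * ln s \<le> ln (\<phi> t) - 29 / 30 * ln t"
  proof (rule DERIV_nonneg_imp_nondecreasing[OF s(2)])
    fix u assume u: "s \<le> u" "u \<le> t"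
    then have "0 \<le> (Q1 u - 29 / 30) / u" using Q1[of u] s sp by simp
    then show "\<exists>y. ((\<lambda>u. ln (\<phi> u) - 29 / 30 * ln u) has_real_derivative y) (at u) \<and> 0 \<le> y" using d[OF u] by blast
  qed
  moreover have lns: "ln (t / s) = ln t - ln s" using sp by (simp add: ln_div)
  ultimately have "ln (\<phi> s) + 29 / 30 * ln (t / s) \<le> ln (\<phi> t)" by (simp add: algebra_simps)
  then have "exp (ln (\<phi> s) + 29 / 30 * ln (t / s)) \<le> exp (ln (\<phi> t))" by (simp only: exp_le_cancel_iff)
  then show "\<phi> s * (t / s) powr (29 / 30) \<le> \<phi> t" using sp by (simp add: exp_add powr_def)
  have "ln (\<phi> t) - b * ln t \<le> ln (\<phi> s) - b * ln s"
  proof (rule DERIV_nonpos_imp_nonincreasing[OF s(2)])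
    fix u assume u: "s \<le> u" "u \<le> t"
    then have "(Q1 u - b) / u \<le> 0" using Q1[of u] s sp by (simp add: divide_nonpos_pos)
    then show "\<exists>y. ((\<lambda>u. ln (\<phi> u) - b * ln u) has_real_derivative y) (at u) \<and> y \<le> 0" using d[OF u] by blast
  qed
  then have "ln (\<phi> t) \<le> ln (\<phi> s) + b * ln (t / s)" unfolding lns by (simp add: algebra_simps)
  then have "exp (ln (\<phi> t)) \<le> exp (ln (\<phi> s) + b * ln (t / s))" by (simp only: exp_le_cancel_iff)
  then show "\<phi> t \<le> \<phi> s * (t / s) powr b" using sp by (simp add: exp_add powr_def)
qed

lemma \<phi>_mono: assumes "y0 \<le> s" "s \<le> t" shows "\<phi> s \<le> \<phi> t"
proof -
  have "1 \<le> (t / s) powr (29 / 30)" using assms y0 by (intro ge_one_powr_ge_zero) auto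
  then have "\<phi> s * 1 \<le> \<phi> s * (t / s) powr (29 / 30)" using \<phi>_pos[OF assms(1)] by (intro mult_left_mono) auto
  then show ?thesis using growth(1)[OF assms] by linarith
qed

lemma \<phi>_sublinear: assumes "y0 \<le> s" "s \<le> t" shows "\<phi> t \<le> \<phi> s * (t / s)"
proof -
  have "(t / s) powr b \<le> (t / s) powr 1" using assms y0 b by (intro powr_mono) auto
  then have "\<phi> s * (t / s) powr b \<le> \<phi> s * (t / s)" using \<phi>_pos[of s] assms y0 by (intro mult_left_mono) auto
  then show ?thesis using growth(2)[OF assms] by linarith
qed

text \<open>This choice makes \<open>bump (g1 \<tau>)\<close> vanish at both ends of \<open>{1/L..L}\<close>, at every scale.\<close>

definition L :: real where "L = real (nat \<lceil>10 powr (1 / (1 - b))\<rceil> + 8)"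

lemma L: "L \<ge> 8" "L powr (1 - b) \<ge> 10"
proof -
  show "L \<ge> 8" unfolding L_def of_nat_add by linarith
  have "10 powr (1 / (1 - b)) \<le> L"
    unfolding L_def of_nat_add using real_nat_ceiling_ge[of "10 powr (1 / (1 - b))"] by linarith
  then have "(10 powr (1 / (1 - b))) powr (1 - b) \<le> L powr (1 - b)" using b by (intro powr_mono2) auto
  then show "L powr (1 - b) \<ge> 10" using b by (simp add: powr_powr)
qed

lemma relative_growth:
  assumes N: "y0 * L \<le> N" and \<tau>: "\<tau> \<in> {1/L..L}"
  shows "N * \<tau> \<ge> y0" "1 / L \<le> \<phi> (N * \<tau>) / \<phi> N" "\<phi> (N * \<tau>) / \<phi> N \<le> L"
    "\<tau> \<le> 1 \<Longrightarrow> \<tau> powr b \<le> \<phi> (N * \<tau>) / \<phi> N" "\<tau> \<le> 1 \<Longrightarrow> \<phi> (N * \<tau>) / \<phi> N \<le> 1"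
    "1 \<le> \<tau> \<Longrightarrow> 1 \<le> \<phi> (N * \<tau>) / \<phi> N" "1 \<le> \<tau> \<Longrightarrow> \<phi> (N * \<tau>) / \<phi> N \<le> \<tau> powr b"
proof -
  have Lp: "L > 0" using L by linarith
  have \<tau>p: "\<tau> > 0" using \<tau> Lp by (auto intro: less_le_trans[of 0 "1/L"])
  have Np: "N > 0" using N y0 Lp by (smt (verit) mult_pos_pos)
  have "y0 \<le> N / L" using N Lp by (simp add: field_simps)
  also have "N / L \<le> N * \<tau>" using \<tau> Np mult_left_mono[of "1/L" \<tau> N] by simp
  finally show Ny: "N * \<tau> \<ge> y0" .
  have "y0 * 1 \<le> y0 * L" using L y0 by (intro mult_left_mono) auto
  then have N1: "y0 \<le> N" using N by linarith
  note pos = \<phi>_pos[OF N1] \<phi>_pos[OF Ny]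
  show 1: "\<tau> powr b \<le> \<phi> (N * \<tau>) / \<phi> N" if "\<tau> \<le> 1"
  proof -
    have "N * \<tau> \<le> N" using that Np by simp
    then have "\<phi> N \<le> \<phi> (N * \<tau>) * (N / (N * \<tau>)) powr b" by (rule growth(2)[OF Ny])
    also have "(N / (N * \<tau>)) powr b = 1 / \<tau> powr b" using Np \<tau>p by (simp add: powr_divide)
    finally show ?thesis using pos \<tau>p by (simp add: field_simps)
  qed
  show 2: "\<phi> (N * \<tau>) / \<phi> N \<le> 1" if "\<tau> \<le> 1"
    using \<phi>_mono[OF Ny, of N] that Np pos by (simp add: field_simps)
  show 3: "1 \<le> \<phi> (N * \<tau>) / \<phi> N" if "1 \<le> \<tau>"
    using \<phi>_mono[OF N1, of "N * \<tau>"] that Np pos by (simp add: field_simps)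
  show 4: "\<phi> (N * \<tau>) / \<phi> N \<le> \<tau> powr b" if "1 \<le> \<tau>"
    using growth(2)[OF N1, of "N * \<tau>"] that Np pos by (simp add: field_simps)
  show "1 / L \<le> \<phi> (N * \<tau>) / \<phi> N"
  proof (cases "\<tau> \<le> 1")
    case True
    have "1 / L \<le> \<tau> powr 1" using \<tau> \<tau>p by simp
    also have "\<dots> \<le> \<tau> powr b" using True \<tau>p b by (intro powr_mono') auto
    finally show ?thesis using 1[OF True] by linarith
  next
    case False
    have "1 / L \<le> 1" using L by simp
    then show ?thesis using 3 False by linarith
  qed
  show "\<phi> (N * \<tau>) / \<phi> N \<le> L"
  proof (cases "\<tau> \<le> 1")
    case True
    then show ?thesis using 2 L by linarith
  next
    case False
    have "\<tau> powr b \<le> \<tau> powr 1" using False b by (intro powr_mono) auto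
    also have "\<dots> \<le> L" using \<tau> \<tau>p by simp
    finally show ?thesis using 4 False by linarith
  qed
qed

text \<open>The k-th derivative of the rescaled curve is G \<tau>^(-k) Q_k with G and 1 / \<tau>
  between 1 / L and L, whence the powers L^(k + 1). The log-convexity expression carries G^2 /
  \<tau>^4, whence L^6.\<close>

definition c :: real where "c = min (1 / (2 * L ^ 2)) (min (a2 / L ^ 3) (a4 / L ^ 6))"

definition C :: real where "C = max (L ^ 2) (max (b2 * L ^ 3) (b3 * L ^ 4))"

lemma c_pos: "c > 0" unfolding c_def using a L by auto

lemma profile:
  assumes N: "y0 * L \<le> N"
  shows "profile L c C (\<lambda>\<tau>. \<phi> (N * \<tau>) / \<phi> N) (\<lambda>\<tau>. \<phi> (N * \<tau>) / \<phi> N / \<tau> * Q1 (N * \<tau>))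
     (\<lambda>\<tau>. \<phi> (N * \<tau>) / \<phi> N / \<tau> ^ 2 * Q2 (N * \<tau>)) (\<lambda>\<tau>. \<phi> (N * \<tau>) / \<phi> N / \<tau> ^ 3 * Q3 (N * \<tau>))"
proof
  have Lp: "L > 0" "L \<ge> 1" using L by linarith+
  show "1 < L" using L by linarith
  show "0 < c" by (rule c_pos)
  have Np: "N > 0" using N y0 Lp by (smt (verit) mult_pos_pos)
  have "y0 * 1 \<le> y0 * L" using L y0 by (intro mult_left_mono) auto
  then have N1: "y0 \<le> N" using N by linarith
  note \<phi>N = \<phi>_pos[OF N1]
  {
    fix \<tau> assume \<tau>: "\<tau> \<in> {1/L..L}"
    note R = relative_growth[OF N \<tau>]
    define G where "G = \<phi> (N * \<tau>) / \<phi> N"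
    have G: "1 / L \<le> G" "G \<le> L" using R by (simp_all add: G_def)
    have \<tau>p: "\<tau> > 0" using \<tau> Lp by (auto intro: less_le_trans[of 0 "1/L"])
    have G0: "G > 0" using G Lp by (auto intro: less_le_trans[of 0 "1/L"])
    note q1 = Q1[OF R(1)] and q2 = Q2[OF R(1)] and q3 = Q3[OF R(1)] and q4 = Q4[OF R(1)]
    have i: "1 / L \<le> 1 / \<tau>" "1 / \<tau> \<le> L" using \<tau> \<tau>p Lp by (auto simp: field_simps)
    have pw: "1 / L ^ k \<le> 1 / \<tau> ^ k" "1 / \<tau> ^ k \<le> L ^ k" for k
      using power_mono[OF i(1), of k] power_mono[OF i(2), of k] Lp \<tau>p by (simp_all add: power_one_over)
    have GT: "1 / L ^ Suc k \<le> G / \<tau> ^ k" "G / \<tau> ^ k \<le> L ^ Suc k" for k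
      using mult_mono[OF G(1) pw(1)[of k]] mult_mono[OF G(2) pw(2)[of k]] Lp \<tau>p G0 by simp_all
    have GT0: "0 \<le> G / \<tau> ^ k" for k using G0 \<tau>p by simp
    have inner: "((\<lambda>\<tau>. N * \<tau>) has_real_derivative N) (at \<tau> within {1/L..L})" by (rule DERIV_cmult_Id)
    have dd: "((\<lambda>\<tau>. F (N * \<tau>) / \<phi> N * N ^ k) has_real_derivative D * N / \<phi> N * N ^ k) (at \<tau> within {1/L..L})"
      if "(F has_real_derivative D) (at (N * \<tau>))" for F D k
      by (intro DERIV_cmult_right DERIV_cdivide DERIV_chain2[OF that inner])
    show "((\<lambda>\<tau>. \<phi> (N * \<tau>) / \<phi> N) has_real_derivative \<phi> (N * \<tau>) / \<phi> N / \<tau> * Q1 (N * \<tau>)) (at \<tau> within {1/L..L})"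
      using dd[OF d1[OF R(1)], of 0] Np \<tau>p by (simp add: field_simps)
    have e1: "(\<lambda>\<tau>. \<phi> (N * \<tau>) / (N * \<tau>) * Q1 (N * \<tau>) / \<phi> N * N ^ 1) = (\<lambda>\<tau>. \<phi> (N * \<tau>) / \<phi> N / \<tau> * Q1 (N * \<tau>))"
      using Np by (simp add: fun_eq_iff field_simps)
    show "((\<lambda>\<tau>. \<phi> (N * \<tau>) / \<phi> N / \<tau> * Q1 (N * \<tau>)) has_real_derivative \<phi> (N * \<tau>) / \<phi> N / \<tau> ^ 2 * Q2 (N * \<tau>)) (at \<tau> within {1/L..L})"
      using dd[OF d2[OF R(1)], of 1] unfolding e1 using Np \<tau>p by (simp add: field_simps power2_eq_square)
    have e2: "(\<lambda>\<tau>. \<phi> (N * \<tau>) / (N * \<tau>) ^ 2 * Q2 (N * \<tau>) / \<phi> N * N ^ 2) = (\<lambda>\<tau>. \<phi> (N * \<tau>) / \<phi> N / \<tau> ^ 2 * Q2 (N * \<tau>))"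
      using Np by (simp add: fun_eq_iff field_simps)
    show "((\<lambda>\<tau>. \<phi> (N * \<tau>) / \<phi> N / \<tau> ^ 2 * Q2 (N * \<tau>)) has_real_derivative \<phi> (N * \<tau>) / \<phi> N / \<tau> ^ 3 * Q3 (N * \<tau>)) (at \<tau> within {1/L..L})"
      using dd[OF d3[OF R(1)], of 2] unfolding e2 using Np \<tau>p by (simp add: field_simps power2_eq_square power3_eq_cube)
    have "1 / L ^ 2 * (1 / 2) \<le> G / \<tau> ^ 1 * Q1 (N * \<tau>)"
      using GT(1)[of 1] q1 GT0[of 1] by (intro mult_mono) (auto simp: numeral_2_eq_2)
    then show "c \<le> \<phi> (N * \<tau>) / \<phi> N / \<tau> * Q1 (N * \<tau>)" by (simp add: c_def G_def)
    have "G / \<tau> ^ 1 * Q1 (N * \<tau>) \<le> L ^ 2 * 1"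
      using GT(2)[of 1] q1 GT0[of 1] b by (intro mult_mono) (auto simp: numeral_2_eq_2)
    then show "\<phi> (N * \<tau>) / \<phi> N / \<tau> * Q1 (N * \<tau>) \<le> C" by (simp add: C_def G_def)
    have "1 / L ^ 3 * a2 \<le> G / \<tau> ^ 2 * (- Q2 (N * \<tau>))"
      using GT(1)[of 2] q2 GT0[of 2] a by (intro mult_mono) (auto simp: numeral_3_eq_3 numeral_2_eq_2)
    then show "c \<le> - (\<phi> (N * \<tau>) / \<phi> N / \<tau> ^ 2 * Q2 (N * \<tau>))" by (simp add: c_def G_def)
    have "G / \<tau> ^ 2 * (- Q2 (N * \<tau>)) \<le> L ^ 3 * b2"
      using GT(2)[of 2] q2 GT0[of 2] a Lp by (intro mult_mono) (auto simp: numeral_3_eq_3 numeral_2_eq_2)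
    then show "- (\<phi> (N * \<tau>) / \<phi> N / \<tau> ^ 2 * Q2 (N * \<tau>)) \<le> C" by (simp add: C_def G_def mult.commute)
    have "G / \<tau> ^ 3 * \<bar>Q3 (N * \<tau>)\<bar> \<le> L ^ 4 * b3"
      using GT(2)[of 3] q3 GT0[of 3] Lp by (intro mult_mono) (auto simp: eval_nat_numeral)
    moreover have "\<bar>\<phi> (N * \<tau>) / \<phi> N / \<tau> ^ 3 * Q3 (N * \<tau>)\<bar> = G / \<tau> ^ 3 * \<bar>Q3 (N * \<tau>)\<bar>"
      unfolding G_def[symmetric] abs_mult using G0 \<tau>p by simp
    ultimately show "\<bar>\<phi> (N * \<tau>) / \<phi> N / \<tau> ^ 3 * Q3 (N * \<tau>)\<bar> \<le> C" by (simp add: C_def mult.commute)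
    have "(1 / L ^ 3) * (1 / L ^ 3) * a4 \<le> (G / \<tau> ^ 2) * (G / \<tau> ^ 2) * (Q3 (N * \<tau>) * Q1 (N * \<tau>) - (Q2 (N * \<tau>))\<^sup>2)"
      using GT(1)[of 2] q4 GT0[of 2] a Lp by (intro mult_mono mult_nonneg_nonneg) (auto simp: numeral_3_eq_3 numeral_2_eq_2)
    also have "\<dots> = G / \<tau> ^ 3 * Q3 (N * \<tau>) * (G / \<tau> * Q1 (N * \<tau>)) - (G / \<tau> ^ 2 * Q2 (N * \<tau>))\<^sup>2"
      using \<tau>p by (simp add: field_simps eval_nat_numeral)
    finally show "c \<le> \<phi> (N * \<tau>) / \<phi> N / \<tau> ^ 3 * Q3 (N * \<tau>) * (\<phi> (N * \<tau>) / \<phi> N / \<tau> * Q1 (N * \<tau>)) - (\<phi> (N * \<tau>) / \<phi> N / \<tau> ^ 2 * Q2 (N * \<tau>))\<^sup>2"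
      unfolding G_def[symmetric] by (simp add: c_def flip: power_add)
  }
  have in1: "1 / L \<in> {1/L..L}" and in2: "L \<in> {1/L..L}" using Lp by (auto simp: field_simps intro: order.trans[of 1 "L * 1"] mult_mono)
  have LL: "L powr (1 - b) = L / L powr b" using Lp by (simp add: powr_diff)
  have Lb: "L powr b > 0" using Lp by simp
  \<comment> \<open>With L^(1 - b) >= 10 the slope is at least 10 * 29 / 30 >= 8 at the left end,
    and at most 1 / 10 at the right end.\<close>
  show "8 \<le> \<phi> (N * (1 / L)) / \<phi> N / (1 / L) * Q1 (N * (1 / L))"
  proof -
    note R = relative_growth[OF N in1]
    have "1 / L powr b \<le> \<phi> (N * (1 / L)) / \<phi> N" using R(4) Lp by (simp add: powr_divide)
    moreover have "0 \<le> \<phi> (N * (1 / L)) / \<phi> N" using order.trans[OF _ R(2), of 0] Lp by simp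
    ultimately have "1 / L powr b * L * (29 / 30) \<le> \<phi> (N * (1 / L)) / \<phi> N * L * Q1 (N * (1 / L))"
      using Q1(1)[OF R(1)] Lp Lb by (intro mult_mono mult_nonneg_nonneg) auto
    moreover have "1 / L powr b * L \<ge> 10" using L(2) LL by simp
    ultimately show ?thesis by simp
  qed
  show "\<phi> (N * L) / \<phi> N / L * Q1 (N * L) \<le> 1 / 10"
  proof -
    note R = relative_growth[OF N in2]
    have "\<phi> (N * L) / \<phi> N / L * Q1 (N * L) \<le> L powr b / L * 1"
    proof (intro mult_mono divide_right_mono)
      show "\<phi> (N * L) / \<phi> N \<le> L powr b" using R(7) Lp by simp
      show "Q1 (N * L) \<le> 1" "0 \<le> Q1 (N * L)" using Q1[OF R(1)] b by linarith+
    qed (use Lp in auto)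
    also have "\<dots> = 1 / L powr (1 - b)" unfolding LL using Lp by simp
    also have "\<dots> \<le> 1 / 10" using L(2) by (intro divide_left_mono) auto
    finally show ?thesis .
  qed
qed

section \<open>The kernels at a single scale\<close>

definition g :: "real \<Rightarrow> real \<Rightarrow> real" where "g N \<tau> = \<phi> (N * \<tau>) / \<phi> N"
definition g1 :: "real \<Rightarrow> real \<Rightarrow> real" where "g1 N \<tau> = \<phi> (N * \<tau>) / \<phi> N / \<tau> * Q1 (N * \<tau>)"
definition g2 :: "real \<Rightarrow> real \<Rightarrow> real" where "g2 N \<tau> = \<phi> (N * \<tau>) / \<phi> N / \<tau> ^ 2 * Q2 (N * \<tau>)"
definition g3 :: "real \<Rightarrow> real \<Rightarrow> real" where "g3 N \<tau> = \<phi> (N * \<tau>) / \<phi> N / \<tau> ^ 3 * Q3 (N * \<tau>)"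

lemma profile_g: "y0 * L \<le> N \<Longrightarrow> profile L c C (g N) (g1 N) (g2 N) (g3 N)"
  using profile[of N] unfolding g_def[abs_def] g1_def[abs_def] g2_def[abs_def] g3_def[abs_def] .

definition ratio :: "real \<Rightarrow> real" where "ratio N = N / \<phi> N"

text \<open>The divisor 32 is dictated by \<open>Ak_Tk_ge\<close>: there \<phi> is within 4 / r of
  an integer, r being the ratio, and \<open>fejer_ge\<close> needs (4 / r) * 8 K <= 1.\<close>

definition order :: "real \<Rightarrow> nat" where "order N = nat \<lfloor>ratio N / 32\<rfloor>"

text \<open>The lower bound 64 makes the Fejer order positive and at least ratio / 64; the bound of
  the ratio by \<phi> keeps the order below \<phi>(N), as \<open>integral_w_fejer\<close>
  requires.\<close>

definition admissible :: "real \<Rightarrow> bool" where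
  "admissible N \<longleftrightarrow> y0 * L \<le> N \<and> 64 \<le> ratio N \<and> ratio N \<le> \<phi> N \<and> 1 \<le> \<phi> N"

text \<open>Freezing the argument outside \<open>{1/L..L}\<close> extends the kernels continuously
  by 0 to the line, because the weight vanishes at both ends.\<close>

definition clamp :: "real \<Rightarrow> real" where "clamp \<tau> = max (1 / L) (min L \<tau>)"

definition Tk :: "real \<Rightarrow> real \<Rightarrow> real" where
  "Tk N t = profile.V (g N) (g1 N) (g2 N) (\<phi> N) (order N) (clamp (t / N)) / N"

definition Ak :: "real \<Rightarrow> real \<Rightarrow> real" where
  "Ak N t = profile.w (g1 N) (g2 N) (clamp (t / N)) / N"

lemma clamp: "clamp \<tau> \<in> {1/L..L}" "\<tau> \<in> {1/L..L} \<Longrightarrow> clamp \<tau> = \<tau>" "\<tau> \<le> 1/L \<Longrightarrow> clamp \<tau> = 1/L" "L \<le> \<tau> \<Longrightarrow> clamp \<tau> = L"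
proof -
  have "1 / L \<le> 1" using L by simp
  then have "1 / L \<le> L" using L by linarith
  then show "clamp \<tau> \<in> {1/L..L}" "\<tau> \<in> {1/L..L} \<Longrightarrow> clamp \<tau> = \<tau>" "\<tau> \<le> 1/L \<Longrightarrow> clamp \<tau> = 1/L" "L \<le> \<tau> \<Longrightarrow> clamp \<tau> = L"
    by (auto simp: clamp_def)
qed

definition B2 :: real where "B2 = 2 * profile.W c C * profile.B_fej L c C + (profile.W c C)\<^sup>2 * L"
definition B4 :: real where "B4 = 4 * (profile.B_off L c C + profile.B_near L c C + profile.B_diag L c C)"
definition C3 :: real where "C3 = B2 * (1 + 512 / c\<^sup>2 + 1 + 1 / (4 * C\<^sup>2)) + B4 * (2 + 4 * C\<^sup>2)"

end

locale regular_scale = regular + fixes N :: real assumes adm: "admissible N"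
begin

sublocale P: profile L c C "g N" "g1 N" "g2 N" "g3 N"
  using adm by (intro profile_g) (simp add: admissible_def)

abbreviation "M \<equiv> \<phi> N"
abbreviation "r \<equiv> ratio N"
abbreviation "K \<equiv> order N"

lemma scale: "y0 * L \<le> N" "64 \<le> r" "r \<le> M" "1 \<le> M" "N > 0" "N = M * r" "y0 \<le> N"
proof -
  show 1: "y0 * L \<le> N" "64 \<le> r" "r \<le> M" "1 \<le> M" using adm by (auto simp: admissible_def)
  have "y0 * 1 \<le> y0 * L" using L y0 by (intro mult_left_mono) auto
  then show "y0 \<le> N" using 1 by linarith
  then show "N > 0" using y0 by linarith
  show "N = M * r" using 1 by (simp add: ratio_def)
qed

lemma K: "1 \<le> K" "real K \<le> r / 32" "r / 64 \<le> real K" "real K \<le> M" "real K \<le> r"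
proof -
  have "real K = of_int \<lfloor>r / 32\<rfloor>" unfolding order_def using scale(2) by (subst of_nat_nat) auto
  then have "real K \<le> r / 32" "r / 32 < real K + 1" by linarith+
  then show "real K \<le> r / 32" "r / 64 \<le> real K" "real K \<le> M" "real K \<le> r" "1 \<le> K" using scale by linarith+
qed

lemma B_nonneg: "B2 \<ge> 0" "B4 \<ge> 0"
proof -
  show "B2 \<ge> 0" unfolding B2_def P.B_fej_def using P.W P.L P.C P.c
    by (intro add_nonneg_nonneg mult_nonneg_nonneg divide_nonneg_nonneg) auto
  have "P.B_near \<ge> 0" "P.B_diag \<ge> 0"
    unfolding P.B_near_def P.B_diag_def using P.C P.L P.c by (auto intro!: add_nonneg_nonneg mult_nonneg_nonneg)
  then show "B4 \<ge> 0" unfolding B4_def using P.B_nonneg by simp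
qed

text \<open>M times the rescaled shift equals x / r, the shift in units of the gap. The cases are
  coinciding points, shifts below the gap, where the decay of the Fejer kernel gains 1 / K, and
  longer shifts, where the frequency expansion is used.\<close>

lemma correlation_le:
  fixes x :: nat
  assumes x: "real x / N \<le> L - 1 / L"
  shows "\<bar>P.corr M K (real x / N)\<bar> \<le> C3 * (r / (1 + (real x)\<^sup>2) + r\<^sup>2 / (r\<^sup>2 + (real x)\<^sup>2) + r ^ 5 * M powr (- 1 / 4))"
    (is "_ \<le> C3 * (?a + ?b + ?e)")
proof -
  have r0: "r > 0" and e0: "?e \<ge> 0" using scale by auto
  have ab0: "?a \<ge> 0" "?b \<ge> 0" using r0 by auto
  have C3: "B2 * (1 + 512 / c\<^sup>2 + 1 + 1 / (4 * C\<^sup>2)) \<le> C3" "B4 * (2 + 4 * C\<^sup>2) \<le> C3"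
    unfolding C3_def using B_nonneg by (auto intro!: mult_nonneg_nonneg add_nonneg_nonneg)
  have y: "M * (real x / N) = real x / r" using scale(5,6) r0 by (simp add: field_simps)
  consider "x = 0" | "x > 0" "C * (real x / r) \<le> 1 / 2" | "x > 0" "1 / 2 < C * (real x / r)" by linarith
  then show ?thesis
  proof cases
    case 1
    have "\<bar>P.corr M K 0\<bar> \<le> B2 * (1 + real K)"
      unfolding B2_def using P.corr_trivial[OF _ _ K(1,4), of 0] P.inv_L by simp
    also have "\<dots> \<le> B2 * (1 + r)" using K B_nonneg by (intro mult_left_mono) auto
    also have "\<dots> = B2 * (?a + ?b)" using 1 r0 by (simp add: add.commute)
    also have "\<dots> \<le> C3 * (?a + ?b + ?e)"
    proof (rule mult_mono)
      have "B2 * 1 \<le> B2 * (1 + 512 / c\<^sup>2 + 1 + 1 / (4 * C\<^sup>2))" using B_nonneg by (intro mult_left_mono) auto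
      then show "B2 \<le> C3" "0 \<le> C3" using C3 B_nonneg by linarith+
    qed (use ab0 e0 in auto)
    finally show ?thesis using 1 by simp
  next
    case 2
    have x1: "1 \<le> (real x)\<^sup>2" "real x > 0" using 2 by (auto simp: Suc_le_eq)
    have "\<bar>P.corr M K (real x / N)\<bar> \<le> B2 * (1 + 4 / (real K * (c * (real x / r))\<^sup>2))"
      unfolding B2_def using P.corr_near[of "real x / N" K M] x 2 scale K unfolding y by simp
    also have "\<dots> \<le> B2 * ((1 + 1 / (4 * C\<^sup>2)) * ?b + 512 / c\<^sup>2 * ?a)"
    proof (rule mult_left_mono[OF add_mono B_nonneg(1)])
      \<comment> \<open>Below the gap \<open>?b\<close> is bounded from below, so it absorbs the
        constant 1.\<close>
      have "C * real x \<le> r / 2" using 2 r0 by (simp add: field_simps)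
      then have "(C * real x)\<^sup>2 \<le> (r / 2)\<^sup>2" using P.C by (intro power_mono) auto
      then have "r\<^sup>2 + (real x)\<^sup>2 \<le> (1 + 1 / (4 * C\<^sup>2)) * r\<^sup>2" using P.C by (simp add: field_simps power_mult_distrib)
      then show "1 \<le> (1 + 1 / (4 * C\<^sup>2)) * ?b" using r0 by (simp add: pos_le_divide_eq add_pos_nonneg)
      have "4 / (real K * (c * (real x / r))\<^sup>2) \<le> 4 / (r / 64 * (c * (real x / r))\<^sup>2)"
        using K r0 x1 P.c by (intro divide_left_mono mult_right_mono mult_pos_pos) auto
      also have "\<dots> = 256 * r / (c\<^sup>2 * (real x)\<^sup>2)" using r0 x1 P.c by (simp add: field_simps power2_eq_square)
      also have "\<dots> \<le> 256 * r / (c\<^sup>2 * ((1 + (real x)\<^sup>2) / 2))"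
        using r0 x1 P.c by (intro divide_left_mono mult_left_mono mult_pos_pos) (auto simp: add_pos_nonneg)
      also have "\<dots> = 512 / c\<^sup>2 * ?a" using P.c by (simp add: field_simps)
      finally show "4 / (real K * (c * (real x / r))\<^sup>2) \<le> 512 / c\<^sup>2 * ?a" .
    qed
    also have "\<dots> \<le> B2 * ((1 + 512 / c\<^sup>2 + 1 + 1 / (4 * C\<^sup>2)) * (?a + ?b + ?e))"
    proof (rule mult_left_mono[OF _ B_nonneg(1)])
      have "(1 + 1 / (4 * C\<^sup>2)) * ?b \<le> (1 + 512 / c\<^sup>2 + 1 + 1 / (4 * C\<^sup>2)) * ?b"
        "512 / c\<^sup>2 * ?a \<le> (1 + 512 / c\<^sup>2 + 1 + 1 / (4 * C\<^sup>2)) * ?a"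
        "0 \<le> (1 + 512 / c\<^sup>2 + 1 + 1 / (4 * C\<^sup>2)) * ?e"
        using ab0 e0 r0 by (intro mult_right_mono mult_nonneg_nonneg add_nonneg_nonneg; simp)+
      then show "(1 + 1 / (4 * C\<^sup>2)) * ?b + 512 / c\<^sup>2 * ?a \<le> (1 + 512 / c\<^sup>2 + 1 + 1 / (4 * C\<^sup>2)) * (?a + ?b + ?e)"
        unfolding distrib_left by linarith
    qed
    also have "\<dots> = B2 * (1 + 512 / c\<^sup>2 + 1 + 1 / (4 * C\<^sup>2)) * (?a + ?b + ?e)" by (simp only: mult.assoc)
    also have "\<dots> \<le> C3 * (?a + ?b + ?e)" using C3 ab0 e0 by (intro mult_right_mono) auto
    finally show ?thesis .
  next
    case 3
    define \<delta> where "\<delta> = M powr (- 1 / 4)"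
    have \<delta>: "0 < \<delta>" "\<delta> \<le> 1" using scale(4) powr_mono[of "- 1 / 4" 0 M] by (auto simp: \<delta>_def)
    have "\<delta> ^ 4 = M powr (- 1 / 4 * 4)" unfolding \<delta>_def using scale(4) by (simp add: powr_powr flip: powr_realpow)
    then have M\<delta>: "M * \<delta> ^ 4 = 1" using scale(4) by (simp add: powr_minus)
    have x0: "real x > 0" using 3 by simp
    have "\<bar>P.corr M K (real x / N)\<bar> \<le> B4 * (1 / (real x / r)\<^sup>2 + real K ^ 5 * \<delta>)"
      unfolding B4_def using P.corr_far[OF _ x \<delta> M\<delta> K(1)] x0 scale unfolding y by simp
    also have "\<dots> \<le> B4 * ((1 + 4 * C\<^sup>2) * ?b + ?e)"
    proof (rule mult_left_mono[OF add_mono B_nonneg(2)])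
      \<comment> \<open>Beyond the gap r^2 / x^2 and \<open>?b\<close> are comparable.\<close>
      have "r \<le> 2 * C * real x" using 3 r0 by (simp add: field_simps)
      then have "r\<^sup>2 \<le> (2 * C * real x)\<^sup>2" using r0 by (intro power_mono) auto
      then have le: "r\<^sup>2 + (real x)\<^sup>2 \<le> (1 + 4 * C\<^sup>2) * (real x)\<^sup>2" by (simp add: power_mult_distrib algebra_simps)
      have "1 / (real x / r)\<^sup>2 = (1 + 4 * C\<^sup>2) * (r\<^sup>2 / ((1 + 4 * C\<^sup>2) * (real x)\<^sup>2))"
        using x0 r0 by (simp add: power_divide add_pos_nonneg less_imp_neq[symmetric])
      also have "\<dots> \<le> (1 + 4 * C\<^sup>2) * ?b"
        using le r0 x0 by (intro mult_left_mono divide_left_mono mult_pos_pos) (auto intro!: add_pos_nonneg)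
      finally show "1 / (real x / r)\<^sup>2 \<le> (1 + 4 * C\<^sup>2) * ?b" .
      show "real K ^ 5 * \<delta> \<le> ?e" unfolding \<delta>_def using K by (intro mult_right_mono power_mono) auto
    qed
    also have "\<dots> \<le> B4 * ((2 + 4 * C\<^sup>2) * (?a + ?b + ?e))"
    proof (rule mult_left_mono[OF _ B_nonneg(2)])
      have "(1 + 4 * C\<^sup>2) * ?b \<le> (2 + 4 * C\<^sup>2) * ?b" "1 * ?e \<le> (2 + 4 * C\<^sup>2) * ?e" "0 \<le> (2 + 4 * C\<^sup>2) * ?a"
        using ab0 e0 r0 by (intro mult_right_mono mult_nonneg_nonneg; simp)+
      then show "(1 + 4 * C\<^sup>2) * ?b + ?e \<le> (2 + 4 * C\<^sup>2) * (?a + ?b + ?e)"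
        unfolding distrib_left by linarith
    qed
    also have "\<dots> = B4 * (2 + 4 * C\<^sup>2) * (?a + ?b + ?e)" by (simp only: mult.assoc)
    also have "\<dots> \<le> C3 * (?a + ?b + ?e)" using C3 ab0 e0 by (intro mult_right_mono) auto
    finally show ?thesis .
  qed
qed

end

context regular_scale
begin

lemma Tk_outside: "t / N \<le> 1 / L \<or> L \<le> t / N \<Longrightarrow> Tk N t = 0" "t / N \<le> 1 / L \<or> L \<le> t / N \<Longrightarrow> Ak N t = 0"
  using clamp(3,4)[of "t / N"] P.w_ends unfolding Tk_def Ak_def P.V_def by auto

lemma continuous_clamp: "continuous_on B clamp"
  unfolding clamp_def by (intro continuous_intros)

lemma continuous_Tk: "continuous_on UNIV (Tk N)"
  unfolding Tk_def divide_inverse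
  by (intro continuous_intros continuous_on_compose2[OF P.continuous_V] continuous_on_compose2[OF continuous_clamp[of UNIV]])
     (use clamp(1) in auto)

lemma Ak_bounds: "0 \<le> Ak N t" "Ak N t \<le> P.W / N"
  unfolding Ak_def using P.w_nonneg[OF clamp(1)] P.abs_w_le[OF clamp(1), of "t / N"] scale(5)
  by (auto intro: divide_right_mono)

lemma Ak_Tk: "Ak N t + Tk N t = P.w (clamp (t / N)) * fejer K (M * g N (clamp (t / N))) / N"
  unfolding Ak_def Tk_def P.V_def by (simp add: algebra_simps add_divide_distrib diff_divide_distrib)

lemma Ak_Tk_nonneg: "0 \<le> Ak N t + Tk N t"
  unfolding Ak_Tk using P.w_nonneg[OF clamp(1)] fejer_nonneg scale(5) by simp

lemma mid_range: assumes "\<tau> \<in> {1/2..4}" shows "\<tau> \<in> {1/L..L}"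
proof -
  have "1 / L \<le> 1 / 8" using L by (intro divide_left_mono) auto
  moreover have "1 / 2 \<le> \<tau>" "\<tau> \<le> 4" using assms by auto
  ultimately have "1 / L \<le> \<tau>" "\<tau> \<le> L" using L by linarith+
  then show ?thesis by simp
qed

text \<open>Monotonicity and sublinearity of \<phi> put \<phi>(N \<tau>) / (\<phi>(N) \<tau>) into
  [1/4, 2], so the slope falls into the interval where \<open>bump_ge\<close> applies.\<close>

lemma g1_mid:
  assumes "\<tau> \<in> {1/2..4}" shows "1 / 5 \<le> g1 N \<tau>" "g1 N \<tau> \<le> 4"
proof -
  have \<tau>: "\<tau> \<in> {1/L..L}" using assms by (rule mid_range)
  note R = relative_growth[OF scale(1) \<tau>]
  define G where "G = \<phi> (N * \<tau>) / \<phi> N"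
  have \<tau>p: "\<tau> > 0" using assms by auto
  have GT: "1 / 4 \<le> G / \<tau> \<and> G / \<tau> \<le> 2"
  proof (cases "\<tau> \<le> 1")
    case True
    have "\<tau> powr 1 \<le> \<tau> powr b" using True \<tau>p b by (intro powr_mono') auto
    then have "\<tau> \<le> G" "G \<le> 1" using R(4,5)[OF True] \<tau>p by (auto simp: G_def)
    moreover have "1 \<le> 2 * \<tau>" using assms by auto
    ultimately show ?thesis using \<tau>p by (simp add: field_simps)
  next
    case False
    have "\<tau> powr b \<le> \<tau> powr 1" using False b by (intro powr_mono) auto
    then have "1 \<le> G" "G \<le> \<tau>" using R(6,7) False \<tau>p by (auto simp: G_def)
    moreover have "\<tau> \<le> 4" using assms by auto
    ultimately show ?thesis using \<tau>p by (simp add: field_simps)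
  qed
  have GT': "1 / 4 \<le> G / \<tau>" "G / \<tau> \<le> 2" "0 \<le> G / \<tau>" using GT by linarith+
  have q: "29 / 30 \<le> Q1 (N * \<tau>)" "Q1 (N * \<tau>) \<le> 1" "0 \<le> Q1 (N * \<tau>)" using Q1[OF R(1)] b by linarith+
  have "1 / 4 * (29 / 30) \<le> G / \<tau> * Q1 (N * \<tau>)" by (rule mult_mono[OF GT'(1) q(1) GT'(3)]) simp
  moreover have "G / \<tau> * Q1 (N * \<tau>) \<le> 2 * 1" by (rule mult_mono[OF GT'(2) q(2) _ q(3)]) simp
  moreover have "g1 N \<tau> = G / \<tau> * Q1 (N * \<tau>)" by (simp add: g1_def G_def)
  ultimately show "1 / 5 \<le> g1 N \<tau>" "g1 N \<tau> \<le> 4" by linarith+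
qed

text \<open>The slope of \<open>g\<close> is at most 4, so \<open>M * g\<close> moves by at most 4 /
  r between \<open>u\<close>, where it is an integer, and \<open>t\<close>; the Fejer kernel at
  \<open>t\<close> is then at least K / 4 >= r / 256. The weight is at least 16 / 100 * sqrt c and r
  / N = 1 / M, whence 1 / 1600.\<close>

lemma Ak_Tk_ge:
  fixes m :: nat
  assumes t: "N / 2 \<le> t" "t \<le> 4 * N" and u: "N / 2 \<le> u" "u \<le> 4 * N" and ut: "\<bar>t - u\<bar> \<le> 1" and m: "\<phi> u = real m"
  shows "sqrt c / 1600 / M \<le> Ak N t + Tk N t"
proof -
  have mid: "t / N \<in> {1/2..4}" "u / N \<in> {1/2..4}" using t u scale(5) by (auto simp: field_simps)
  note in' = mid_range
  have *: "\<bar>g N t' - g N s\<bar> \<le> 4 * (t' - s)" if st: "1/2 \<le> s" "s \<le> t'" "t' \<le> 4" for s t'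
  proof -
    obtain x where x: "x \<in> {s..t'}" "g N t' - g N s = g1 N x * (t' - s)"
      using P.mean_value_profile[OF P.g, of s t'] st in'[of s] in'[of t'] by auto
    then have "\<bar>g1 N x\<bar> \<le> 4" using g1_mid[of x] that by auto
    then have "\<bar>g1 N x\<bar> * (t' - s) \<le> 4 * (t' - s)" using st by (intro mult_right_mono) auto
    then show ?thesis unfolding x(2) abs_mult using st by simp
  qed
  have "\<bar>g N (t / N) - g N (u / N)\<bar> \<le> 4 * \<bar>t / N - u / N\<bar>"
  proof -
    have mid': "1 / 2 \<le> t / N" "t / N \<le> 4" "1 / 2 \<le> u / N" "u / N \<le> 4" using mid by auto
    show ?thesis
    proof (cases "t / N \<le> u / N")
      case True
      have "\<bar>X - Y\<bar> \<le> 4 * \<bar>a - b\<bar>" if "a \<le> b" "\<bar>Y - X\<bar> \<le> 4 * (b - a)" for X Y a b :: real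
        using that by (auto simp: abs_if split: if_splits)
      from this[OF True *[OF mid'(1) True mid'(4)]] show ?thesis .
    next
      case False
      then have le: "u / N \<le> t / N" by simp
      have "\<bar>X - Y\<bar> \<le> 4 * \<bar>a - b\<bar>" if "b \<le> a" "\<bar>X - Y\<bar> \<le> 4 * (a - b)" for X Y a b :: real
        using that by (auto simp: abs_if split: if_splits)
      from this[OF le *[OF mid'(3) le mid'(2)]] show ?thesis .
    qed
  qed
  also have "\<dots> = 4 * \<bar>t - u\<bar> / N" using scale(5) by (simp add: abs_divide flip: diff_divide_distrib)
  also have "\<dots> \<le> 4 / N" using ut scale(5) by (intro divide_right_mono) auto
  finally have "M * \<bar>g N (t / N) - g N (u / N)\<bar> \<le> M * (4 / N)" using scale(4) by (intro mult_left_mono) auto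
  moreover have "M * g N (u / N) = real m" "M * (4 / N) = 4 / r"
    using scale(2,4,5) m by (auto simp: g_def ratio_def)
  moreover have "M * \<bar>g N (t / N) - g N (u / N)\<bar> = \<bar>M * g N (t / N) - M * g N (u / N)\<bar>"
    using scale(4) by (simp add: abs_mult flip: right_diff_distrib)
  ultimately have d: "\<bar>M * g N (t / N) - real m\<bar> \<le> 4 / r" by simp
  have "\<bar>M * g N (t / N) - real m\<bar> * (8 * real K) \<le> 4 / r * (8 * (r / 32))"
    using d K scale(2) by (intro mult_mono) auto
  also have "\<dots> = 1" using scale(2) by simp
  finally have "real K / 4 \<le> fejer K (M * g N (t / N) - real m)" by (rule fejer_ge)
  also have "\<dots> = fejer K (M * g N (t / N))"
    using fejer_add_int[of K "M * g N (t / N)" "- int m"] by simp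
  finally have F: "r / 256 \<le> fejer K (M * g N (t / N))" using K(3) by linarith
  have w: "sqrt c * (16 / 100) \<le> P.w (t / N)"
    unfolding P.w_def using P.g2_ge[OF in'[OF mid(1)]] bump_ge g1_mid[OF mid(1)] P.c by (intro mult_mono) auto
  have "sqrt c * (16 / 100) * (r / 256) \<le> P.w (t / N) * fejer K (M * g N (t / N))"
    using w F P.c scale(2) P.w_nonneg[OF in'[OF mid(1)]] by (intro mult_mono) auto
  then have "sqrt c * (16 / 100) * (r / 256) / N \<le> Ak N t + Tk N t"
    unfolding Ak_Tk clamp(2)[OF in'[OF mid(1)]] using scale(5) by (intro divide_right_mono) auto
  moreover have "sqrt c * (16 / 100) * (r / 256) / N = sqrt c / 1600 / M"
  proof -
    have "r / N = 1 / M" unfolding ratio_def using scale(5) by simp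
    then have "sqrt c / 1600 * (r / N) = sqrt c / 1600 * (1 / M)" by simp
    then show ?thesis by (simp add: mult.commute)
  qed
  ultimately show ?thesis by simp
qed

text \<open>Substituting t = N \<tau> produces the factor N / N^2. For rescaled shifts above L - 1 /
  L the supports are disjoint, which is the second case of \<open>J\<close>.\<close>

lemma Tk_correlation:
  fixes x :: nat
  shows "\<bar>integral {0..L * N} (\<lambda>t. Tk N t * Tk N (t + real x))\<bar>
    \<le> C3 / N * (r / (1 + (real x)\<^sup>2) + r\<^sup>2 / (r\<^sup>2 + (real x)\<^sup>2) + r ^ 5 * M powr (- 1 / 4))"
proof -
  define \<xi> where "\<xi> = real x / N"
  have \<xi>: "\<xi> \<ge> 0" using scale(5) by (simp add: \<xi>_def)
  define H where "H \<tau> = P.V M K (clamp \<tau>) * P.V M K (clamp (\<tau> + \<xi>))" for \<tau>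
  have V0: "P.V M K (clamp \<tau>) = 0" if "\<tau> \<le> 1 / L \<or> L \<le> \<tau>" for \<tau>
    using that clamp(3,4)[of \<tau>] P.w_ends by (auto simp: P.V_def)
  have TH: "Tk N t * Tk N (t + real x) = H (1 / N * t) / N\<^sup>2" for t
    unfolding Tk_def H_def \<xi>_def by (simp add: power2_eq_square add_divide_distrib)
  define J where "J = (if \<xi> \<le> L - 1 / L then P.corr M K \<xi> else 0)"
  have "(H has_integral J) {0..L}"
  proof (cases "\<xi> \<le> L - 1 / L")
    case True
    have "(H has_integral P.corr M K \<xi>) {1/L..L-\<xi>}"
    proof (rule has_integral_eq)
      show "((\<lambda>t. P.V M K t * P.V M K (t + \<xi>)) has_integral P.corr M K \<xi>) {1/L..L-\<xi>}"
        unfolding P.corr_def using P.continuous_on_shift[OF P.continuous_V \<xi>]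
        by (intro integrable_integral integrable_continuous_real continuous_intros) auto
      show "P.V M K t * P.V M K (t + \<xi>) = H t" if "t \<in> {1/L..L-\<xi>}" for t
        using that \<xi> clamp(2)[of t] clamp(2)[of "t + \<xi>"] by (simp add: H_def)
    qed
    moreover have "H t = 0" if "t \<notin> {1/L..L-\<xi>}" for t
      using that V0[of t] V0[of "t + \<xi>"] by (auto simp: H_def not_le)
    moreover have "{1/L..L-\<xi>} \<subseteq> {0..L}" using \<xi> L by auto
    ultimately show ?thesis using True has_integral_on_superset[of H _ "{1/L..L-\<xi>}" "{0..L}"] by (simp add: J_def)
  next
    case False
    have "H t = 0" for t
      using V0[of t] V0[of "t + \<xi>"] False by (cases "t \<le> 1 / L") (auto simp: H_def)
    then have "H = (\<lambda>_. 0)" by auto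
    then show ?thesis using False by (simp add: J_def)
  qed
  then have "((\<lambda>t. H (1 / N * t)) has_integral (1 / \<bar>1 / N\<bar>) *\<^sub>R J) ((\<lambda>t. t / (1 / N)) ` {0..L})"
    by (rule has_integral_stretch_real) (use scale(5) in auto)
  moreover have "(\<lambda>t. t / (1 / N)) ` {0..L} = {0..L * N}"
    using scale(5) image_mult_atLeastAtMost[of N 0 L] by (simp add: mult.commute)
  ultimately have "((\<lambda>t. H (1 / N * t)) has_integral N * J) {0..L * N}" using scale(5) by simp
  then have "((\<lambda>t. H (1 / N * t) / N\<^sup>2) has_integral N * J / N\<^sup>2) {0..L * N}" by (rule has_integral_divide)
  then have "integral {0..L * N} (\<lambda>t. H (1 / N * t) / N\<^sup>2) = N * J / N\<^sup>2" by (rule integral_unique)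
  then have "integral {0..L * N} (\<lambda>t. Tk N t * Tk N (t + real x)) = N * J / N\<^sup>2" by (simp only: TH)
  moreover have "N * J / N\<^sup>2 = J / N" using scale(5) by (simp add: power2_eq_square)
  ultimately have "integral {0..L * N} (\<lambda>t. Tk N t * Tk N (t + real x)) = J / N" by simp
  then have "\<bar>integral {0..L * N} (\<lambda>t. Tk N t * Tk N (t + real x))\<bar> = \<bar>J\<bar> / N" using scale(5) by simp
  also have "\<dots> \<le> C3 * (r / (1 + (real x)\<^sup>2) + r\<^sup>2 / (r\<^sup>2 + (real x)\<^sup>2) + r ^ 5 * M powr (- 1 / 4)) / N"
  proof (rule divide_right_mono)
    have "C3 \<ge> 0" unfolding C3_def using B_nonneg by (intro add_nonneg_nonneg mult_nonneg_nonneg) auto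
    then have "0 \<le> C3 * (r / (1 + (real x)\<^sup>2) + r\<^sup>2 / (r\<^sup>2 + (real x)\<^sup>2) + r ^ 5 * M powr (- 1 / 4))"
      using scale(2) by (intro mult_nonneg_nonneg add_nonneg_nonneg) auto
    then show "\<bar>J\<bar> \<le> C3 * (r / (1 + (real x)\<^sup>2) + r\<^sup>2 / (r\<^sup>2 + (real x)\<^sup>2) + r ^ 5 * M powr (- 1 / 4))"
      using correlation_le[of x] by (simp add: J_def \<xi>_def)
  qed (use scale(5) in simp)
  finally show ?thesis by simp
qed

end

lemma exists_power_ge:
  fixes X k e :: real
  assumes "k > 0" "e > 0"
  shows "\<exists>n0. \<forall>n\<ge>n0. X \<le> k * (2 ^ n) powr e"
proof -
  have q: "2 powr e > (1::real)" using assms by simp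
  obtain n0 where n0: "X / k < (2 powr e) ^ n0" using real_arch_pow[OF q] by blast
  have "X \<le> k * (2 ^ n) powr e" if "n \<ge> n0" for n
  proof -
    have "(2 ^ n :: real) powr e = (2 powr e) ^ n" by (simp add: powr_powr mult.commute flip: powr_realpow)
    moreover have "(2 powr e) ^ n0 \<le> (2 powr e :: real) ^ n" using that q by (intro power_increasing) auto
    ultimately have "X / k \<le> (2 ^ n) powr e" using n0 by linarith
    then show ?thesis using assms by (simp add: field_simps)
  qed
  then show ?thesis by blast
qed

context regular
begin

section \<open>Large scales and the summable error\<close>

definition \<kappa>0 :: real where "\<kappa>0 = \<phi> y0 / y0 powr (29 / 30)"

lemma \<kappa>0: "\<kappa>0 > 0" using \<phi>_pos[of y0] y0 by (simp add: \<kappa>0_def)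

lemma \<phi>_ge: assumes "t \<ge> y0" shows "\<kappa>0 * t powr (29 / 30) \<le> \<phi> t"
proof -
  have "(t / y0) powr (29 / 30) = t powr (29 / 30) / y0 powr (29 / 30)"
    by (rule powr_divide)
  then show ?thesis using growth(1)[of y0 t] assms by (simp add: \<kappa>0_def)
qed

lemma \<phi>_le: assumes "t \<ge> y0" shows "\<phi> t \<le> \<phi> y0 / y0 powr b * t powr b"
proof -
  have "(t / y0) powr b = t powr b / y0 powr b"
    by (rule powr_divide)
  then show ?thesis using growth(2)[of y0 t] assms by simp
qed

text \<open>The ratio tends to infinity because \<phi>(N) is at most a multiple of N^b with b < 1.
  That it is at most \<phi>(N) means N <= \<phi>(N)^2, and the exponent 2 * 29 / 30 exceeds 1 by 14
  / 15.\<close>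

lemma eventually_admissible: "\<exists>n0. \<forall>n\<ge>n0. admissible (2 ^ n)"
proof -
  define k where "k = \<phi> y0 / y0 powr b"
  have k: "k > 0" using \<phi>_pos[of y0] y0 by (simp add: k_def)
  obtain n1 where n1: "\<And>n. n \<ge> n1 \<Longrightarrow> y0 * L \<le> 1 * (2 ^ n) powr 1" using exists_power_ge[of 1 1] by auto
  obtain n2 where n2: "\<And>n. n \<ge> n2 \<Longrightarrow> 64 \<le> 1 / k * (2 ^ n) powr (1 - b)" using exists_power_ge[of "1 / k" "1 - b" 64] b k by auto
  obtain n3 where n3: "\<And>n. n \<ge> n3 \<Longrightarrow> 1 \<le> \<kappa>0\<^sup>2 * (2 ^ n) powr (14 / 15)" using exists_power_ge[of "\<kappa>0\<^sup>2" "14 / 15" 1] \<kappa>0 by auto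
  obtain n4 where n4: "\<And>n. n \<ge> n4 \<Longrightarrow> 1 \<le> \<kappa>0 * (2 ^ n) powr (29 / 30)" using exists_power_ge[of "\<kappa>0" "29 / 30" 1] \<kappa>0 by auto
  have "admissible (2 ^ n)" if n: "n \<ge> max (max n1 n2) (max n3 n4)" for n
  proof -
    define N :: real where "N = 2 ^ n"
    have Np: "N > 0" by (simp add: N_def)
    have 1: "y0 * L \<le> N" using n1[of n] n by (simp add: N_def)
    have "y0 * 1 \<le> y0 * L" using L y0 by (intro mult_left_mono) auto
    then have Ny: "y0 \<le> N" using 1 by linarith
    have pos: "\<phi> N > 0" by (rule \<phi>_pos[OF Ny])
    have "64 * (k * N powr b) \<le> N"
    proof -
      have "64 \<le> 1 / k * N powr (1 - b)" using n2[of n] n by (simp add: N_def)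
      then have "64 * (k * N powr b) \<le> 1 / k * N powr (1 - b) * (k * N powr b)" using k by (intro mult_right_mono) auto
      also have "\<dots> = N powr (1 - b) * N powr b" using k by simp
      also have "\<dots> = N" using Np by (simp flip: powr_add)
      finally show ?thesis .
    qed
    then have "64 * \<phi> N \<le> N" using \<phi>_le[OF Ny] by (simp add: k_def)
    then have 2: "64 \<le> ratio N" using pos by (simp add: ratio_def field_simps)
    have ge: "\<kappa>0 * N powr (29 / 30) \<le> \<phi> N" by (rule \<phi>_ge[OF Ny])
    have "N \<le> (\<kappa>0 * N powr (29 / 30)) * (\<kappa>0 * N powr (29 / 30))"
    proof -
      have "N * 1 \<le> N * (\<kappa>0\<^sup>2 * N powr (14 / 15))" using n3[of n] n Np by (intro mult_left_mono) (auto simp: N_def)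
      also have "\<dots> = \<kappa>0\<^sup>2 * (N powr 1 * N powr (14 / 15))" using Np by simp
      also have "N powr 1 * N powr (14 / 15) = N powr (29 / 30) * N powr (29 / 30)" unfolding powr_add[symmetric] by simp
      finally show ?thesis by (simp add: power2_eq_square mult_ac)
    qed
    also have "\<dots> \<le> \<phi> N * \<phi> N" using ge \<kappa>0 pos by (intro mult_mono) auto
    finally have 3: "ratio N \<le> \<phi> N" using pos by (simp add: ratio_def field_simps)
    have 4: "1 \<le> \<phi> N" using n4[of n] n ge by (simp add: N_def)
    show ?thesis using 1 2 3 4 by (simp add: admissible_def N_def)
  qed
  then show ?thesis by blast
qed

definition eps :: "nat \<Rightarrow> real" where "eps n = \<kappa>0 powr (- 21 / 4) * (2 powr (- 3 / 40)) ^ n"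

lemma eps: "eps n \<ge> 0" "summable eps"
proof -
  have "2 powr (- 3 / 40) < (2::real) powr 0" by (intro powr_less_mono) auto
  then show "summable eps" unfolding eps_def[abs_def] by (intro summable_mult summable_geometric) simp
qed (simp add: eps_def)

text \<open>The left side is N^5 M^(-21/4); inserting the lower bound for M gives the exponent 5 -
  (29/30) (21/4) = -3/40, so the error is geometric in n.\<close>

lemma error_le_eps:
  assumes "admissible (2 ^ n)"
  shows "(ratio (2 ^ n)) ^ 5 * \<phi> (2 ^ n) powr (- 1 / 4) \<le> eps n"
proof -
  interpret regular_scale \<phi> Q1 Q2 Q3 y0 b a2 b2 b3 a4 "2 ^ n" by standard (rule assms)
  define N :: real where "N = 2 ^ n"
  define M where "M = \<phi> N"
  have N: "N > 0" and M: "M > 0" using scale by (auto simp: N_def M_def)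
  have "(N / M) ^ 5 * M powr (- 1 / 4) = N ^ 5 * (M powr (- 5) * M powr (- 1 / 4))"
  proof -
    have "M powr (- 5) = 1 / M ^ 5" using M powr_minus[of M 5] by (simp add: divide_inverse)
    then show ?thesis by (simp add: power_divide)
  qed
  also have "M powr (- 5) * M powr (- 1 / 4) = M powr (- 21 / 4)" unfolding powr_add[symmetric] by simp
  also have "N ^ 5 * M powr (- 21 / 4) \<le> N ^ 5 * (\<kappa>0 * N powr (29 / 30)) powr (- 21 / 4)"
  proof (rule mult_left_mono)
    show "M powr (- 21 / 4) \<le> (\<kappa>0 * N powr (29 / 30)) powr (- 21 / 4)"
      unfolding M_def using \<phi>_ge[of N] scale \<kappa>0 N by (intro powr_mono2') (auto simp: N_def)
  qed (use N in simp)
  also have "\<dots> = \<kappa>0 powr (- 21 / 4) * (N powr 5 * N powr (29 / 30 * (- 21 / 4)))"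
  proof -
    have "(\<kappa>0 * N powr (29 / 30)) powr (- 21 / 4) = \<kappa>0 powr (- 21 / 4) * N powr (29 / 30 * (- 21 / 4))"
      unfolding powr_mult powr_powr ..
    moreover have "N ^ 5 = N powr 5" using N by simp
    ultimately show ?thesis by simp
  qed
  also have "N powr 5 * N powr (29 / 30 * (- 21 / 4)) = N powr (- 3 / 40)" unfolding powr_add[symmetric] by simp
  also have "N powr (- 3 / 40) = (2 powr (- 3 / 40)) ^ n"
    unfolding N_def by (simp add: powr_powr mult.commute flip: powr_realpow)
  finally show ?thesis unfolding eps_def ratio_def N_def M_def .
qed

text \<open>A natural number whose real value is \<open>L\<close>, since \<open>kernels\<close>
  measures supports in integer multiples of 2^n.\<close>

definition Q :: nat where "Q = nat \<lceil>10 powr (1 / (1 - b))\<rceil> + 8"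

text \<open>The hypothesis \<open>S_int\<close> will be met with u = h(m): y is the integer part of
  u, and the inverse function sends u to m.\<close>

lemma kernels_instance:
  fixes S :: "nat \<Rightarrow> nat set"
  assumes adm: "\<And>n. n \<ge> n0 \<Longrightarrow> admissible (2 ^ n)"
    and S: "\<And>n y. n \<ge> n0 \<Longrightarrow> y \<in> S n \<Longrightarrow> 2 ^ n / 2 \<le> real y \<and> real y \<le> 2 * 2 ^ n"
    and card_S: "\<And>n. n \<ge> n0 \<Longrightarrow> real (card (S n)) \<le> C1 * \<phi> (2 ^ n)" and C1: "C1 \<ge> 0"
    and S_int: "\<And>n y. n \<ge> n0 \<Longrightarrow> y \<in> S n \<Longrightarrow> \<exists>(m::nat) u. real y \<le> u \<and> u \<le> real y + 1 \<and> \<phi> u = real m"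
  shows "kernels S (\<lambda>n. \<phi> (2 ^ n)) (\<lambda>n. Ak (2 ^ n)) (\<lambda>n. Tk (2 ^ n)) eps n0 Q (2 powr (29 / 30)) (sqrt c / 1600) C1 (profile.W c C) C3"
proof
  have LQ: "real Q = L" by (simp add: Q_def L_def)
  show "1 < 2 powr (29 / 30 :: real)" by simp
  show "0 < sqrt c / 1600" using c_pos by simp
  show "0 \<le> C1" by (rule C1)
  show "0 \<le> eps n" "summable eps" for n by (rule eps)+
  interpret base: regular_scale \<phi> Q1 Q2 Q3 y0 b a2 b2 b3 a4 "2 ^ n0" by standard (simp add: adm)
  show "0 \<le> base.P.W" by (rule base.P.W)
  show "0 \<le> C3" unfolding C3_def using base.B_nonneg by (intro add_nonneg_nonneg mult_nonneg_nonneg) auto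
  fix n assume n: "n \<ge> n0"
  interpret regular_scale \<phi> Q1 Q2 Q3 y0 b a2 b2 b3 a4 "2 ^ n" by standard (rule adm[OF n])
  show "S n \<subseteq> {0..2 * 2 ^ n}"
  proof
    fix y assume "y \<in> S n"
    then have "real y \<le> 2 * 2 ^ n" using S[OF n] by blast
    then show "y \<in> {0..2 * 2 ^ n}" by (simp flip: of_nat_le_iff[where 'a=real])
  qed
  show "real (card (S n)) \<le> C1 * \<phi> (2 ^ n)" by (rule card_S[OF n])
  show "0 < \<phi> (2 ^ n)" using scale by simp
  show "\<phi> (2 ^ n) \<le> 2 ^ n" using scale(2,4) by (simp add: ratio_def field_simps)
  show "2 powr (29 / 30) * \<phi> (2 ^ n) \<le> \<phi> (2 ^ Suc n)"
    using growth(1)[of "2 ^ n" "2 ^ Suc n"] scale(7) by (simp add: mult.commute)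
  show "0 \<le> Ak (2 ^ n) t + Tk (2 ^ n) t" for t by (rule Ak_Tk_nonneg)
  show "0 \<le> Ak (2 ^ n) t" "Ak (2 ^ n) t \<le> profile.W c C / 2 ^ n" for t by (rule Ak_bounds)+
  show "continuous_on UNIV (Tk (2 ^ n))" by (rule continuous_Tk)
  have out: "t / 2 ^ n \<le> 1 / L \<or> L \<le> t / 2 ^ n" if t: "t \<notin> {0..real Q * 2 ^ n}" for t
  proof -
    consider "t < 0" | "L * 2 ^ n < t" using t unfolding LQ by fastforce
    then show ?thesis
    proof cases
      case 1
      then have "t / 2 ^ n \<le> 0" by (simp add: divide_nonpos_pos)
      moreover have "0 \<le> 1 / L" using L by simp
      ultimately show ?thesis by linarith
    next
      case 2
      then show ?thesis by (simp add: field_simps)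
    qed
  qed
  show "Ak (2 ^ n) t = 0" "Tk (2 ^ n) t = 0" if "t \<notin> {0..real Q * 2 ^ n}" for t
    using Tk_outside[OF out[OF that]] by auto
  show "sqrt c / 1600 / \<phi> (2 ^ n) \<le> Ak (2 ^ n) (real y + s) + Tk (2 ^ n) (real y + s)"
    if y: "y \<in> S n" and s: "0 \<le> s" "s \<le> 1" for y s
  proof -
    obtain m u where u: "real y \<le> u" "u \<le> real y + 1" "\<phi> u = real m" using S_int[OF n y] by blast
    have yb: "2 ^ n / 2 \<le> real y" "real y \<le> 2 * 2 ^ n" "(1::real) \<le> 2 ^ n" using S[OF n y] by auto
    have "2 ^ n / 2 \<le> real y + s" "real y + s \<le> 4 * 2 ^ n" "2 ^ n / 2 \<le> u" "u \<le> 4 * 2 ^ n" "\<bar>real y + s - u\<bar> \<le> 1"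
      unfolding abs_le_iff using u s yb by linarith+
    then show ?thesis by (rule Ak_Tk_ge[OF _ _ _ _ _ u(3)])
  qed
  show "\<bar>integral {0..real Q * 2 ^ n} (\<lambda>t. Tk (2 ^ n) t * Tk (2 ^ n) (t + real x))\<bar>
    \<le> C3 / 2 ^ n * (2 ^ n / \<phi> (2 ^ n) / (1 + (real x)\<^sup>2) + (2 ^ n / \<phi> (2 ^ n))\<^sup>2 / ((2 ^ n / \<phi> (2 ^ n))\<^sup>2 + (real x)\<^sup>2) + eps n)" for x
  proof -
    have "C3 \<ge> 0" unfolding C3_def using B_nonneg by (intro add_nonneg_nonneg mult_nonneg_nonneg) auto
    then have "C3 / 2 ^ n * (ratio (2 ^ n) / (1 + (real x)\<^sup>2) + (ratio (2 ^ n))\<^sup>2 / ((ratio (2 ^ n))\<^sup>2 + (real x)\<^sup>2) + (ratio (2 ^ n)) ^ 5 * \<phi> (2 ^ n) powr (- 1 / 4))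
      \<le> C3 / 2 ^ n * (ratio (2 ^ n) / (1 + (real x)\<^sup>2) + (ratio (2 ^ n))\<^sup>2 / ((ratio (2 ^ n))\<^sup>2 + (real x)\<^sup>2) + eps n)"
      using error_le_eps[OF adm] by (intro mult_left_mono add_left_mono) auto
    then show ?thesis using Tk_correlation[of x] unfolding LQ ratio_def[symmetric] by linarith
  qed
qed

end

section \<open>The inverse of a function of the class\<close>

text \<open>The strict inequality \<open>x0 < x\<close> turns the derivative within
  \<open>{x0..}\<close> into an ordinary two-sided one.\<close>

lemma deriv_on_DERIV:
  assumes "C_diff_on k {x0..} f" "j < k" "x0 < x"
  shows "(deriv_on {x0..} j f has_real_derivative deriv_on {x0..} (Suc j) f x) (at x)"
proof -
  have "deriv_on {x0..} j f differentiable_on {x0..}" using assms by (auto simp: C_diff_on_def)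
  then have "deriv_on {x0..} j f differentiable (at x within {x0..})" using assms by (auto simp: differentiable_on_def)
  moreover have w: "at x within {x0..} = at x" using assms by (intro at_within_interior) (simp add: interior_real_atLeast)
  ultimately have "deriv_on {x0..} j f differentiable (at x)" by simp
  then have "(deriv_on {x0..} j f has_vector_derivative vector_derivative (deriv_on {x0..} j f) (at x)) (at x)"
    using vector_derivative_works by blast
  moreover have "deriv_on {x0..} (Suc j) f x = vector_derivative (deriv_on {x0..} j f) (at x)"
    by (simp add: deriv_on_def w)
  ultimately show ?thesis by (simp add: has_real_derivative_iff_has_vector_derivative)
qed

lemma deriv_on_0: "deriv_on S 0 f = f" by (simp add: deriv_on_def)

lemma growth_function_DERIV:
  fixes h \<theta> :: "real \<Rightarrow> real"
  assumes x0: "x0 \<ge> 1" and \<theta>: "continuous_on {x0..} \<theta>"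
    and h: "\<And>x. x \<ge> x0 \<Longrightarrow> h x = Ch * x powr c * exp (integral {x0..x} (\<lambda>t. \<theta> t / t))" and x: "x0 < x"
  shows "(h has_real_derivative h x * (c + \<theta> x) / x) (at x)"
proof -
  define I where "I x = integral {x0..x} (\<lambda>t. \<theta> t / t)" for x
  have "continuous_on {x0..x + 1} (\<lambda>t. \<theta> t / t)"
    using x0 by (intro continuous_intros continuous_on_subset[OF \<theta>]) auto
  then have "(I has_real_derivative \<theta> x / x) (at x within {x0..x + 1})"
    unfolding I_def by (rule integral_has_real_derivative) (use x in auto)
  moreover have "at x within {x0..x + 1} = at x" using x by (intro at_within_interior) auto
  ultimately have I: "(I has_real_derivative \<theta> x / x) (at x)" by simp
  have p: "((\<lambda>x. x powr c) has_real_derivative c * x powr (c - 1)) (at x)"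
    using x x0 by (intro has_real_derivative_powr) auto
  have "((\<lambda>x. Ch * x powr c * exp (I x)) has_real_derivative
      (Ch * (c * x powr (c - 1))) * exp (I x) + (exp (I x) * (\<theta> x / x)) * (Ch * x powr c)) (at x)"
    by (intro DERIV_mult DERIV_cmult p DERIV_chain2[OF DERIV_exp I])
  moreover have "(Ch * (c * x powr (c - 1))) * exp (I x) + (exp (I x) * (\<theta> x / x)) * (Ch * x powr c) = h x * (c + \<theta> x) / x"
    using h[of x] x x0 by (simp add: I_def powr_diff field_simps)
  ultimately have "((\<lambda>x. Ch * x powr c * exp (I x)) has_real_derivative h x * (c + \<theta> x) / x) (at x)" by simp
  then show ?thesis
    by (rule has_field_derivative_transform_within_open[of _ _ _ "{x0<..}"]) (use h x in \<open>auto simp: I_def\<close>)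
qed

text \<open>The logarithmic slope x h' / h is c + \<theta>, so that of the inverse is its reciprocal
  \<open>Q1\<close>, and the higher quotients follow by differentiating \<open>Q1\<close>. All
  limits are those of the pure power y^\<gamma> with \<gamma> = 1 / c: the log-convexity expression
  tends to \<gamma>^2 (1 - \<gamma>), positive since c > 1, and \<gamma> > 29 / 30 since c < 30 /
  29.\<close>

theorem inverse_regular:
  fixes c x0 :: real and h :: "real \<Rightarrow> real"
  assumes c: "1 < c" "c < 30 / 29" and F: "in_F c x0 h"
  obtains \<phi> Q1 Q2 Q3 y0 b a2 b2 b3 a4 x1
  where "regular \<phi> Q1 Q2 Q3 y0 b a2 b2 b3 a4" "x0 \<le> x1" "h x1 \<le> y0" "strict_mono_on {x1..} h"
    "\<And>x. x \<ge> x1 \<Longrightarrow> \<phi> (h x) = x" "\<And>y. y \<ge> y0 \<Longrightarrow> x1 \<le> \<phi> y \<and> h (\<phi> y) = y"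
proof -
  from F obtain \<theta> Ch where x0: "x0 \<ge> 1" and h1: "\<And>x. x \<ge> x0 \<Longrightarrow> h x \<ge> 1"
    and \<theta>: "C_diff_on 3 {x0..} \<theta>" and h: "\<And>x. x \<ge> x0 \<Longrightarrow> h x = Ch * x powr c * exp (integral {x0..x} (\<lambda>t. \<theta> t / t))"
    and lim: "\<And>k. k \<le> 3 \<Longrightarrow> ((\<lambda>x. x ^ k * deriv_on {x0..} k \<theta> x) \<longlongrightarrow> 0) at_top"
    unfolding in_F_def by blast
  define \<theta>1 \<theta>2 where "\<theta>1 = deriv_on {x0..} 1 \<theta>" and "\<theta>2 = deriv_on {x0..} 2 \<theta>"
  have lims: "(\<theta> \<longlongrightarrow> 0) at_top" "((\<lambda>x. x * \<theta>1 x) \<longlongrightarrow> 0) at_top" "((\<lambda>x. x\<^sup>2 * \<theta>2 x) \<longlongrightarrow> 0) at_top"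
    using lim[of 0] lim[of 1] lim[of 2] by (simp_all add: deriv_on_0 \<theta>1_def \<theta>2_def)
  have d\<theta>: "(\<theta> has_real_derivative \<theta>1 x) (at x)" and d\<theta>1: "(\<theta>1 has_real_derivative \<theta>2 x) (at x)" if "x0 < x" for x
    using deriv_on_DERIV[OF \<theta>, of 0 x] deriv_on_DERIV[OF \<theta>, of 1 x] that
    by (simp_all add: deriv_on_0 \<theta>1_def \<theta>2_def numeral_2_eq_2)
  have "\<theta> differentiable_on {x0..}" using \<theta> unfolding C_diff_on_def by (metis deriv_on_0 zero_less_numeral)
  then have cont\<theta>: "continuous_on {x0..} \<theta>" by (rule differentiable_imp_continuous_on)
  have dh: "(h has_real_derivative h x * (c + \<theta> x) / x) (at x)" if "x0 < x" for x
    by (rule growth_function_DERIV[OF x0 cont\<theta> h that])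
  have "eventually (\<lambda>x. - (c - 1) < \<theta> x) at_top" using order_tendstoD(1)[OF lims(1), of "- (c - 1)"] c by simp
  then obtain X where X: "\<And>x. x \<ge> X \<Longrightarrow> - (c - 1) < \<theta> x" by (auto simp: eventually_at_top_linorder)
  \<comment> \<open>Beyond \<open>x1\<close> the logarithmic slope exceeds 1, so h is increasing and
    h(x) / x is nondecreasing; the latter makes h unbounded and the inverse defined on all of [h x1,
    \<infinity>).\<close>
  define x1 where "x1 = max X x0 + 1"
  have x1: "x1 > x0" "x1 \<ge> 1" "\<And>x. x \<ge> x1 \<Longrightarrow> 1 < c + \<theta> x"
    using x0 X by (auto simp: x1_def) (smt (verit))
  have hpos: "h x > 0" if "x \<ge> x1" for x using h1[of x] that x1 by auto
  have dpos: "h x * (c + \<theta> x) / x > 0" if "x \<ge> x1" for x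
    using hpos[OF that] x1(3)[OF that] that x1(2) by auto
  have mono: "h s < h t" if "x1 \<le> s" "s < t" for s t
    by (rule DERIV_pos_imp_increasing[OF that(2)]) (use dh dpos that x1(1) in \<open>meson less_le_trans order.trans\<close>)
  have smono: "strict_mono_on {x1..} h" by (rule strict_mono_onI) (use mono in auto)
  have contH: "isCont h x" if "x \<ge> x1" for x using dh[of x] that x1(1) by (intro DERIV_isCont) auto
  have lin: "h x1 / x1 * x \<le> h x" if "x1 \<le> x" for x
  proof -
    have "h x1 / x1 \<le> h x / x"
    proof (rule DERIV_nonneg_imp_nondecreasing[OF that])
      fix u assume u: "x1 \<le> u" "u \<le> x"
      have "((\<lambda>u. h u / u) has_real_derivative (h u * (c + \<theta> u) / u * u - h u * 1) / (u * u)) (at u)"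
        by (intro DERIV_divide dh DERIV_ident) (use u x1 in auto)
      moreover have "0 \<le> (h u * (c + \<theta> u) / u * u - h u * 1) / (u * u)"
      proof -
        have "h u * 1 \<le> h u * (c + \<theta> u)" using x1(3)[OF u(1)] hpos[OF u(1)] by (intro mult_left_mono) auto
        then show ?thesis using u x1 by auto
      qed
      ultimately show "\<exists>y. ((\<lambda>u. h u / u) has_real_derivative y) (at u) \<and> 0 \<le> y" by blast
    qed
    then show ?thesis using that x1 by (simp add: pos_le_divide_eq)
  qed
  have surj: "\<exists>x\<ge>x1. h x = y" if y: "y \<ge> h x1" for y
  proof -
    define z where "z = max x1 (y * x1 / h x1)"
    have z: "x1 \<le> z" by (simp add: z_def)
    have "h x1 / x1 * (y * x1 / h x1) \<le> h x1 / x1 * z" using hpos[of x1] x1 by (intro mult_left_mono) (auto simp: z_def)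
    moreover have "h x1 / x1 * (y * x1 / h x1) = y" using hpos[of x1] x1 by simp
    ultimately have "y \<le> h z" using lin[OF z] by linarith
    moreover have "continuous_on {x1..z} h" using contH by (intro continuous_at_imp_continuous_on) auto
    ultimately obtain x where "x1 \<le> x" "x \<le> z" "h x = y" using IVT'[of h x1 y z] y z by auto
    then show ?thesis by blast
  qed
  have inj: "inj_on h {x1..}" using smono by (rule strict_mono_on_imp_inj_on)
  define \<phi> where "\<phi> = inv_into {x1..} h"
  have \<phi>h: "\<phi> (h x) = x" if "x \<ge> x1" for x unfolding \<phi>_def using inj that by (intro inv_into_f_f) auto
  have h\<phi>: "x1 \<le> \<phi> y" "h (\<phi> y) = y" if "y \<ge> h x1" for y
    using surj[OF that] \<phi>h by auto
  have \<phi>gt: "x1 < \<phi> y" if "y > h x1" for y using h\<phi>[of y] that by (cases "\<phi> y = x1") auto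
  define Q1 where "Q1 y = 1 / (c + \<theta> (\<phi> y))" for y
  \<comment> \<open>\<open>e1\<close> and \<open>e2\<close> are x \<theta>' and x^2 \<theta>'' at x
    = \<phi> y, and y Q1' = - e1 Q1^3. \<open>q2\<close> is y Q2'; the literal shapes of
    \<open>Q2\<close> and \<open>Q3\<close> are those that \<open>dprod\<close> delivers.\<close>
  define e1 where "e1 y = \<phi> y * \<theta>1 (\<phi> y)" for y
  define e2 where "e2 y = (\<phi> y)\<^sup>2 * \<theta>2 (\<phi> y)" for y
  define Q2 where "Q2 y = Q1 y * Q1 y - 1 * Q1 y + - (e1 y * Q1 y ^ 3)" for y
  define q2 where "q2 y = (2 * Q1 y - 1 - 3 * e1 y * (Q1 y)\<^sup>2) * - (e1 y * Q1 y ^ 3) - (e1 y + e2 y) * Q1 y * Q1 y ^ 3" for y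
  define Q3 where "Q3 y = Q1 y * Q2 y - 2 * Q2 y + q2 y" for y
  have d\<phi>: "(\<phi> has_real_derivative \<phi> y / y * Q1 y) (at y)" if y: "y > h x1" for y
  proof -
    have p: "\<phi> y > x1" "h (\<phi> y) = y" using \<phi>gt[OF y] h\<phi>[of y] y by auto
    have "isCont \<phi> (h (\<phi> y))"
      by (rule isCont_inverse_function2[of x1 _ "\<phi> y + 1"]) (use p \<phi>h contH in auto)
    then have ic: "isCont \<phi> y" using p by simp
    have "(h has_real_derivative h (\<phi> y) * (c + \<theta> (\<phi> y)) / \<phi> y) (at (\<phi> y))"
      by (rule dh) (use p x1 in linarith)
    then have "(\<phi> has_real_derivative inverse (h (\<phi> y) * (c + \<theta> (\<phi> y)) / \<phi> y)) (at y)"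
      by (rule DERIV_inverse_function[of _ _ _ _ "h x1" "y + 1"]) (use p y h\<phi> ic dpos[of "\<phi> y"] in auto)
    moreover have "inverse (h (\<phi> y) * (c + \<theta> (\<phi> y)) / \<phi> y) = \<phi> y / y * Q1 y" unfolding p(2) Q1_def by simp
    ultimately show ?thesis by simp
  qed
  have ypos: "y > 0" if "y > h x1" for y using that hpos[of x1] by simp
  have den: "c + \<theta> (\<phi> y) > 1" if "y > h x1" for y using x1(3) \<phi>gt[OF that] by simp
  have dQ1: "(Q1 has_real_derivative - (e1 y * Q1 y ^ 3) / y) (at y)" if y: "y > h x1" for y
  proof -
    have "((\<lambda>y. c + \<theta> (\<phi> y)) has_real_derivative 0 + \<theta>1 (\<phi> y) * (\<phi> y / y * Q1 y)) (at y)"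
      by (intro DERIV_add DERIV_const DERIV_chain2[OF d\<theta> d\<phi>[OF y]]) (use \<phi>gt[OF y] x1 in auto)
    then have "(Q1 has_real_derivative (0 * (c + \<theta> (\<phi> y)) - 1 * (0 + \<theta>1 (\<phi> y) * (\<phi> y / y * Q1 y))) / ((c + \<theta> (\<phi> y)) * (c + \<theta> (\<phi> y)))) (at y)"
      unfolding Q1_def by (intro DERIV_divide DERIV_const) (use den[OF y] in auto)
    moreover have "(0 * (c + \<theta> (\<phi> y)) - 1 * (0 + \<theta>1 (\<phi> y) * (\<phi> y / y * Q1 y))) / ((c + \<theta> (\<phi> y)) * (c + \<theta> (\<phi> y))) = - (e1 y * Q1 y ^ 3) / y"
      using den[OF y] ypos[OF y] by (simp add: Q1_def e1_def field_simps power3_eq_cube)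
    ultimately show ?thesis by simp
  qed
  have de1: "(e1 has_real_derivative (e1 y + e2 y) * Q1 y / y) (at y)" if y: "y > h x1" for y
  proof -
    have "(e1 has_real_derivative (\<phi> y / y * Q1 y) * \<theta>1 (\<phi> y) + (\<theta>2 (\<phi> y) * (\<phi> y / y * Q1 y)) * \<phi> y) (at y)"
      unfolding e1_def by (intro DERIV_mult d\<phi>[OF y] DERIV_chain2[OF d\<theta>1 d\<phi>[OF y]]) (use \<phi>gt[OF y] x1 in auto)
    moreover have "(\<phi> y / y * Q1 y) * \<theta>1 (\<phi> y) + (\<theta>2 (\<phi> y) * (\<phi> y / y * Q1 y)) * \<phi> y = (e1 y + e2 y) * Q1 y / y"
      using ypos[OF y] by (simp add: e1_def e2_def field_simps power2_eq_square)
    ultimately show ?thesis by simp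
  qed
  \<comment> \<open>The recursion Q_(k+1) = Q1 Q_k - k Q_k + y Q_k', with \<open>r\<close> standing
    for y R'.\<close>
  have dprod: "((\<lambda>y. \<phi> y / y ^ k * R y) has_real_derivative \<phi> y / y ^ Suc k * (Q1 y * R y - real k * R y + r)) (at y)"
    if y: "y > h x1" and R: "(R has_real_derivative r / y) (at y)" for y k R r
  proof -
    have "((\<lambda>y. \<phi> y / y ^ k * R y) has_real_derivative
      ((\<phi> y / y * Q1 y) * y ^ k - \<phi> y * (real k * y ^ (k - 1))) / (y ^ k * y ^ k) * R y + r / y * (\<phi> y / y ^ k)) (at y)"
      using DERIV_pow[of k y] ypos[OF y] by (intro DERIV_mult DERIV_divide d\<phi>[OF y] R) auto
    moreover have "((\<phi> y / y * Q1 y) * y ^ k - \<phi> y * (real k * y ^ (k - 1))) / (y ^ k * y ^ k) * R y + r / y * (\<phi> y / y ^ k)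
      = \<phi> y / y ^ Suc k * (Q1 y * R y - real k * R y + r)"
      using ypos[OF y] by (cases k) (simp_all add: field_simps)
    ultimately show ?thesis by simp
  qed
  have dQ2: "(Q2 has_real_derivative q2 y / y) (at y)" if y: "y > h x1" for y
  proof -
    note D = dQ1[OF y]
    have "((\<lambda>y. Q1 y ^ 3) has_real_derivative 3 * (Q1 y)\<^sup>2 * (- (e1 y * Q1 y ^ 3) / y)) (at y)"
      using DERIV_power[OF D, of 3] by (simp add: mult_ac)
    from DERIV_mult[OF de1[OF y] this]
    have "((\<lambda>y. e1 y * Q1 y ^ 3) has_real_derivative (e1 y + e2 y) * Q1 y / y * Q1 y ^ 3 + 3 * (Q1 y)\<^sup>2 * (- (e1 y * Q1 y ^ 3) / y) * e1 y) (at y)" .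
    from DERIV_add[OF DERIV_diff[OF DERIV_mult[OF D D] DERIV_cmult[OF D, of 1]] DERIV_minus[OF this]]
    have "(Q2 has_real_derivative - (e1 y * Q1 y ^ 3) / y * Q1 y + - (e1 y * Q1 y ^ 3) / y * Q1 y - 1 * (- (e1 y * Q1 y ^ 3) / y)
      + - ((e1 y + e2 y) * Q1 y / y * Q1 y ^ 3 + 3 * (Q1 y)\<^sup>2 * (- (e1 y * Q1 y ^ 3) / y) * e1 y)) (at y)"
      unfolding Q2_def .
    moreover have "- (e1 y * Q1 y ^ 3) / y * Q1 y + - (e1 y * Q1 y ^ 3) / y * Q1 y - 1 * (- (e1 y * Q1 y ^ 3) / y)
      + - ((e1 y + e2 y) * Q1 y / y * Q1 y ^ 3 + 3 * (Q1 y)\<^sup>2 * (- (e1 y * Q1 y ^ 3) / y) * e1 y) = q2 y / y"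
      unfolding q2_def using ypos[OF y] by (simp add: field_simps)
    ultimately show ?thesis by simp
  qed
  have \<phi>_top: "filterlim \<phi> at_top at_top"
    unfolding filterlim_at_top
  proof
    fix Z
    have "Z \<le> \<phi> y" if "y \<ge> h (max Z x1)" for y
    proof -
      have "h x1 \<le> h (max Z x1)" using mono[of x1 "max Z x1"] by (cases "Z \<le> x1") (auto simp: max_def)
      then have p: "x1 \<le> \<phi> y" "h (\<phi> y) = y" using h\<phi>[of y] that by auto
      have "max Z x1 \<le> \<phi> y"
      proof (rule ccontr)
        assume "\<not> max Z x1 \<le> \<phi> y"
        then have "h (\<phi> y) < h (max Z x1)" using p by (intro mono) auto
        then show False using p that by simp
      qed
      then show ?thesis by simp
    qed
    then show "eventually (\<lambda>y. Z \<le> \<phi> y) at_top" unfolding eventually_at_top_linorder by blast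
  qed
  define \<gamma> where "\<gamma> = 1 / c"
  have \<gamma>: "29 / 30 < \<gamma>" "\<gamma> < 1" using c by (simp_all add: \<gamma>_def field_simps)
  have l\<theta>: "((\<lambda>y. \<theta> (\<phi> y)) \<longlongrightarrow> 0) at_top" by (rule filterlim_compose[OF lims(1) \<phi>_top])
  have le1: "(e1 \<longlongrightarrow> 0) at_top" unfolding e1_def by (rule filterlim_compose[OF lims(2) \<phi>_top])
  have le2: "(e2 \<longlongrightarrow> 0) at_top" unfolding e2_def by (rule filterlim_compose[OF lims(3) \<phi>_top])
  have "(Q1 \<longlongrightarrow> 1 / (c + 0)) at_top" unfolding Q1_def by (intro tendsto_intros l\<theta>) (use c in auto)
  then have lQ1: "(Q1 \<longlongrightarrow> \<gamma>) at_top" by (simp add: \<gamma>_def)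
  have "(Q2 \<longlongrightarrow> \<gamma> * \<gamma> - 1 * \<gamma> + - (0 * \<gamma> ^ 3)) at_top" unfolding Q2_def by (intro tendsto_intros lQ1 le1)
  then have lQ2: "(Q2 \<longlongrightarrow> \<gamma> * \<gamma> - \<gamma>) at_top" by simp
  have "(q2 \<longlongrightarrow> (2 * \<gamma> - 1 - 3 * 0 * \<gamma>\<^sup>2) * - (0 * \<gamma> ^ 3) - (0 + 0) * \<gamma> * \<gamma> ^ 3) at_top"
    unfolding q2_def by (intro tendsto_intros lQ1 le1 le2)
  then have lq2: "(q2 \<longlongrightarrow> 0) at_top" by simp
  have "(Q3 \<longlongrightarrow> \<gamma> * (\<gamma> * \<gamma> - \<gamma>) - 2 * (\<gamma> * \<gamma> - \<gamma>) + 0) at_top"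
    unfolding Q3_def by (intro tendsto_intros lQ1 lQ2 lq2)
  then have lQ3: "(Q3 \<longlongrightarrow> (\<gamma> - 2) * (\<gamma> * \<gamma> - \<gamma>)) at_top" by (simp add: algebra_simps)
  have "((\<lambda>y. Q3 y * Q1 y - (Q2 y)\<^sup>2) \<longlongrightarrow> (\<gamma> - 2) * (\<gamma> * \<gamma> - \<gamma>) * \<gamma> - (\<gamma> * \<gamma> - \<gamma>)\<^sup>2) at_top"
    by (intro tendsto_intros lQ1 lQ2 lQ3)
  moreover have "(\<gamma> - 2) * (\<gamma> * \<gamma> - \<gamma>) * \<gamma> - (\<gamma> * \<gamma> - \<gamma>)\<^sup>2 = \<gamma>\<^sup>2 * (1 - \<gamma>)"
    by (simp add: algebra_simps power2_eq_square)
  ultimately have lQ4: "((\<lambda>y. Q3 y * Q1 y - (Q2 y)\<^sup>2) \<longlongrightarrow> \<gamma>\<^sup>2 * (1 - \<gamma>)) at_top" by simp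
  define p where "p = \<gamma> * (1 - \<gamma>)"
  define p4 where "p4 = \<gamma>\<^sup>2 * (1 - \<gamma>)"
  define p3 where "p3 = (\<gamma> - 2) * (\<gamma> * \<gamma> - \<gamma>)"
  have pp: "p > 0" "p4 > 0" using \<gamma> by (auto simp: p_def p4_def)
  have lQ2': "(Q2 \<longlongrightarrow> - p) at_top" using lQ2 by (simp add: p_def algebra_simps)
  have lQ3': "(Q3 \<longlongrightarrow> p3) at_top" using lQ3 by (simp add: p3_def)
  have lQ4': "((\<lambda>y. Q3 y * Q1 y - (Q2 y)\<^sup>2) \<longlongrightarrow> p4) at_top" using lQ4 by (simp add: p4_def)
  \<comment> \<open>Each quotient is confined near its limit: (1 + \<gamma>) / 2 lies strictly
    between \<gamma> and 1, and the positive limits are halved or doubled.\<close>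
  have "eventually (\<lambda>y. 29 / 30 < Q1 y \<and> Q1 y < (1 + \<gamma>) / 2 \<and> - (2 * p) < Q2 y \<and> Q2 y < - (p / 2) \<and>
      - \<bar>p3\<bar> - 1 < Q3 y \<and> Q3 y < \<bar>p3\<bar> + 1 \<and> p4 / 2 < Q3 y * Q1 y - (Q2 y)\<^sup>2 \<and> y > max 1 (h x1)) at_top"
    using \<gamma> pp
    by (intro eventually_conj order_tendstoD[OF lQ1] order_tendstoD[OF lQ2'] order_tendstoD[OF lQ3'] order_tendstoD[OF lQ4'] eventually_gt_at_top)
       auto
  then obtain y0 where y0: "\<And>y. y \<ge> y0 \<Longrightarrow> 29 / 30 < Q1 y \<and> Q1 y < (1 + \<gamma>) / 2 \<and> - (2 * p) < Q2 y \<and> Q2 y < - (p / 2) \<and>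
      - \<bar>p3\<bar> - 1 < Q3 y \<and> Q3 y < \<bar>p3\<bar> + 1 \<and> p4 / 2 < Q3 y * Q1 y - (Q2 y)\<^sup>2 \<and> y > max 1 (h x1)"
    unfolding eventually_at_top_linorder by blast
  have big: "y > h x1" "y > 1" if "y \<ge> y0" for y using y0[OF that] by auto
  have "regular \<phi> Q1 Q2 Q3 y0 ((1 + \<gamma>) / 2) (p / 2) (2 * p) (\<bar>p3\<bar> + 1) (p4 / 2)"
  proof
    show "1 \<le> y0" using big[of y0] by simp
    show "(1 + \<gamma>) / 2 < 1" "0 < p / 2" "0 < p4 / 2" using \<gamma> pp by auto
    fix y assume y: "y0 \<le> y"
    note B = y0[OF y]
    show "0 < \<phi> y" using \<phi>gt[OF big(1)[OF y]] x1 by simp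
    show "(\<phi> has_real_derivative \<phi> y / y * Q1 y) (at y)" by (rule d\<phi>[OF big(1)[OF y]])
    show "((\<lambda>y. \<phi> y / y * Q1 y) has_real_derivative \<phi> y / y\<^sup>2 * Q2 y) (at y)"
      using dprod[OF big(1)[OF y] dQ1[OF big(1)[OF y]], of 1] by (simp add: Q2_def power2_eq_square)
    show "((\<lambda>y. \<phi> y / y\<^sup>2 * Q2 y) has_real_derivative \<phi> y / y ^ 3 * Q3 y) (at y)"
      using dprod[OF big(1)[OF y] dQ2[OF big(1)[OF y]], of 2] by (simp add: Q3_def eval_nat_numeral)
    show "29 / 30 \<le> Q1 y" "Q1 y \<le> (1 + \<gamma>) / 2" "p / 2 \<le> - Q2 y" "- Q2 y \<le> 2 * p" "p4 / 2 \<le> Q3 y * Q1 y - (Q2 y)\<^sup>2"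
      using B by linarith+
    show "\<bar>Q3 y\<bar> \<le> \<bar>p3\<bar> + 1" using B by linarith
  qed
  moreover have "x1 \<le> \<phi> y \<and> h (\<phi> y) = y" if "y \<ge> y0" for y
    using h\<phi>[OF less_imp_le[OF big(1)[OF that]]] by simp
  moreover have "x0 \<le> x1" "h x1 \<le> y0" using x1 big(1)[of y0] by auto
  ultimately show ?thesis using that smono \<phi>h by blast
qed

section \<open>Averages over the thin set\<close>

text \<open>The locale \<open>density\<close> fixes one function and one height; here its constants
  are seen to depend on neither.\<close>

lemma (in kernels) weak_type:
  "\<exists>B t. B \<ge> 0 \<and> t > 0 \<and> (\<forall>f Z lam. finite Z \<longrightarrow> (\<forall>z. z \<notin> Z \<longrightarrow> f z = 0) \<longrightarrow> (\<forall>z. f z \<ge> 0) \<longrightarrow> lam > 0 \<longrightarrow>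
     finite {x. \<exists>n\<ge>n0. 1 / D n * (\<Sum>y\<in>S n. f (x - int y)) > t * lam} \<and>
     real (card {x. \<exists>n\<ge>n0. 1 / D n * (\<Sum>y\<in>S n. f (x - int y)) > t * lam}) \<le> B * (\<Sum>z\<in>Z. f z) / lam)"
proof -
  define B where "B = 4 + C1 * (\<rho> / (\<rho> - 1)) + 10 * C3 * (\<rho> / (\<rho> - 1)) + 2 * C3 * real (Q + 1) * suminf \<epsilon>"
  define t where "t = (C2 * real (Q + 1) + 1) / \<kappa>"
  have "B \<ge> 0" unfolding B_def using C \<rho> \<epsilon> by (intro add_nonneg_nonneg mult_nonneg_nonneg suminf_nonneg) auto
  moreover have "t > 0" unfolding t_def using C \<kappa> by (intro divide_pos_pos add_nonneg_pos mult_nonneg_nonneg) auto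
  moreover have "finite {x. \<exists>n\<ge>n0. 1 / D n * (\<Sum>y\<in>S n. f (x - int y)) > t * lam} \<and>
     real (card {x. \<exists>n\<ge>n0. 1 / D n * (\<Sum>y\<in>S n. f (x - int y)) > t * lam}) \<le> B * (\<Sum>z\<in>Z. f z) / lam"
    if "finite Z" "\<forall>z. z \<notin> Z \<longrightarrow> f z = 0" "\<forall>z. f z \<ge> 0" "lam > 0" for f :: "int \<Rightarrow> real" and Z lam
  proof -
    interpret density S D A T \<epsilon> n0 Q \<rho> \<kappa> C1 C2 C3 f Z lam by standard (use that in auto)
    show ?thesis using weak_type_finite
      unfolding avg_def threshold_def weak_const_def total_def B_def t_def .
  qed
  ultimately show ?thesis by blast
qed

text \<open>Only n > N / 2 enter the sum because the cut-off vanishes at n / N <= 1 / 2, while the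
  normalisation counts all points up to N.\<close>

definition half_avg :: "real \<Rightarrow> (real \<Rightarrow> real) \<Rightarrow> nat \<Rightarrow> (int \<Rightarrow> real) \<Rightarrow> int \<Rightarrow> real" where
  "half_avg x0 h N f x =
     1 / real (card (N_set x0 h \<inter> {1..N})) * (\<Sum>n\<in>{n\<in>N_set x0 h \<inter> {1..N}. N < 2 * n}. f (x - int n))"

lemma half_avg_mono:
  assumes "\<And>n. n \<in> {1..N} \<Longrightarrow> f (x - int n) \<le> f' (x - int n)"
  shows "half_avg x0 h N f x \<le> half_avg x0 h N f' x"
  unfolding half_avg_def using assms by (intro mult_left_mono sum_mono) auto

lemma half_avg_add: "half_avg x0 h N (\<lambda>z. f z + f' z) x = half_avg x0 h N f x + half_avg x0 h N f' x"
  unfolding half_avg_def by (simp add: sum.distrib distrib_left)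

lemma half_avg_const:
  assumes "a \<ge> 0" shows "half_avg x0 h N (\<lambda>z. a) x \<le> a"
proof -
  let ?c = "card (N_set x0 h \<inter> {1..N})" and ?d = "card {n\<in>N_set x0 h \<inter> {1..N}. N < 2 * n}"
  have "?d \<le> ?c" by (intro card_mono) auto
  then have "real ?d / real ?c \<le> 1" by (simp add: divide_le_eq)
  then have "real ?d / real ?c * a \<le> 1 * a" using assms by (intro mult_right_mono) auto
  then show ?thesis unfolding half_avg_def by simp
qed

text \<open>Markov's inequality: every translate of f has the same sum, so m translates cost the
  factor m. This disposes of all small N at once.\<close>

lemma sum_avg_small:
  fixes f :: "int \<Rightarrow> real"
  assumes Z: "finite Z" "\<And>z. z \<notin> Z \<Longrightarrow> f z = 0" "\<And>z. f z \<ge> 0" and lam: "lam > 0"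
  shows "finite {x. (\<Sum>y\<in>{1..m}. f (x - int y)) > lam} \<and>
    real (card {x. (\<Sum>y\<in>{1..m}. f (x - int y)) > lam}) \<le> real m * (\<Sum>z\<in>Z. f z) / lam"
proof -
  let ?X = "{x. (\<Sum>y\<in>{1..m}. f (x - int y)) > lam}"
  have "?X \<subseteq> (\<Union>z\<in>Z. (\<lambda>y. z + int y) ` {1..m})"
  proof
    fix x assume "x \<in> ?X"
    then have "(\<Sum>y\<in>{1..m}. f (x - int y)) \<noteq> 0" using lam by auto
    then obtain y where "y \<in> {1..m}" "f (x - int y) \<noteq> 0" by (meson sum.neutral)
    then have "x - int y \<in> Z" "y \<in> {1..m}" "x = (x - int y) + int y" using Z by auto
    then show "x \<in> (\<Union>z\<in>Z. (\<lambda>y. z + int y) ` {1..m})" by blast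
  qed
  then have fin: "finite ?X" by (rule finite_subset) (use Z in auto)
  have "real (card ?X) * lam = (\<Sum>x\<in>?X. lam)" by simp
  also have "\<dots> \<le> (\<Sum>x\<in>?X. \<Sum>y\<in>{1..m}. f (x - int y))" by (intro sum_mono) auto
  also have "\<dots> = (\<Sum>y\<in>{1..m}. \<Sum>x\<in>?X. f (x - int y))" by (rule sum.swap)
  also have "\<dots> \<le> (\<Sum>y\<in>{1..m}. \<Sum>z\<in>Z. f z)"
  proof (rule sum_mono)
    fix y
    have "(\<Sum>x\<in>?X. f (x - int y)) = (\<Sum>z\<in>(\<lambda>x. x - int y) ` ?X. f z)" by (subst sum.reindex) (auto simp: inj_on_def)
    also have "\<dots> = (\<Sum>z\<in>(\<lambda>x. x - int y) ` ?X \<inter> Z. f z)" using fin Z by (intro sum.mono_neutral_right) auto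
    also have "\<dots> \<le> (\<Sum>z\<in>Z. f z)" using Z by (intro sum_mono2) auto
    finally show "(\<Sum>x\<in>?X. f (x - int y)) \<le> (\<Sum>z\<in>Z. f z)" .
  qed
  also have "\<dots> = real m * (\<Sum>z\<in>Z. f z)" by simp
  finally show ?thesis using fin lam by (simp add: pos_le_divide_eq)
qed

text \<open>For N in [2^n, 2^(n+1)) the range (N/2, N] lies within that of \<open>S n\<close>, and
  at least \<phi>(2^n) / 2 points of the set are at most N; the average is thus at most twice the
  one at scale n. Smaller N are covered by the trivial bound.\<close>

theorem half_avg_weak_type:
  assumes p: "1 < p" "p < 30 / 29" and F: "in_F p x0 h"
  shows "\<exists>B>0. \<forall>f Z lam. finite Z \<longrightarrow> (\<forall>z. z \<notin> Z \<longrightarrow> f z = 0) \<longrightarrow> (\<forall>z. f z \<ge> 0) \<longrightarrow> lam > 0 \<longrightarrow>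
     finite {x. \<exists>N\<ge>1. N_set x0 h \<inter> {1..N} \<noteq> {} \<and> half_avg x0 h N f x > lam} \<and>
     real (card {x. \<exists>N\<ge>1. N_set x0 h \<inter> {1..N} \<noteq> {} \<and> half_avg x0 h N f x > lam}) \<le> B * (\<Sum>z\<in>Z. f z) / lam"
proof -
  obtain \<phi> Q1 Q2 Q3 y0 b a2 b2 b3 a4 x1
    where R: "regular \<phi> Q1 Q2 Q3 y0 b a2 b2 b3 a4" and x1: "x0 \<le> x1" "h x1 \<le> y0" and mono: "strict_mono_on {x1..} h"
      and \<phi>h: "\<And>x. x \<ge> x1 \<Longrightarrow> \<phi> (h x) = x" and h\<phi>: "\<And>y. y \<ge> y0 \<Longrightarrow> x1 \<le> \<phi> y \<and> h (\<phi> y) = y"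
    using inverse_regular[OF p F] by blast
  interpret regular \<phi> Q1 Q2 Q3 y0 b a2 b2 b3 a4 by (rule R)
  define NS where "NS = N_set x0 h"
  obtain n1 where n1: "\<And>n. n \<ge> n1 \<Longrightarrow> admissible (2 ^ n)" using eventually_admissible by blast
  define s0 :: real where "s0 = 2 ^ n1"
  have s0: "s0 \<ge> y0" "\<phi> s0 \<le> s0"
  proof -
    interpret regular_scale \<phi> Q1 Q2 Q3 y0 b a2 b2 b3 a4 "2 ^ n1" by standard (simp add: n1)
    show "s0 \<ge> y0" using scale(7) by (simp add: s0_def)
    show "\<phi> s0 \<le> s0" using scale(2,4) by (simp add: s0_def ratio_def field_simps)
  qed
  \<comment> \<open>From \<open>s0\<close> on \<phi>(u) <= u, hence \<phi>' <= 1. Values of h at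
    distinct integers then differ by at least 1 and have distinct integer parts.\<close>
  have \<phi>_contract: "\<phi> t - \<phi> s \<le> t - s" if "s0 \<le> s" "s \<le> t" for s t
  proof -
    have "s - \<phi> s \<le> t - \<phi> t"
    proof (rule DERIV_nonneg_imp_nondecreasing[OF that(2)])
      fix u assume u: "s \<le> u" "u \<le> t"
      have u0: "u \<ge> y0" "u > 0" using u that s0 y0 by linarith+
      have "\<phi> u \<le> \<phi> s0 * (u / s0)" using \<phi>_sublinear[OF s0(1), of u] u that by simp
      also have "\<dots> \<le> s0 * (u / s0)" using s0 u0 y0 by (intro mult_right_mono) auto
      also have "\<dots> = u" using s0 y0 by simp
      finally have "\<phi> u / u \<le> 1" using u0 by simp
      moreover have "0 \<le> \<phi> u / u" "Q1 u \<le> 1" "0 \<le> Q1 u" using \<phi>_pos[OF u0(1)] u0 Q1[OF u0(1)] b by auto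
      ultimately have "\<phi> u / u * Q1 u \<le> 1 * 1" by (intro mult_mono) auto
      moreover have "((\<lambda>u. u - \<phi> u) has_real_derivative 1 - \<phi> u / u * Q1 u) (at u)"
        by (intro DERIV_diff DERIV_ident d1 u0)
      ultimately show "\<exists>y. ((\<lambda>u. u - \<phi> u) has_real_derivative y) (at u) \<and> 0 \<le> y" by (intro exI conjI) auto
    qed
    then show ?thesis by linarith
  qed
  have h_mono: "h s \<le> h t" if "x1 \<le> s" "s \<le> t" for s t
    using strict_mono_on_leD[OF mono, of s t] that by simp
  define a where "a = nat \<lceil>max x1 (\<phi> s0)\<rceil> + 1"
  have a: "real a \<ge> x1" "real a \<ge> \<phi> s0" "a \<ge> 1" unfolding a_def by linarith+
  have ha: "h (real m) \<ge> s0" "h (real m) \<ge> y0" if "m \<ge> a" for m :: nat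
  proof -
    have "h (\<phi> s0) = s0" "x1 \<le> \<phi> s0" using h\<phi>[OF s0(1)] by auto
    moreover have "\<phi> s0 \<le> real m" using a(2) that by (meson of_nat_mono order.trans)
    ultimately show "h (real m) \<ge> s0" using h_mono[of "\<phi> s0" "real m"] by simp
    then show "h (real m) \<ge> y0" using s0 by linarith
  qed
  define fl where "fl m = nat \<lfloor>h (real m)\<rfloor>" for m :: nat
  have am: "real m \<ge> x1" if "m \<ge> a" for m using a(1) that by (meson of_nat_mono order.trans)
  have fl_NS: "fl m \<in> NS" "real (fl m) \<le> h (real m)" if "m \<ge> a" for m
  proof -
    have "h (real m) \<ge> 1" using ha[OF that] y0 by linarith
    then have "\<lfloor>h (real m)\<rfloor> \<ge> 1" by linarith
    then have "int (fl m) = \<lfloor>h (real m)\<rfloor>" "fl m \<ge> 1" unfolding fl_def by linarith+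
    then show "fl m \<in> NS" "real (fl m) \<le> h (real m)" unfolding NS_def N_set_def using am[OF that] a x1 that
      by (auto intro!: exI[of _ m]) linarith
  qed
  have fl_inj: "inj_on fl {a..}"
  proof -
    have "fl m < fl m'" if m: "a \<le> m" "m < m'" for m m'
    proof -
      have le: "h (real m) \<le> h (real m')" using h_mono[of "real m" "real m'"] am m by simp
      have "\<phi> (h (real m')) - \<phi> (h (real m)) \<le> h (real m') - h (real m)" by (rule \<phi>_contract) (use ha m le in auto)
      then have "h (real m) + 1 \<le> h (real m')" using \<phi>h[of "real m"] \<phi>h[of "real m'"] am m by simp
      moreover have "h (real m) \<ge> 1" using ha[of m] m y0 by simp
      ultimately show ?thesis unfolding fl_def by linarith
    qed
    then show ?thesis by (intro inj_onI) (metis atLeast_iff linorder_neqE_nat order_less_irrefl)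
  qed
  \<comment> \<open>The indices below \<open>x1\<close>, where h is not controlled, are finite in
    number; their values stay below \<open>Bd\<close> and drop out of \<open>S n\<close> for large
    n.\<close>
  obtain Bd where Bd: "\<And>m::nat. real m < x1 \<Longrightarrow> h (real m) \<le> Bd"
  proof -
    have fin: "finite {m::nat. real m < x1}"
      by (rule finite_subset[of _ "{..nat \<lceil>x1\<rceil>}"]) (auto, linarith)
    have "h (real m) \<le> Max (insert 0 ((\<lambda>m. h (real m)) ` {m::nat. real m < x1}))" if "real m < x1" for m :: nat
      using fin that by (intro Max_ge) auto
    then show ?thesis using that by blast
  qed
  obtain n2 where n2: "\<And>n. n \<ge> n2 \<Longrightarrow> 2 * Bd + 1 \<le> 1 * (2 ^ n) powr 1" using exists_power_ge[of 1 1 "2 * Bd + 1"] by auto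
  \<comment> \<open>This leaves at least half of the about \<phi>(2^n) indices after those below
    \<open>a\<close> are discarded.\<close>
  obtain n3 where n3: "\<And>n. n \<ge> n3 \<Longrightarrow> 2 * real a + 2 \<le> \<kappa>0 * (2 ^ n) powr (29 / 30)" using exists_power_ge[of \<kappa>0 "29 / 30"] \<kappa>0 by auto
  define n0 where "n0 = max (max n1 n2) n3"
  define S where "S n = {y\<in>NS. 2 ^ n \<le> 2 * y \<and> y \<le> 2 * 2 ^ n}" for n
  have S_bounds: "2 ^ n / 2 \<le> real y \<and> real y \<le> 2 * 2 ^ n" if "y \<in> S n" for n y
  proof -
    have "2 ^ n \<le> 2 * y" "y \<le> 2 * 2 ^ n" using that by (auto simp: S_def)
    then have "real (2 ^ n) \<le> real (2 * y)" "real y \<le> real (2 * 2 ^ n)" by (simp_all only: of_nat_le_iff)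
    then show ?thesis by simp
  qed
  have S_rep: "\<exists>m::nat. real m \<ge> x1 \<and> y = fl m \<and> real y \<le> h (real m) \<and> h (real m) \<le> real y + 1 \<and> h (real m) \<ge> y0"
    if n: "n \<ge> n0" and y: "y \<in> S n" for n y
  proof -
    obtain m where m: "m \<ge> 1" "real m \<ge> x0" "int y = \<lfloor>h (real m)\<rfloor>" using y by (auto simp: S_def NS_def N_set_def)
    have yh: "real y \<le> h (real m)" "h (real m) \<le> real y + 1" "y = fl m" using m(3) unfolding fl_def by linarith+
    have "Bd < 2 ^ n / 2" using n2[of n] n by (simp add: n0_def)
    then have "Bd < h (real m)" using S_bounds[OF y] yh by linarith
    then have mx: "real m \<ge> x1" using Bd[of m] by linarith
    interpret regular_scale \<phi> Q1 Q2 Q3 y0 b a2 b2 b3 a4 "2 ^ n" by standard (use n1 n in \<open>simp add: n0_def\<close>)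
    have "y0 * 8 \<le> y0 * L" using L y0 by (intro mult_left_mono) auto
    then have "y0 \<le> 2 ^ n / 2" using scale(1) y0 by linarith
    then have "h (real m) \<ge> y0" using S_bounds[OF y] yh by linarith
    then show ?thesis using mx yh by blast
  qed
  \<comment> \<open>A point of \<open>S n\<close> has an index m with h(m) <= 4 * 2^n, hence m <=
    \<phi>(4 * 2^n) <= 4 \<phi>(2^n); the index 0 raises the factor to 5.\<close>
  have card_S: "real (card (S n)) \<le> 5 * \<phi> (2 ^ n)" if n: "n \<ge> n0" for n
  proof -
    interpret regular_scale \<phi> Q1 Q2 Q3 y0 b a2 b2 b3 a4 "2 ^ n" by standard (use n1 n in \<open>simp add: n0_def\<close>)
    have "S n \<subseteq> fl ` {..nat \<lfloor>4 * \<phi> (2 ^ n)\<rfloor>}"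
    proof
      fix y assume y: "y \<in> S n"
      obtain m where m: "real m \<ge> x1" "y = fl m" "h (real m) \<le> real y + 1" "h (real m) \<ge> y0" using S_rep[OF n y] by blast
      have "h (real m) \<le> 4 * 2 ^ n" using S_bounds[OF y] m(3) one_le_power[of "2::real" n] by linarith
      then have "\<phi> (h (real m)) \<le> \<phi> (4 * 2 ^ n)" using m(4) by (intro \<phi>_mono)
      also have "\<dots> \<le> \<phi> (2 ^ n) * (4 * 2 ^ n / 2 ^ n)" using scale(7) by (intro \<phi>_sublinear) auto
      also have "\<dots> = 4 * \<phi> (2 ^ n)" by simp
      finally have "real m \<le> 4 * \<phi> (2 ^ n)" using \<phi>h[OF m(1)] by simp
      then have "m \<le> nat \<lfloor>4 * \<phi> (2 ^ n)\<rfloor>" by linarith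
      then show "y \<in> fl ` {..nat \<lfloor>4 * \<phi> (2 ^ n)\<rfloor>}" using m(2) by blast
    qed
    then have "card (S n) \<le> card {..nat \<lfloor>4 * \<phi> (2 ^ n)\<rfloor>}" by (meson card_image_le card_mono finite_atMost finite_imageI order.trans)
    then have "real (card (S n)) \<le> real (nat \<lfloor>4 * \<phi> (2 ^ n)\<rfloor>) + 1" by simp
    also have "\<dots> \<le> 5 * \<phi> (2 ^ n)" using scale(4) by linarith
    finally show ?thesis .
  qed
  interpret K: kernels S "\<lambda>n. \<phi> (2 ^ n)" "\<lambda>n. Ak (2 ^ n)" "\<lambda>n. Tk (2 ^ n)" eps n0 Q "2 powr (29 / 30)" "sqrt c / 1600" 5 "profile.W c C" C3
  proof (rule kernels_instance)
    show "admissible (2 ^ n)" if "n0 \<le> n" for n using n1 that by (simp add: n0_def)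
    show "\<exists>(m::nat) u. real y \<le> u \<and> u \<le> real y + 1 \<and> \<phi> u = real m" if "n0 \<le> n" "y \<in> S n" for n y
      using S_rep[OF that] \<phi>h by blast
  qed (use S_bounds card_S in auto)
  obtain B t where Bt: "B \<ge> 0" "t > 0" and W: "\<And>f Z lam. finite Z \<Longrightarrow> (\<forall>z. z \<notin> Z \<longrightarrow> f z = 0) \<Longrightarrow> (\<forall>z. f z \<ge> 0) \<Longrightarrow> lam > 0 \<Longrightarrow>
     finite {x. \<exists>n\<ge>n0. 1 / \<phi> (2 ^ n) * (\<Sum>y\<in>S n. f (x - int y)) > t * lam} \<and>
     real (card {x. \<exists>n\<ge>n0. 1 / \<phi> (2 ^ n) * (\<Sum>y\<in>S n. f (x - int y)) > t * lam}) \<le> B * (\<Sum>z\<in>Z. f z) / lam"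
    using K.weak_type by blast
  have card_lower: "\<phi> (2 ^ n) / 2 \<le> real (card (NS \<inter> {1..N}))" if n: "n \<ge> n0" and N: "2 ^ n \<le> N" for n N
  proof -
    interpret regular_scale \<phi> Q1 Q2 Q3 y0 b a2 b2 b3 a4 "2 ^ n" by standard (use n1 n in \<open>simp add: n0_def\<close>)
    define k where "k = nat \<lfloor>\<phi> (2 ^ n)\<rfloor>"
    have "fl ` {a..k} \<subseteq> NS \<inter> {1..N}"
    proof
      fix y assume "y \<in> fl ` {a..k}"
      then obtain m where m: "a \<le> m" "m \<le> k" "y = fl m" by auto
      have "real m \<le> \<phi> (2 ^ n)" using m(2) scale(4) unfolding k_def by linarith
      then have "h (real m) \<le> h (\<phi> (2 ^ n))" using am[OF m(1)] by (intro h_mono)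
      also have "\<dots> = 2 ^ n" using h\<phi>[OF scale(7)] by simp
      finally have "real y \<le> 2 ^ n" using fl_NS(2)[OF m(1)] m(3) by linarith
      then have "real y \<le> real N" using of_nat_mono[OF N, where 'a=real] by simp
      then have "y \<le> N" by simp
      moreover have "y \<in> NS" "y \<ge> 1" using fl_NS(1)[OF m(1)] m(3) by (auto simp: NS_def N_set_def)
      ultimately show "y \<in> NS \<inter> {1..N}" by simp
    qed
    then have "card (fl ` {a..k}) \<le> card (NS \<inter> {1..N})" by (intro card_mono) auto
    moreover have "card (fl ` {a..k}) = Suc k - a" using inj_on_subset[OF fl_inj, of "{a..k}"] by (simp add: card_image)
    ultimately have "real (Suc k) - real a \<le> real (card (NS \<inter> {1..N}))" by linarith
    moreover have "real (Suc k) \<ge> \<phi> (2 ^ n)" unfolding k_def by linarith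
    moreover have "2 * real a + 2 \<le> \<phi> (2 ^ n)" using n3[of n] n \<phi>_ge[OF scale(7)] by (simp add: n0_def)
    ultimately show ?thesis by linarith
  qed
  define N1 :: nat where "N1 = 2 ^ n0"
  \<comment> \<open>\<open>N1\<close> pays for the small N. The factor 2 t arises because the
    criterion is applied at height lam / (2 t), the 2 being lost in
    \<open>card_lower\<close>.\<close>
  define BB where "BB = real N1 + B * (2 * t)"
  show ?thesis
  proof (intro exI[of _ BB] conjI allI impI)
    show "BB > 0" unfolding BB_def N1_def using Bt by (intro add_pos_nonneg) auto
    fix f :: "int \<Rightarrow> real" and Z and lam :: real
    assume f: "finite Z" "\<forall>z. z \<notin> Z \<longrightarrow> f z = 0" "\<forall>z. 0 \<le> f z" and lam: "0 < lam"
    define lam' where "lam' = lam / (2 * t)"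
    have lam': "lam' > 0" "t * lam' = lam / 2" using lam Bt by (simp_all add: lam'_def)
    let ?X = "{x. \<exists>N\<ge>1. N_set x0 h \<inter> {1..N} \<noteq> {} \<and> half_avg x0 h N f x > lam}"
    let ?U = "{x. (\<Sum>y\<in>{1..N1}. f (x - int y)) > lam}"
    let ?V = "{x. \<exists>n\<ge>n0. 1 / \<phi> (2 ^ n) * (\<Sum>y\<in>S n. f (x - int y)) > t * lam'}"
    have U: "finite ?U \<and> real (card ?U) \<le> real N1 * (\<Sum>z\<in>Z. f z) / lam" using sum_avg_small[of Z f lam N1] f lam by auto
    have V: "finite ?V \<and> real (card ?V) \<le> B * (\<Sum>z\<in>Z. f z) / lam'" using W[OF f lam'(1)] .
    have sub: "?X \<subseteq> ?U \<union> ?V"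
    proof
      fix x assume "x \<in> ?X"
      then obtain N where N: "N \<ge> 1" "NS \<inter> {1..N} \<noteq> {}" "half_avg x0 h N f x > lam" by (auto simp: NS_def)
      define cN where "cN = real (card (NS \<inter> {1..N}))"
      have ha': "half_avg x0 h N f x = 1 / cN * (\<Sum>n\<in>{n\<in>NS \<inter> {1..N}. N < 2 * n}. f (x - int n))"
        by (simp add: half_avg_def cN_def NS_def)
      show "x \<in> ?U \<union> ?V"
      proof (cases "N \<le> N1")
        case True
        have "card (NS \<inter> {1..N}) \<noteq> 0" using N(2) by simp
        then have "cN \<ge> 1" unfolding cN_def by linarith
        then have "1 / cN * (\<Sum>n\<in>{n\<in>NS \<inter> {1..N}. N < 2 * n}. f (x - int n)) \<le> 1 * (\<Sum>y\<in>{1..N1}. f (x - int y))"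
          using f True by (intro mult_mono sum_mono2 sum_nonneg) auto
        then have "x \<in> ?U" using N(3) ha' by simp
        then show ?thesis by blast
      next
        case False
        define n where "n = (GREATEST n. 2 ^ n \<le> N)"
        have bnd: "\<forall>k. 2 ^ k \<le> N \<longrightarrow> k \<le> N" using less_exp by (meson le_trans less_imp_le)
        have n1': "2 ^ n \<le> N" unfolding n_def by (rule GreatestI_nat[of _ n0 N]) (use False bnd in \<open>auto simp: N1_def\<close>)
        have nn0: "n \<ge> n0" unfolding n_def by (rule Greatest_le_nat[of _ n0 N]) (use False bnd in \<open>auto simp: N1_def\<close>)
        have greatest: "k \<le> n" if "2 ^ k \<le> N" for k
          unfolding n_def by (rule Greatest_le_nat[of "\<lambda>n. 2 ^ n \<le> N" k N]) (use that bnd in auto)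
        have n2': "N < 2 * 2 ^ n"
        proof (rule ccontr)
          assume "\<not> N < 2 * 2 ^ n"
          then have "2 ^ Suc n \<le> N" by simp
          then show False using greatest[of "Suc n"] by simp
        qed
        have \<phi>p: "\<phi> (2 ^ n) > 0" using K.D(1)[OF nn0] .
        have cl: "\<phi> (2 ^ n) / 2 \<le> cN" unfolding cN_def by (rule card_lower[OF nn0 n1'])
        have fS: "finite (S n)" unfolding S_def by (rule finite_subset[of _ "{..2 * 2 ^ n}"]) auto
        have "1 / cN * (\<Sum>n\<in>{n\<in>NS \<inter> {1..N}. N < 2 * n}. f (x - int n)) \<le> 1 / (\<phi> (2 ^ n) / 2) * (\<Sum>y\<in>S n. f (x - int y))"
        proof (rule mult_mono)
          show "1 / cN \<le> 1 / (\<phi> (2 ^ n) / 2)" using cl \<phi>p by (intro divide_left_mono) auto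
          show "(\<Sum>n\<in>{n\<in>NS \<inter> {1..N}. N < 2 * n}. f (x - int n)) \<le> (\<Sum>y\<in>S n. f (x - int y))"
            using f fS n1' n2' by (intro sum_mono2) (auto simp: S_def)
        qed (use \<phi>p f in \<open>auto intro!: sum_nonneg\<close>)
        then have "lam < 1 / (\<phi> (2 ^ n) / 2) * (\<Sum>y\<in>S n. f (x - int y))" using N(3) ha' by linarith
        then have "lam / 2 < 1 / \<phi> (2 ^ n) * (\<Sum>y\<in>S n. f (x - int y))" by (simp add: mult.commute)
        then have "t * lam' < 1 / \<phi> (2 ^ n) * (\<Sum>y\<in>S n. f (x - int y))" unfolding lam'(2) .
        then have "x \<in> ?V" using nn0 by blast
        then show ?thesis by blast
      qed
    qed
    have fin: "finite (?U \<union> ?V)" using U V by blast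
    show "finite ?X" by (rule finite_subset[OF sub fin])
    have "real (card ?X) \<le> real (card (?U \<union> ?V))" using card_mono[OF fin sub] by simp
    also have "\<dots> \<le> real (card ?U) + real (card ?V)" using card_Un_le[of ?U ?V] by linarith
    also have "\<dots> \<le> real N1 * (\<Sum>z\<in>Z. f z) / lam + B * (\<Sum>z\<in>Z. f z) / lam'" using U V by linarith
    also have "\<dots> = BB * (\<Sum>z\<in>Z. f z) / lam" unfolding BB_def lam'_def using lam Bt by (simp add: field_simps)
    finally show "real (card ?X) \<le> BB * (\<Sum>z\<in>Z. f z) / lam" .
  qed
qed

section \<open>The maximal function\<close>

text \<open>Only absolute values are kept: 0 <= \<eta> <= 1, and \<eta>(n / N) = 0 unless N < 2
  n.\<close>

lemma conv_kernel_le: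
  assumes supp: "closure {x. \<eta> x \<noteq> 0} \<subseteq> {1/2<..<4}" and \<eta>: "\<forall>x. 0 \<le> \<eta> x \<and> \<eta> x \<le> 1" and N: "N \<ge> 1"
  shows "cmod (conv (\<lambda>z. complex_of_real (kernel x0 h \<eta> N z)) f x) \<le> half_avg x0 h N (\<lambda>z. cmod (f z)) x"
proof -
  define J where "J = N_set x0 h \<inter> {1..N}"
  have fin: "finite J" by (simp add: J_def)
  have \<eta>0: "\<eta> (real n / real N) = 0" if "2 * n \<le> N" for n
  proof (rule ccontr)
    assume "\<eta> (real n / real N) \<noteq> 0"
    then have "real n / real N \<in> closure {x. \<eta> x \<noteq> 0}" using closure_subset[of "{x. \<eta> x \<noteq> 0}"] by blast
    then have "real n / real N \<in> {1/2<..<4}" using supp by blast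
    then have "1 / 2 < real n / real N" by simp
    then show False using that N by (simp add: field_simps flip: of_nat_mult)
  qed
  have ker: "kernel x0 h \<eta> N (int n) = 1 / real (card J) * \<eta> (real n / real N)" if "n \<in> J" for n
  proof -
    have "(\<Sum>m\<in>J. delta (int m) (int n) * \<eta> (real m / real N)) = (\<Sum>m\<in>J. if m = n then \<eta> (real m / real N) else 0)"
      by (intro sum.cong) (auto simp: delta_def)
    also have "\<dots> = \<eta> (real n / real N)" using fin that by simp
    finally show ?thesis by (simp add: kernel_def J_def)
  qed
  have ker0: "kernel x0 h \<eta> N z = 0" if "z \<notin> int ` J" for z
  proof -
    have "(\<Sum>m\<in>J. delta (int m) z * \<eta> (real m / real N)) = 0"
      using that by (intro sum.neutral) (auto simp: delta_def)
    then show ?thesis by (simp add: kernel_def J_def)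
  qed
  have "conv (\<lambda>z. complex_of_real (kernel x0 h \<eta> N z)) f x
      = infsum (\<lambda>y. complex_of_real (kernel x0 h \<eta> N (x - y)) * f y) ((\<lambda>n. x - int n) ` J)"
    unfolding conv_def
  proof (rule infsum_cong_neutral)
    fix y assume "y \<in> UNIV - (\<lambda>n. x - int n) ` J"
    then have "x - y \<notin> int ` J" by (auto simp: image_iff)
    then show "complex_of_real (kernel x0 h \<eta> N (x - y)) * f y = 0" using ker0 by simp
  qed auto
  also have "\<dots> = (\<Sum>n\<in>J. complex_of_real (kernel x0 h \<eta> N (int n)) * f (x - int n))"
    using fin by (simp add: sum.reindex inj_on_def)
  also have "\<dots> = (\<Sum>n\<in>J. complex_of_real (1 / real (card J) * \<eta> (real n / real N)) * f (x - int n))"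
    by (intro sum.cong) (simp_all add: ker)
  also have "cmod \<dots> \<le> (\<Sum>n\<in>J. 1 / real (card J) * (if N < 2 * n then cmod (f (x - int n)) else 0))"
  proof (rule sum_norm_le)
    fix n assume "n \<in> J"
    have "\<eta> (real n / real N) * cmod (f (x - int n)) \<le> (if N < 2 * n then cmod (f (x - int n)) else 0)"
      using \<eta>0[of n] \<eta> by (auto intro: mult_left_le_one_le)
    then have "1 / real (card J) * (\<eta> (real n / real N) * cmod (f (x - int n))) \<le> 1 / real (card J) * (if N < 2 * n then cmod (f (x - int n)) else 0)"
      by (rule mult_left_mono) simp
    then show "cmod (complex_of_real (1 / real (card J) * \<eta> (real n / real N)) * f (x - int n))
       \<le> 1 / real (card J) * (if N < 2 * n then cmod (f (x - int n)) else 0)"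
      using \<eta> by (simp only: norm_mult norm_of_real) (simp add: abs_mult)
  qed
  also have "\<dots> = half_avg x0 h N (\<lambda>z. cmod (f z)) x"
    unfolding half_avg_def J_def[symmetric] sum_distrib_left[symmetric] sum.inter_filter[OF fin] ..
  finally show ?thesis .
qed

section \<open>Level sets, and the passage to infinitely supported functions\<close>

definition level_set :: "real \<Rightarrow> (real \<Rightarrow> real) \<Rightarrow> (int \<Rightarrow> real) \<Rightarrow> real \<Rightarrow> int set" where
  "level_set x0 h F s = {x. \<exists>N\<ge>1. N_set x0 h \<inter> {1..N} \<noteq> {} \<and> half_avg x0 h N F x > s}"

lemma maximal_greater:
  assumes "closure {x. \<eta> x \<noteq> 0} \<subseteq> {1/2<..<4}" "\<forall>x. 0 \<le> \<eta> x \<and> \<eta> x \<le> 1"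
    and "maximal x0 h \<eta> f x > ennreal s" "s \<ge> 0"
  shows "x \<in> level_set x0 h (\<lambda>z. cmod (f z)) s"
proof -
  obtain N where N: "N \<ge> 1" "N_set x0 h \<inter> {1..N} \<noteq> {}"
      "ennreal s < ennreal (cmod (conv (\<lambda>z. complex_of_real (kernel x0 h \<eta> N z)) f x))"
    using assms(3) unfolding maximal_def less_SUP_iff by auto
  then have "s < cmod (conv (\<lambda>z. complex_of_real (kernel x0 h \<eta> N z)) f x)"
    using assms(4) by (simp add: ennreal_less_iff)
  then have "s < half_avg x0 h N (\<lambda>z. cmod (f z)) x" using conv_kernel_le[OF assms(1,2) N(1)] by (rule less_le_trans)
  then show ?thesis using N by (auto simp: level_set_def)
qed

lemma maximal_le:
  assumes "closure {x. \<eta> x \<noteq> 0} \<subseteq> {1/2<..<4}" "\<forall>x. 0 \<le> \<eta> x \<and> \<eta> x \<le> 1"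
    and F: "\<And>z. cmod (f z) \<le> a"
  shows "maximal x0 h \<eta> f x \<le> ennreal a"
  unfolding maximal_def
proof (rule SUP_least)
  fix N assume "N \<in> {N. 1 \<le> N \<and> N_set x0 h \<inter> {1..N} \<noteq> {}}"
  then have N: "N \<ge> 1" by simp
  have a: "a \<ge> 0" using F[of 0] norm_ge_zero order.trans by blast
  have "cmod (conv (\<lambda>z. complex_of_real (kernel x0 h \<eta> N z)) f x) \<le> half_avg x0 h N (\<lambda>z. cmod (f z)) x"
    by (rule conv_kernel_le[OF assms(1,2) N])
  also have "\<dots> \<le> half_avg x0 h N (\<lambda>z. a) x" by (rule half_avg_mono) (rule F)
  also have "\<dots> \<le> a" by (rule half_avg_const[OF a])
  finally show "ennreal (cmod (conv (\<lambda>z. complex_of_real (kernel x0 h \<eta> N z)) f x)) \<le> ennreal a" by (rule ennreal_leI)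
qed

text \<open>Finiteness of the level set is part of the claim because \<open>card\<close> of an
  infinite set is 0.\<close>

definition weak_bound :: "real \<Rightarrow> (real \<Rightarrow> real) \<Rightarrow> real \<Rightarrow> bool" where
  "weak_bound x0 h B \<longleftrightarrow> (\<forall>f Z s. finite Z \<longrightarrow> (\<forall>z. z \<notin> Z \<longrightarrow> f z = 0) \<longrightarrow> (\<forall>z. f z \<ge> 0) \<longrightarrow> s > 0 \<longrightarrow>
     finite (level_set x0 h f s) \<and> real (card (level_set x0 h f s)) \<le> B * (\<Sum>z\<in>Z. f z) / s)"

text \<open>A finite subset of the level set is witnessed by finitely many N, hence by the values of
  F on a finite set. The bound for that restriction is uniform, and a set whose finite subsets have
  bounded size is finite.\<close>

lemma weak_bound_summable:
  assumes W: "weak_bound x0 h B" and B: "B > 0" and F: "\<And>z. F z \<ge> 0" and s: "s > 0"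
    and K: "\<And>J. finite J \<Longrightarrow> (\<Sum>z\<in>J. F z) \<le> K"
  shows "finite (level_set x0 h F s)" "real (card (level_set x0 h F s)) \<le> B * K / s"
proof -
  have K0: "K \<ge> 0" using K[of "{}"] by simp
  have "finite (level_set x0 h F s) \<and> card (level_set x0 h F s) \<le> nat \<lfloor>B * K / s\<rfloor>"
  proof (rule finite_if_finite_subsets_card_bdd)
    fix G assume G: "G \<subseteq> level_set x0 h F s" "finite G"
    then have "\<forall>x\<in>G. \<exists>N\<ge>1. N_set x0 h \<inter> {1..N} \<noteq> {} \<and> half_avg x0 h N F x > s" by (auto simp: level_set_def)
    then obtain n where n: "\<And>x. x \<in> G \<Longrightarrow> n x \<ge> 1 \<and> N_set x0 h \<inter> {1..n x} \<noteq> {} \<and> half_avg x0 h (n x) F x > s" by metis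
    define J where "J = (\<Union>x\<in>G. (\<lambda>k. x - int k) ` {1..n x})"
    have J: "finite J" unfolding J_def using G by auto
    define F' where "F' z = (if z \<in> J then F z else 0)" for z
    have "G \<subseteq> level_set x0 h F' s"
    proof
      fix x assume x: "x \<in> G"
      have "half_avg x0 h (n x) F x \<le> half_avg x0 h (n x) F' x"
        by (rule half_avg_mono) (use x in \<open>auto simp: F'_def J_def\<close>)
      then show "x \<in> level_set x0 h F' s" using n[OF x] unfolding level_set_def
        by (intro CollectI exI[of _ "n x"]) auto
    qed
    moreover have "\<forall>z. z \<notin> J \<longrightarrow> F' z = 0" "\<forall>z. F' z \<ge> 0" using F by (auto simp: F'_def)
    then have W': "finite (level_set x0 h F' s)" "real (card (level_set x0 h F' s)) \<le> B * (\<Sum>z\<in>J. F' z) / s"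
      using W J s unfolding weak_bound_def by blast+
    ultimately have "real (card G) \<le> B * (\<Sum>z\<in>J. F' z) / s" using card_mono[of "level_set x0 h F' s" G] by linarith
    also have "\<dots> \<le> B * K / s" using K[OF J] B s by (intro divide_right_mono mult_left_mono) (auto simp: F'_def)
    finally show "card G \<le> nat \<lfloor>B * K / s\<rfloor>" by linarith
  qed
  then have fc: "finite (level_set x0 h F s)" "card (level_set x0 h F s) \<le> nat \<lfloor>B * K / s\<rfloor>" by auto
  show "finite (level_set x0 h F s)" by (rule fc)
  have "0 \<le> B * K / s" using B K0 s by simp
  then show "real (card (level_set x0 h F s)) \<le> B * K / s" using fc(2) by linarith
qed

lemma sum_le_nn_integral_count_space:
  assumes "finite J" shows "(\<Sum>z\<in>J. g z) \<le> (\<integral>\<^sup>+ z. g z \<partial>count_space UNIV)"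
proof -
  have "(\<Sum>z\<in>J. g z) = (\<integral>\<^sup>+ z. g z \<partial>count_space J)" using assms by (simp add: nn_integral_count_space_finite)
  also have "\<dots> = (\<integral>\<^sup>+ z. g z * indicator J z \<partial>count_space UNIV)" by (rule nn_integral_count_space_indicator) simp
  also have "\<dots> \<le> (\<integral>\<^sup>+ z. g z \<partial>count_space UNIV)" by (intro nn_integral_mono) (auto simp: indicator_def)
  finally show ?thesis .
qed

text \<open>Monotone convergence along the symmetric intervals
  \<open>{- int n..int n}\<close>.\<close>

lemma nn_integral_count_space_int_le:
  fixes g :: "int \<Rightarrow> ennreal"
  assumes "\<And>J. finite J \<Longrightarrow> (\<Sum>z\<in>J. g z) \<le> b"
  shows "(\<integral>\<^sup>+ z. g z \<partial>count_space UNIV) \<le> b"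
proof -
  define J where "J n = {- int n..int n}" for n
  have inc: "incseq (\<lambda>n z. g z * indicator (J n) z)"
    by (auto simp: incseq_def le_fun_def J_def indicator_def)
  have "(SUP n. g z * indicator (J n) z) = g z" for z
  proof (rule antisym)
    show "(SUP n. g z * indicator (J n) z) \<le> g z" by (rule SUP_least) (auto simp: indicator_def)
    have "g z = g z * indicator (J (nat \<bar>z\<bar>)) z" by (auto simp: J_def indicator_def)
    also have "\<dots> \<le> (SUP n. g z * indicator (J n) z)" by (rule SUP_upper) simp
    finally show "g z \<le> (SUP n. g z * indicator (J n) z)" .
  qed
  then have "(\<integral>\<^sup>+ z. g z \<partial>count_space UNIV) = (\<integral>\<^sup>+ z. (SUP n. g z * indicator (J n) z) \<partial>count_space UNIV)" by simp
  also have "\<dots> = (SUP n. \<integral>\<^sup>+ z. g z * indicator (J n) z \<partial>count_space UNIV)"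
    by (rule nn_integral_monotone_convergence_SUP[OF inc]) simp
  also have "\<dots> \<le> b"
  proof (rule SUP_least)
    fix n
    have "(\<integral>\<^sup>+ z. g z * indicator (J n) z \<partial>count_space UNIV) = (\<integral>\<^sup>+ z. g z \<partial>count_space (J n))"
      by (rule nn_integral_count_space_indicator[symmetric]) simp
    also have "\<dots> = (\<Sum>z\<in>J n. g z)" by (simp add: nn_integral_count_space_finite J_def)
    also have "\<dots> \<le> b" by (rule assms) (simp add: J_def)
    finally show "(\<integral>\<^sup>+ z. g z * indicator (J n) z \<partial>count_space UNIV) \<le> b" .
  qed
  finally show ?thesis .
qed

lemma epowr_ennreal: "a \<ge> 0 \<Longrightarrow> epowr (ennreal a) r = ennreal (a powr r)"
  by (simp add: epowr_def)

lemma epowr_1: "epowr a 1 = a"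
  by (cases a) (auto simp: epowr_def)

theorem weak_type_maximal:
  assumes W: "weak_bound x0 h B" and B: "B > 0"
    and \<eta>: "closure {x. \<eta> x \<noteq> 0} \<subseteq> {1/2<..<4}" "\<forall>x. 0 \<le> \<eta> x \<and> \<eta> x \<le> 1" and f: "f \<in> lp_space 1"
  shows "weak_l1_norm (maximal x0 h \<eta> f) \<le> ennreal B * lp_norm 1 (modulus f)"
proof -
  define P where "P = (\<integral>\<^sup>+ x. ennreal (cmod (f x)) \<partial>count_space UNIV)"
  have P: "lp_norm 1 (modulus f) = P" by (simp add: lp_norm_def epowr_1 modulus_def P_def)
  then have fin: "P < \<infinity>" using f by (simp add: lp_space_def)
  define K where "K = enn2real P"
  have PK: "P = ennreal K" using fin by (simp add: K_def less_top)
  have K: "(\<Sum>z\<in>J. cmod (f z)) \<le> K" if "finite J" for J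
  proof -
    have "ennreal (\<Sum>z\<in>J. cmod (f z)) = (\<Sum>z\<in>J. ennreal (cmod (f z)))" by (simp add: sum_ennreal)
    also have "\<dots> \<le> P" unfolding P_def by (rule sum_le_nn_integral_count_space[OF that])
    finally show ?thesis unfolding PK by (simp add: ennreal_le_iff K_def)
  qed
  show ?thesis unfolding weak_l1_norm_def P
  proof (rule SUP_least)
    fix s :: real assume "s \<in> {0<..}"
    then have s: "s > 0" by simp
    let ?E = "level_set x0 h (\<lambda>z. cmod (f z)) s"
    have sub: "{x. ennreal s < maximal x0 h \<eta> f x} \<subseteq> ?E" using maximal_greater[OF \<eta>] s by auto
    have E: "finite ?E" "real (card ?E) \<le> B * K / s" using weak_bound_summable[OF W B _ s K] by auto
    have "emeasure (count_space UNIV) {x. ennreal s < maximal x0 h \<eta> f x} \<le> emeasure (count_space UNIV) ?E"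
      by (rule emeasure_mono[OF sub]) simp
    also have "\<dots> = ennreal (real (card ?E))" using E by (simp add: ennreal_of_nat_eq_real_of_nat)
    also have "\<dots> \<le> ennreal (B * K / s)" by (rule ennreal_leI[OF E(2)])
    finally have "ennreal s * emeasure (count_space UNIV) {x. ennreal s < maximal x0 h \<eta> f x} \<le> ennreal s * ennreal (B * K / s)"
      by (rule mult_left_mono) simp
    also have "\<dots> = ennreal (B * K)" using s B by (simp add: K_def flip: ennreal_mult)
    also have "\<dots> = ennreal B * P" unfolding PK using B by (simp add: ennreal_mult K_def)
    finally show "ennreal s * emeasure (count_space UNIV) {x. ennreal s < maximal x0 h \<eta> f x} \<le> ennreal B * P" .
  qed
qed

section \<open>Interpolation with the bounded functions\<close>

lemma sum_dyadic_powr_le: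
  fixes Ks :: "int set"
  assumes fin: "finite Ks" and q: "q > 0" and Y: "\<And>k. k \<in> Ks \<Longrightarrow> 2 powr real_of_int k \<le> Y"
  shows "(\<Sum>k\<in>Ks. (2 powr real_of_int k) powr q) \<le> Y powr q / (1 - 2 powr (- q))"
proof (cases "Ks = {}")
  case True
  have "2 powr (- q) < 2 powr (0::real)" using q by (intro powr_less_mono) auto
  then show ?thesis using True by simp
next
  case False
  define m where "m = Max Ks"
  have m: "m \<in> Ks" "\<And>k. k \<in> Ks \<Longrightarrow> k \<le> m" using fin False by (auto simp: m_def)
  have lt1: "2 powr (- q) < (1::real)"
  proof -
    have "2 powr (- q) < 2 powr (0::real)" using q by (intro powr_less_mono) auto
    then show ?thesis by simp
  qed
  have "(2 powr real_of_int k) powr q = (2 powr real_of_int m) powr q * (2 powr (- q)) ^ nat (m - k)" if "k \<in> Ks" for k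
  proof -
    have "(2 powr (- q)) ^ nat (m - k) = 2 powr (- q * (real_of_int m - real_of_int k))"
      using m(2)[OF that] by (simp add: powr_powr flip: powr_realpow)
    then show ?thesis by (simp add: powr_powr flip: powr_add) (simp add: algebra_simps)
  qed
  then have "(\<Sum>k\<in>Ks. (2 powr real_of_int k) powr q) = (2 powr real_of_int m) powr q * (\<Sum>k\<in>Ks. (2 powr (- q)) ^ nat (m - k))"
    by (simp add: sum_distrib_left)
  also have "(\<Sum>k\<in>Ks. (2 powr (- q)) ^ nat (m - k)) = (\<Sum>i\<in>(\<lambda>k. nat (m - k)) ` Ks. (2 powr (- q)) ^ i)"
  proof -
    have "inj_on (\<lambda>k. nat (m - k)) Ks" using m(2) by (intro inj_onI) (force simp: eq_nat_nat_iff)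
    then show ?thesis by (simp add: sum.reindex)
  qed
  also have "\<dots> \<le> (\<Sum>i. (2 powr (- q)) ^ i)"
    using lt1 fin by (intro sum_le_suminf summable_geometric) auto
  also have "\<dots> = 1 / (1 - 2 powr (- q))" using lt1 by (intro suminf_geometric) simp
  finally have "(\<Sum>k\<in>Ks. (2 powr real_of_int k) powr q) \<le> (2 powr real_of_int m) powr q * (1 / (1 - 2 powr (- q)))" by simp
  also have "\<dots> \<le> Y powr q * (1 / (1 - 2 powr (- q)))"
    using Y[OF m(1)] q lt1 by (intro mult_right_mono powr_mono2) auto
  finally show ?thesis by simp
qed

text \<open>The truncation of the Marcinkiewicz theorem: values up to s add at most s to any
  average, so an average above 2 s forces that of the tall part above s.\<close>

lemma level_set_split:
  assumes W: "weak_bound x0 h B" and F: "\<And>z. F z \<ge> 0" and s: "s > 0" and Z: "finite {z. F z > s}"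
  shows "finite (level_set x0 h F (2 * s))" "real (card (level_set x0 h F (2 * s))) \<le> B * (\<Sum>z | F z > s. F z) / s"
proof -
  define F' where "F' z = (if F z > s then F z else 0)" for z
  have sub: "level_set x0 h F (2 * s) \<subseteq> level_set x0 h F' s"
  proof
    fix x assume "x \<in> level_set x0 h F (2 * s)"
    then obtain N where N: "N \<ge> 1" "N_set x0 h \<inter> {1..N} \<noteq> {}" "half_avg x0 h N F x > 2 * s" by (auto simp: level_set_def)
    have "half_avg x0 h N F x \<le> half_avg x0 h N (\<lambda>z. F' z + s) x"
      by (rule half_avg_mono) (use s in \<open>auto simp: F'_def\<close>)
    also have "\<dots> = half_avg x0 h N F' x + half_avg x0 h N (\<lambda>z. s) x" by (rule half_avg_add)
    also have "half_avg x0 h N (\<lambda>z. s) x \<le> s" using s by (intro half_avg_const) simp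
    finally have "half_avg x0 h N F' x > s" using N(3) by linarith
    then show "x \<in> level_set x0 h F' s" using N by (auto simp: level_set_def)
  qed
  have "\<forall>z. z \<notin> {z. F z > s} \<longrightarrow> F' z = 0" "\<forall>z. F' z \<ge> 0" using F by (auto simp: F'_def)
  then have W': "finite (level_set x0 h F' s)" "real (card (level_set x0 h F' s)) \<le> B * (\<Sum>z | F z > s. F' z) / s"
    using W Z s unfolding weak_bound_def by blast+
  show "finite (level_set x0 h F (2 * s))" by (rule finite_subset[OF sub W'(1)])
  have "(\<Sum>z | F z > s. F' z) = (\<Sum>z | F z > s. F z)" by (intro sum.cong) (auto simp: F'_def)
  then show "real (card (level_set x0 h F (2 * s))) \<le> B * (\<Sum>z | F z > s. F z) / s"
    using W'(2) card_mono[OF W'(1) sub] by simp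
qed

text \<open>Marcinkiewicz interpolation with dyadic layers. On the layer 2^j < G <= 2^(j+1) the
  function is split at 2^(j-1), and the p-th power of 2^(j+1) / 2^(j-1) is the factor 4^p.
  Exchanging the sums leaves, for each z, a geometric series over the j with 2^(j-1) < F z.\<close>

lemma sum_powr_le:
  fixes F G :: "int \<Rightarrow> real"
  assumes W: "weak_bound x0 h B" and B: "B > 0" and F: "\<And>z. F z \<ge> 0" and p: "p > 1"
    and K: "\<And>J. finite J \<Longrightarrow> (\<Sum>z\<in>J. F z powr p) \<le> K"
    and G: "\<And>x. G x \<ge> 0" "\<And>x s. s > 0 \<Longrightarrow> G x > s \<Longrightarrow> x \<in> level_set x0 h F s" and X: "finite X"
  shows "(\<Sum>x\<in>X. G x powr p) \<le> 4 powr p * B / (1 - 2 powr (1 - p)) * K"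
proof -
  have K0: "K \<ge> 0" using K[of "{}"] by simp
  define X' where "X' = {x\<in>X. G x > 0}"
  \<comment> \<open>Ceiling minus one makes the lower inequality 2^k < G x strict, as membership in
    a level set requires.\<close>
  define k where "k x = \<lceil>log 2 (G x)\<rceil> - 1" for x
  define e where "e j = 2 powr real_of_int j" for j :: int
  have e0: "e j > 0" for j by (simp add: e_def)
  have e_add: "e (j + 1) = 2 * e j" for j by (simp add: e_def powr_add)
  have kx: "e (k x) < G x" "G x \<le> e (k x + 1)" if "x \<in> X'" for x
  proof -
    have g: "G x > 0" using that by (simp add: X'_def)
    have "real_of_int (k x) < log 2 (G x)" "log 2 (G x) \<le> real_of_int (k x + 1)" unfolding k_def by linarith+
    then show "e (k x) < G x" "G x \<le> e (k x + 1)" unfolding e_def using g by (simp_all add: less_log_iff log_le_iff)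
  qed
  define Z where "Z j = {z. F z > e (j - 1)}" for j
  \<comment> \<open>Markov's inequality for the p-th power of F; finiteness is needed to apply the
    bound for finitely supported functions to the tall part.\<close>
  have finZ: "finite (Z j)" for j
  proof -
    have "finite (Z j) \<and> card (Z j) \<le> nat \<lfloor>K / e (j - 1) powr p\<rfloor>"
    proof (rule finite_if_finite_subsets_card_bdd)
      fix J assume J: "J \<subseteq> Z j" "finite J"
      have "real (card J) * e (j - 1) powr p = (\<Sum>z\<in>J. e (j - 1) powr p)" by simp
      also have "\<dots> \<le> (\<Sum>z\<in>J. F z powr p)"
        using J(1) e0[of "j - 1"] p by (intro sum_mono powr_mono2) (auto simp: Z_def)
      also have "\<dots> \<le> K" by (rule K[OF J(2)])
      finally have "real (card J) \<le> K / e (j - 1) powr p" using e0[of "j - 1"] by (simp add: pos_le_divide_eq)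
      then show "card J \<le> nat \<lfloor>K / e (j - 1) powr p\<rfloor>" by linarith
    qed
    then show ?thesis by simp
  qed
  define Ks where "Ks = k ` X'"
  have finK: "finite Ks" unfolding Ks_def X'_def using X by simp
  have "(\<Sum>x\<in>X. G x powr p) = (\<Sum>x\<in>X'. G x powr p)"
    using X G(1) by (intro sum.mono_neutral_right) (auto simp: X'_def not_less intro: antisym)
  also have "\<dots> = (\<Sum>j\<in>Ks. \<Sum>x\<in>{x\<in>X'. k x = j}. G x powr p)"
    using X by (intro sum.group[symmetric]) (auto simp: Ks_def X'_def)
  also have "\<dots> \<le> (\<Sum>j\<in>Ks. 4 powr p * B * (e (j - 1) powr (p - 1) * (\<Sum>z\<in>Z j. F z)))"
  proof (rule sum_mono)
    fix j assume "j \<in> Ks"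
    have lev: "finite (level_set x0 h F (e j))" "real (card (level_set x0 h F (e j))) \<le> B * (\<Sum>z\<in>Z j. F z) / e (j - 1)"
      using level_set_split[OF W F e0[of "j - 1"]] finZ[of j] e_add[of "j - 1"] by (simp_all add: Z_def)
    have "(\<Sum>x\<in>{x\<in>X'. k x = j}. G x powr p) \<le> (\<Sum>x\<in>{x\<in>X'. k x = j}. e (j + 1) powr p)"
      using kx(2) p by (intro sum_mono powr_mono2) (auto simp: X'_def less_imp_le)
    also have "\<dots> = real (card {x\<in>X'. k x = j}) * e (j + 1) powr p" by simp
    also have "\<dots> \<le> real (card (level_set x0 h F (e j))) * e (j + 1) powr p"
    proof (rule mult_right_mono)
      have "{x\<in>X'. k x = j} \<subseteq> level_set x0 h F (e j)" using kx(1) G(2)[OF e0] by blast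
      then show "real (card {x\<in>X'. k x = j}) \<le> real (card (level_set x0 h F (e j)))" using card_mono[OF lev(1)] by simp
    qed simp
    also have "\<dots> \<le> B * (\<Sum>z\<in>Z j. F z) / e (j - 1) * e (j + 1) powr p" using lev(2) by (intro mult_right_mono) auto
    also have "e (j + 1) powr p = 4 powr p * e (j - 1) powr p"
      using e_add[of j] e_add[of "j - 1"] e0[of "j - 1"] by (simp flip: powr_mult)
    also have "B * (\<Sum>z\<in>Z j. F z) / e (j - 1) * (4 powr p * e (j - 1) powr p) = 4 powr p * B * (e (j - 1) powr (p - 1) * (\<Sum>z\<in>Z j. F z))"
      using e0[of "j - 1"] by (simp add: powr_diff)
    finally show "(\<Sum>x\<in>{x\<in>X'. k x = j}. G x powr p) \<le> 4 powr p * B * (e (j - 1) powr (p - 1) * (\<Sum>z\<in>Z j. F z))" .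
  qed
  also have "\<dots> = 4 powr p * B * (\<Sum>j\<in>Ks. \<Sum>z\<in>Z j. e (j - 1) powr (p - 1) * F z)"
    by (simp only: sum_distrib_left)
  also have "(\<Sum>j\<in>Ks. \<Sum>z\<in>Z j. e (j - 1) powr (p - 1) * F z) = (\<Sum>z\<in>(\<Union>j\<in>Ks. Z j). \<Sum>j\<in>{j\<in>Ks. z \<in> Z j}. e (j - 1) powr (p - 1) * F z)"
  proof -
    have "(\<Sum>j\<in>Ks. \<Sum>z\<in>Z j. e (j - 1) powr (p - 1) * F z) = (\<Sum>j\<in>Ks. \<Sum>z\<in>{z\<in>(\<Union>j\<in>Ks. Z j). z \<in> Z j}. e (j - 1) powr (p - 1) * F z)"
      by (intro sum.cong refl) auto
    also have "\<dots> = (\<Sum>z\<in>(\<Union>j\<in>Ks. Z j). \<Sum>j\<in>{j\<in>Ks. z \<in> Z j}. e (j - 1) powr (p - 1) * F z)"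
      using finK finZ by (intro sum.swap_restrict) auto
    finally show ?thesis .
  qed
  also have "\<dots> \<le> (\<Sum>z\<in>(\<Union>j\<in>Ks. Z j). F z powr p / (1 - 2 powr (1 - p)))"
  proof (rule sum_mono)
    fix z assume "z \<in> (\<Union>j\<in>Ks. Z j)"
    then obtain j where "z \<in> Z j" by blast
    then have Fz: "F z > 0" using e0[of "j - 1"] by (simp add: Z_def)
    have "(\<Sum>j\<in>{j\<in>Ks. z \<in> Z j}. e (j - 1) powr (p - 1)) = (\<Sum>j\<in>(\<lambda>j. j - 1) ` {j\<in>Ks. z \<in> Z j}. (2 powr real_of_int j) powr (p - 1))"
      by (subst sum.reindex) (auto simp: inj_on_def e_def)
    also have "\<dots> \<le> F z powr (p - 1) / (1 - 2 powr (- (p - 1)))"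
      using finK p by (intro sum_dyadic_powr_le) (auto simp: Z_def e_def)
    finally have "(\<Sum>j\<in>{j\<in>Ks. z \<in> Z j}. e (j - 1) powr (p - 1)) * F z \<le> F z powr (p - 1) / (1 - 2 powr (- (p - 1))) * F z"
      using Fz by (intro mult_right_mono) auto
    also have "\<dots> = F z powr p / (1 - 2 powr (1 - p))" using Fz by (simp add: powr_diff)
    finally show "(\<Sum>j\<in>{j\<in>Ks. z \<in> Z j}. e (j - 1) powr (p - 1) * F z) \<le> F z powr p / (1 - 2 powr (1 - p))"
      by (simp add: sum_distrib_right)
  qed
  also have "\<dots> = (\<Sum>z\<in>(\<Union>j\<in>Ks. Z j). F z powr p) / (1 - 2 powr (1 - p))" by (simp only: sum_divide_distrib)
  finally have "(\<Sum>x\<in>X. G x powr p) \<le> 4 powr p * B * ((\<Sum>z\<in>(\<Union>j\<in>Ks. Z j). F z powr p) / (1 - 2 powr (1 - p)))"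
    using B by (simp add: mult_left_mono)
  also have "\<dots> \<le> 4 powr p * B * (K / (1 - 2 powr (1 - p)))"
  proof (intro mult_left_mono divide_right_mono)
    show "(\<Sum>z\<in>(\<Union>j\<in>Ks. Z j). F z powr p) \<le> K" by (rule K) (use finK finZ in auto)
    have "2 powr (1 - p) < 2 powr (0::real)" using p by (intro powr_less_mono) auto
    then show "0 \<le> 1 - 2 powr (1 - p)" by simp
  qed (use B in auto)
  finally show ?thesis by simp
qed

theorem strong_type_maximal:
  assumes W: "weak_bound x0 h B" and B: "B > 0"
    and \<eta>: "closure {x. \<eta> x \<noteq> 0} \<subseteq> {1/2<..<4}" "\<forall>x. 0 \<le> \<eta> x \<and> \<eta> x \<le> 1" and p: "p > 1" and f: "f \<in> lp_space p"
  shows "lp_norm p (maximal x0 h \<eta> f) \<le> ennreal ((4 powr p * B / (1 - 2 powr (1 - p))) powr (1 / p)) * lp_norm p (modulus f)"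
proof -
  define A where "A = 4 powr p * B / (1 - 2 powr (1 - p))"
  have "2 powr (1 - p) < 2 powr (0::real)" using p by (intro powr_less_mono) auto
  then have A: "A > 0" using B by (simp add: A_def)
  define F where "F z = cmod (f z)" for z
  define P where "P = (\<integral>\<^sup>+ x. ennreal (F x powr p) \<partial>count_space UNIV)"
  have P: "lp_norm p (modulus f) = epowr P (1 / p)" by (simp add: lp_norm_def modulus_def P_def F_def epowr_ennreal)
  have fin: "P < \<infinity>"
  proof (rule ccontr)
    assume "\<not> P < \<infinity>"
    then have "P = \<infinity>" by (metis less_top infinity_ennreal_def)
    then show False using f P by (simp add: lp_space_def epowr_def)
  qed
  define K where "K = enn2real P"
  have PK: "P = ennreal K" and K0: "K \<ge> 0" using fin by (simp_all add: K_def less_top)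
  have K: "(\<Sum>z\<in>J. F z powr p) \<le> K" if "finite J" for J
  proof -
    have "ennreal (\<Sum>z\<in>J. F z powr p) = (\<Sum>z\<in>J. ennreal (F z powr p))" by (simp add: sum_ennreal)
    also have "\<dots> \<le> P" unfolding P_def by (rule sum_le_nn_integral_count_space[OF that])
    finally show ?thesis unfolding PK using K0 by (simp add: ennreal_le_iff)
  qed
  have F0: "F z \<ge> 0" for z by (simp add: F_def)
  \<comment> \<open>A function in l^p is bounded, so the maximal function is finite everywhere and
    \<open>enn2real\<close> loses nothing.\<close>
  have Fle: "F z \<le> K powr (1 / p)" for z
  proof -
    have "F z powr p \<le> K" using K[of "{z}"] by simp
    then have "(F z powr p) powr (1 / p) \<le> K powr (1 / p)" using p by (intro powr_mono2) auto
    then show ?thesis using p F0[of z] by (simp add: powr_powr)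
  qed
  define G where "G x = enn2real (maximal x0 h \<eta> f x)" for x
  have MG: "maximal x0 h \<eta> f x = ennreal (G x)" for x
  proof -
    have "maximal x0 h \<eta> f x \<le> ennreal (K powr (1 / p))" by (rule maximal_le[OF \<eta>]) (use Fle in \<open>simp add: F_def\<close>)
    then have "maximal x0 h \<eta> f x < \<infinity>" by (rule le_less_trans) simp
    then show ?thesis by (simp add: G_def less_top)
  qed
  have G0: "G x \<ge> 0" for x by (simp add: G_def)
  have Glev: "x \<in> level_set x0 h F s" if "s > 0" "G x > s" for x s
  proof -
    have "maximal x0 h \<eta> f x > ennreal s" unfolding MG using that by (simp add: ennreal_less_iff)
    then show ?thesis using maximal_greater[OF \<eta>] that unfolding F_def by simp
  qed
  have "(\<integral>\<^sup>+ x. epowr (maximal x0 h \<eta> f x) p \<partial>count_space UNIV) \<le> ennreal (A * K)"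
  proof (rule nn_integral_count_space_int_le)
    fix J :: "int set" assume J: "finite J"
    have "(\<Sum>x\<in>J. epowr (maximal x0 h \<eta> f x) p) = ennreal (\<Sum>x\<in>J. G x powr p)"
      by (simp add: MG epowr_ennreal G0 sum_ennreal)
    also have "\<dots> \<le> ennreal (A * K)"
      unfolding A_def by (rule ennreal_leI[OF sum_powr_le[OF W B F0 p K G0 Glev J]])
    finally show "(\<Sum>x\<in>J. epowr (maximal x0 h \<eta> f x) p) \<le> ennreal (A * K)" .
  qed
  then obtain v where v: "(\<integral>\<^sup>+ x. epowr (maximal x0 h \<eta> f x) p \<partial>count_space UNIV) = ennreal v" "0 \<le> v" "v \<le> A * K"
    using A K0 by (cases "\<integral>\<^sup>+ x. epowr (maximal x0 h \<eta> f x) p \<partial>count_space UNIV") (auto simp: top_unique)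
  have "lp_norm p (maximal x0 h \<eta> f) = ennreal (v powr (1 / p))" unfolding lp_norm_def v(1) by (rule epowr_ennreal[OF v(2)])
  also have "\<dots> \<le> ennreal ((A * K) powr (1 / p))" using v p by (intro ennreal_leI powr_mono2) auto
  also have "\<dots> = ennreal (A powr (1 / p)) * lp_norm p (modulus f)"
    unfolding P PK epowr_ennreal[OF K0] using A K0 by (simp add: powr_mult ennreal_mult)
  finally show ?thesis unfolding A_def .
qed

theorem theorem1p7:
  fixes c x0 :: real and h \<eta> :: "real \<Rightarrow> real"
  assumes "1 < c" and "c < 30 / 29"
    and "in_F c x0 h"
    and "smooth \<eta>"
    and "closure {x. \<eta> x \<noteq> 0} \<subseteq> {1/2<..<4}"
    and "\<forall>x\<in>{1..2}. \<eta> x = 1"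
    and "\<forall>x. 0 \<le> \<eta> x \<and> \<eta> x \<le> 1"
  shows "(\<exists>C::real. C > 0 \<and> (\<forall>f\<in>lp_space 1.
            weak_l1_norm (maximal x0 h \<eta> f) \<le> ennreal C * lp_norm 1 (modulus f))) \<and>
         (\<forall>p::real. p > 1 \<longrightarrow> (\<exists>Cp::real. Cp > 0 \<and> (\<forall>f\<in>lp_space p.
            lp_norm p (maximal x0 h \<eta> f) \<le> ennreal Cp * lp_norm p (modulus f))))"
proof -
  obtain B where B: "B > 0" and W: "weak_bound x0 h B"
    using half_avg_weak_type[OF assms(1-3)] unfolding weak_bound_def level_set_def by blast
  have "(4 powr p * B / (1 - 2 powr (1 - p))) powr (1 / p) > 0" if "p > 1" for p
  proof -
    have "2 powr (1 - p) < 2 powr (0::real)" using that by (intro powr_less_mono) auto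
    then show ?thesis using B that by simp
  qed
  then show ?thesis
    using weak_type_maximal[OF W B assms(5,7)] strong_type_maximal[OF W B assms(5,7)] B by blast
qed

end
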